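(* For all integers $k\ge1$ and $n\ge0$, $$e_4(13^{2k}n+\delta_{13,2k})\equiv0\pmod{13^{2k}}.$$
   Context: $q=e^{2\pi i\tau}$, $(q;q)_\infty=\prod_{n\ge1}(1-q^n)$, $E_4(\tau)=1+240\sum_{n\ge1}\sigma_3(n)q^n$ with $\sigma_3(n)=\sum_{d\mid n}d^3$. The numbers $e_4(n)$ are defined by $\sum_{n\ge0}e_4(n)q^n=E_4(\tau)/(q;q)_\infty$. For a prime $\ell\ge5$ and $k\ge1$, $\delta_{\ell,k}$ is the integer with $0<\delta_{\ell,k}<\ell^k$ and $24\delta_{\ell,k}\equiv1\pmod{\ell^k}$. *)

theory Defs
  imports "HOL-Analysis.Analysis" "HOL-Number_Theory.Number_Theory"
begin

text \<open>All $q$-series are formal power series over the integers, with \<^const>\<open>fps_X\<close> playing the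
  role of $q$.\<close>

definition divisor_sigma :: "nat \<Rightarrow> nat \<Rightarrow> nat" where
  "divisor_sigma k n = (\<Sum>d | d dvd n. d ^ k)"

definition E4_fps :: "int fps" where
  "E4_fps = Abs_fps (\<lambda>n. if n = 0 then 1 else 240 * int (divisor_sigma 3 n))"

text \<open>$(q;q)_\infty$. The factors are indexed from $0$, and the infinite product is taken in the
  topology of coefficientwise convergence; it does converge, see \<open>has_prod_euler_fps\<close>.\<close>

definition euler_fps :: "int fps" where
  "euler_fps = (\<Prod>n. 1 - fps_X ^ Suc n)"

text \<open>Division is not available for power series over the integers, so the quotient
  $E_4/(q;q)_\infty$ is characterised by multiplication; see \<open>ex1_e4\<close> for well-definedness.\<close>

definition e4 :: "nat \<Rightarrow> int" where
  "e4 = (THE e. Abs_fps e * euler_fps = E4_fps)"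

definition delta :: "nat \<Rightarrow> nat \<Rightarrow> nat" where
  "delta l k = (THE d. 0 < d \<and> d < l ^ k \<and> [24 * d = 1] (mod l ^ k))"


lemma euler_partial_nth:
  fixes n N :: nat
  assumes "n \<le> N"
  shows "fps_nth (\<Prod>i\<le>N. 1 - fps_X ^ Suc i :: int fps) n
         = fps_nth (\<Prod>i\<le>n. 1 - fps_X ^ Suc i) n"
  using assms
proof (induction N rule: dec_induct)
  case base
  show ?case by simp
next
  case (step N)
  let ?P = "\<Prod>i\<le>N. 1 - fps_X ^ Suc i :: int fps"
  have "(\<Prod>i\<le>Suc N. 1 - fps_X ^ Suc i :: int fps) = ?P - ?P * fps_X ^ Suc (Suc N)"
    by (simp only: prod.atMost_Suc right_diff_distrib mult_1_right)
  also have "fps_nth \<dots> n = fps_nth ?P n"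
    using step.hyps by (simp only: fps_sub_nth fps_X_power_mult_right_nth) simp
  finally show ?case
    using step.IH by simp
qed

lemma euler_factor_nonzero: "(1 - fps_X ^ Suc i :: int fps) \<noteq> 0"
proof
  assume "(1 - fps_X ^ Suc i :: int fps) = 0"
  hence "fps_nth (1 - fps_X ^ Suc i :: int fps) 0 = 0" by simp
  thus False by simp
qed

lemma has_prod_euler_fps: "(\<lambda>n. 1 - fps_X ^ Suc n :: int fps) has_prod euler_fps"
proof -
  define G :: "int fps" where
    "G = Abs_fps (\<lambda>n. fps_nth (\<Prod>i\<le>n. 1 - fps_X ^ Suc i) n)"
  have "(\<lambda>N. \<Prod>i\<le>N. 1 - fps_X ^ Suc i) \<longlonglongrightarrow> G"
  proof (rule tendsto_fpsI)
    fix n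
    show "\<forall>\<^sub>F N in sequentially. fps_nth (\<Prod>i\<le>N. 1 - fps_X ^ Suc i) n = fps_nth G n"
      using eventually_ge_at_top[of n]
      by (rule eventually_mono) (simp only: G_def fps_nth_Abs_fps, rule euler_partial_nth)
  qed
  moreover have "fps_nth G 0 = 1"
    by (simp add: G_def)
  hence "G \<noteq> 0"
    by auto
  ultimately have "(\<lambda>n. 1 - fps_X ^ Suc n :: int fps) has_prod G"
    by (simp add: has_prod_def raw_has_prod_def)
  moreover have "\<exists>!p. (\<lambda>n. 1 - fps_X ^ Suc n :: int fps) has_prod p"
  proof (rule ex1I)
    show "(\<lambda>n. 1 - fps_X ^ Suc n :: int fps) has_prod G"
      by fact
  next
    fix p :: "int fps"
    assume p: "(\<lambda>n. 1 - fps_X ^ Suc n) has_prod p"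
    from p euler_factor_nonzero have "(\<lambda>N. \<Prod>i\<le>N. 1 - fps_X ^ Suc i) \<longlonglongrightarrow> p"
      unfolding has_prod_def raw_has_prod_def by auto
    with \<open>(\<lambda>N. \<Prod>i\<le>N. 1 - fps_X ^ Suc i) \<longlonglongrightarrow> G\<close> show "p = G"
      using LIMSEQ_unique by blast
  qed
  ultimately show ?thesis
    unfolding euler_fps_def prodinf_def by (metis (no_types, lifting) theI')
qed

lemma euler_fps_nth:
  "fps_nth euler_fps n = fps_nth (\<Prod>i\<le>n. 1 - fps_X ^ Suc i) n"
proof -
  have "(\<lambda>N. \<Prod>i\<le>N. 1 - fps_X ^ Suc i) \<longlonglongrightarrow> euler_fps"
    using has_prod_euler_fps euler_factor_nonzero unfolding has_prod_def raw_has_prod_def by auto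
  hence "\<forall>\<^sub>F N in sequentially. fps_nth (\<Prod>i\<le>N. 1 - fps_X ^ Suc i) n = fps_nth euler_fps n"
    unfolding tendsto_fps_iff by blast
  with eventually_ge_at_top[of n]
  have "\<forall>\<^sub>F N in sequentially.
      fps_nth euler_fps n = fps_nth (\<Prod>i\<le>n. 1 - fps_X ^ Suc i) n"
    by eventually_elim (metis euler_partial_nth)
  thus ?thesis
    by simp
qed

lemma ex1_e4: "\<exists>!e. Abs_fps e * euler_fps = E4_fps"
proof -
  have 1: "fps_nth euler_fps 0 = 1"
    by (simp add: euler_fps_nth)
  hence nz: "euler_fps \<noteq> 0"
    by auto
  define H where "H = E4_fps * fps_right_inverse euler_fps 1"
  have "euler_fps * fps_right_inverse euler_fps 1 = 1"
    by (rule fps_right_inverse) (simp add: 1)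
  hence H: "H * euler_fps = E4_fps"
    unfolding H_def by (metis mult.assoc mult.commute mult_1_right)
  show ?thesis
  proof (rule ex1I)
    show "Abs_fps (fps_nth H) * euler_fps = E4_fps"
      by (simp add: fps_nth_inverse H)
  next
    fix e
    assume "Abs_fps e * euler_fps = E4_fps"
    with H nz have "Abs_fps e = H"
      by (metis mult_right_cancel)
    thus "e = fps_nth H"
      by (auto simp: fun_eq_iff)
  qed
qed

lemma e4_generating_function: "Abs_fps e4 * euler_fps = E4_fps"
  unfolding e4_def by (rule theI'[OF ex1_e4])

lemma ex1_delta:
  fixes l k :: nat
  assumes "prime l" "l \<ge> 5" "k \<ge> 1"
  shows "\<exists>!d. 0 < d \<and> d < l ^ k \<and> [24 * d = 1] (mod l ^ k)"
proof -
  have "\<not> l dvd 24"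
  proof
    assume "l dvd 24"
    hence "l dvd 2 ^ 3 * 3" by simp
    hence "l dvd 2 \<or> l dvd 3"
      using assms(1) prime_dvd_mult_iff[of l "2 ^ 3" 3] prime_dvd_power[of l 2 3] by blast
    thus False
      using assms(2) by (auto dest: dvd_imp_le)
  qed
  hence cop: "coprime 24 (l ^ k)"
    using prime_imp_coprime[OF assms(1), of 24] coprime_commute[of l 24] by simp
  have big: "l ^ k > 1"
    using assms by (intro one_less_power) auto
  obtain x where x: "[24 * x = 1] (mod l ^ k)"
    using cong_solve_coprime_nat[OF cop] by auto
  show ?thesis
  proof (rule ex1I)
    have c: "[24 * (x mod l ^ k) = 1] (mod l ^ k)"
      using x by (simp add: cong_def mod_mult_right_eq)
    have "x mod l ^ k \<noteq> 0"
    proof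
      assume "x mod l ^ k = 0"
      with c big show False by (auto simp: cong_def)
    qed
    thus "0 < x mod l ^ k \<and> x mod l ^ k < l ^ k \<and> [24 * (x mod l ^ k) = 1] (mod l ^ k)"
      using c big mod_less_divisor[of "l ^ k" x] by linarith
  next
    fix d
    assume d: "0 < d \<and> d < l ^ k \<and> [24 * d = 1] (mod l ^ k)"
    hence "[24 * d = 24 * x] (mod l ^ k)"
      using x by (metis cong_sym cong_trans)
    hence "[d = x] (mod l ^ k)"
      using cop by (simp add: cong_mult_lcancel_nat)
    thus "d = x mod l ^ k"
      using d by (simp add: cong_def)
  qed
qed

end

theory Submission
  imports Defs "HOL-Complex_Analysis.Complex_Analysis"
begin

text \<open>
  Put $f = E_4/\eta$, a weakly holomorphic form of weight $7/2$ for $SL_2(\mathbb{Z})$ with the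
  multiplier of $1/\eta$, with coefficients $a(24n-1) = e_4(n)$. The Hecke operator $T = T(13^2)$,
  $(Ta)(r) = a(13^2 r) \pm 13^2 (r/13) a(r) + 13^5 a(r/13^2)$,
  preserves the space of such forms. A form in it is determined by its coefficients of negative
  index, and for every $j$ there is a form $f_j$ with integral coefficients whose only nonzero
  coefficient of negative index is a $1$ at $-13^{2j}$; in particular $f_0 = f$. Comparing
  coefficients of negative index gives $T f_0 = 13^5 f_1 \pm 13^2 f_0$ and
  $T f_{j+1} = 13^5 f_{j+2} + f_j$, and by induction on $k$ the coefficient of $f_j$ at $13^{2k} m$
  is divisible by $13^{2(k-j)}$. The case $j = 0$ is the theorem.

  The modularity of $E_4$ and $\eta$ comes from the Lipschitz formula for lattice sums. That $T$
  commutes with $\tau \mapsto -1/\tau$ requires the multipliers of finitely many matrices of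
  determinant $1$, which are computed from continued fractions.
\<close>

section \<open>The Lipschitz formula\<close>

text \<open>The form f is not an eigenform: the term a(r/13^2) of T creates a new pole, so no
  relation closes up on f alone and the whole sequence f_j has to be carried along. That the
  negative indices determine a form is a matter of weight: all indices are -1 modulo 24, so a form
  without negative ones vanishes at the cusp to order at least 23/24, more than the 7/24 that weight
  7/2 permits. The forms f_j are integral because they are obtained by elimination among E_4/eta
  times powers of E_4^3/Delta, which have leading coefficient 1. The law for eta comes from
  integrating the inversion formula of E_2, the logarithmic derivative of eta, whose failure to be
  modular produces the square root. The obstacle is half-integral weight: square roots multiply only
  up to a root of unity, so the multiplier of a matrix is accumulated along a word in the
  generators, with every square root taken in the right half-plane where its branch is under
  control.\<close>

definition qexp :: "complex \<Rightarrow> complex" where "qexp z = exp (2 * pi * \<i> * z)"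

lemma qexp_nonzero [simp]: "qexp z \<noteq> 0" by (simp add: qexp_def)

lemma qexp_add: "qexp (y + z) = qexp y * qexp z"
  by (simp add: qexp_def ring_distribs exp_add)

lemma qexp_of_int [simp]: "qexp (of_int n) = 1"
proof -
  have "Im (2 * pi * \<i> * of_int n) = of_int (2 * n) * pi" by simp
  then show ?thesis unfolding qexp_def exp_eq_1 by (intro conjI exI) auto
qed

lemma qexp_eq_1_iff: "qexp z = 1 \<longleftrightarrow> z \<in> \<int>"
proof
  assume "qexp z = 1"
  then obtain n where n: "Re (2 * pi * \<i> * z) = 0" "Im (2 * pi * \<i> * z) = of_int (2 * n) * pi"
    unfolding qexp_def exp_eq_1 by auto
  then have "z = of_int n" by (simp add: complex_eq_iff)
  then show "z \<in> \<int>" by simp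
qed (auto elim: Ints_cases)

lemma qexp_of_nat_mult: "qexp (of_nat n * z) = qexp z ^ n"
  by (simp add: qexp_def flip: exp_of_nat_mult) (simp add: mult_ac)

lemma norm_qexp: "norm (qexp z) = exp (- 2 * pi * Im z)"
  by (simp add: qexp_def norm_exp_eq_Re)

lemma norm_qexp_less_1_iff [simp]: "norm (qexp z) < 1 \<longleftrightarrow> Im z > 0"
  by (simp add: norm_qexp zero_less_mult_iff)

lemma has_field_derivative_qexp [derivative_intros]:
  assumes "(f has_field_derivative f') (at z within A)"
  shows "((\<lambda>z. qexp (f z)) has_field_derivative 2 * pi * \<i> * f' * qexp (f z)) (at z within A)"
  unfolding qexp_def by (rule derivative_eq_intros assms refl)+ simp

lemma open_non_Ints: "open (- \<int> :: complex set)"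
  using closed_Ints by blast

text \<open>Logarithmic derivative of Euler's reflection formula for Gamma. The cotangent is
  expressed as a rational function of \<open>qexp z\<close>, a shape that further differentiation
  preserves.\<close>

lemma Digamma_reflection:
  assumes z: "z \<notin> \<int>"
  shows "Digamma (1 - z) - Digamma z = pi * \<i> * (qexp z + 1) / (qexp z - 1)"
proof -
  have nz: "z \<notin> \<int>\<^sub>\<le>\<^sub>0" "1 - z \<notin> \<int>\<^sub>\<le>\<^sub>0" "1 - z \<notin> \<int>"
    using z nonpos_Ints_Int by (auto simp: minus_in_Ints_iff) 
  have s: "sin (pi * z) \<noteq> 0"
  proof
    assume "sin (pi * z) = 0"
    then have "Gamma z * Gamma (1 - z) = 0" using Gamma_reflection_complex[of z] by simp
    then show False using nz by (simp add: Gamma_eq_zero_iff)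
  qed
  have "((\<lambda>z. Gamma z * Gamma (1 - z)) has_field_derivative
      Gamma z * Gamma (1 - z) * (Digamma z - Digamma (1 - z))) (at z)"
    by (rule derivative_eq_intros refl nz)+ (simp add: algebra_simps)
  moreover have "((\<lambda>z. pi / sin (pi * z)) has_field_derivative
      - (pi / sin (pi * z)) * (pi * cos (pi * z) / sin (pi * z))) (at z)"
    by (rule derivative_eq_intros refl s)+ (use s in \<open>simp add: field_simps power2_eq_square\<close>)
  ultimately have "Gamma z * Gamma (1 - z) * (Digamma z - Digamma (1 - z)) =
     - (pi / sin (pi * z)) * (pi * cos (pi * z) / sin (pi * z))"
    by (subst (asm) Gamma_reflection_complex) (metis DERIV_unique)
  then have "(pi / sin (pi * z)) * (Digamma z - Digamma (1 - z))
      = (pi / sin (pi * z)) * (- (pi * cos (pi * z) / sin (pi * z)))"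
    unfolding Gamma_reflection_complex by simp
  then have "Digamma z - Digamma (1 - z) = - (pi * cos (pi * z) / sin (pi * z))"
    using s by (subst (asm) mult_left_cancel) auto
  also have "pi * cos (pi * z) / sin (pi * z) = pi * \<i> * (qexp z + 1) / (qexp z - 1)"
  proof -
    define u where "u = exp (\<i> * (pi * z))"
    have u: "u \<noteq> 0" "exp (-(\<i> * (pi * z))) = inverse u" by (auto simp: u_def exp_minus)
    have "qexp z = u ^ 2" unfolding u_def qexp_def exp_double [symmetric] by (simp add: mult_ac)
    then have w: "qexp z + 1 = u * (u + inverse u)" "qexp z - 1 = u * (u - inverse u)"
      using u(1) by (simp_all add: power2_eq_square distrib_left right_diff_distrib)
    have "pi * \<i> * (qexp z + 1) / (qexp z - 1) = pi * \<i> * (u + inverse u) / (u - inverse u)"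
      unfolding w mult.left_commute[of _ u] using u(1) by (rule mult_divide_mult_cancel_left)
    moreover have "cos (pi * z) = (u + inverse u) / 2" "sin (pi * z) = (u - inverse u) / (2 * \<i>)"
      unfolding cos_exp_eq sin_exp_eq using u by (simp_all add: u_def)
    moreover have "pi * (x / 2) / (y / (2 * \<i>)) = pi * \<i> * x / y" for x y :: complex
      by (simp add: field_simps)
    ultimately show ?thesis
      by (simp only:)
  qed
  finally show ?thesis by (simp add: algebra_simps)
qed

text \<open>Differentiating \<open>Polygamma n (1 - z)\<close> produces a minus sign, hence the
  change from \<open>s\<close> to \<open>- s\<close>. The identity may be differentiated because it
  holds on the open complement of the integers.\<close>

lemma Polygamma_reflection_step:
  assumes eq: "\<And>z::complex. z \<notin> \<int> \<Longrightarrow> s * Polygamma n (1 - z) - Polygamma n z = f z"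
    and f: "\<And>z. z \<notin> \<int> \<Longrightarrow> (f has_field_derivative f' z) (at z)"
    and z: "z \<notin> \<int>"
  shows "- s * Polygamma (Suc n) (1 - z) - Polygamma (Suc n) z = f' z"
proof -
  have nz: "z \<notin> \<int>\<^sub>\<le>\<^sub>0" "1 - z \<notin> \<int>\<^sub>\<le>\<^sub>0"
    using z nonpos_Ints_Int by (auto simp: minus_in_Ints_iff)
  have "((\<lambda>z. s * Polygamma n (1 - z) - Polygamma n z) has_field_derivative
     - s * Polygamma (Suc n) (1 - z) - Polygamma (Suc n) z) (at z)"
    by (rule derivative_eq_intros refl nz)+ simp
  moreover have "((\<lambda>z. s * Polygamma n (1 - z) - Polygamma n z) has_field_derivative f' z) (at z)"
    by (rule DERIV_cong_ev[THEN iffD2, OF refl _ refl f[OF z]])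
       (use eq z open_non_Ints in \<open>auto simp: eventually_nhds\<close>)
  ultimately show ?thesis by (rule DERIV_unique)
qed

lemma rational_deriv_0:
  assumes w: "w \<noteq> 1"
  shows "((\<lambda>w::complex. pi * \<i> * (w + 1) / (w - 1)) has_field_derivative
     - (2 * pi * \<i>) / (1 - w)^2) (at w)"
proof -
  have "((\<lambda>w::complex. pi * \<i> * (w + 1) / (w - 1)) has_field_derivative
     (pi * \<i> * (w - 1) - pi * \<i> * (w + 1)) / ((w - 1) * (w - 1))) (at w)"
    by (rule derivative_eq_intros refl)+ (use w in auto)
  also have "pi * \<i> * (w - 1) - pi * \<i> * (w + 1) = - (2 * pi * \<i>)"
    by (simp add: algebra_simps)
  also have "(w - 1) * (w - 1) = (1 - w)^2"
    by (simp add: power2_eq_square algebra_simps)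
  finally show ?thesis .
qed

text \<open>Up to a factor w, the passage from the series of n w^n to that of n^2 w^n. It serves
  twice: for the Polygamma functions through w = \<open>qexp z\<close>, and for the power sums in
  \<open>power_sums_has_sum\<close>.\<close>

lemma rational_deriv_1:
  assumes w: "w \<noteq> 1"
  shows "((\<lambda>w::complex. w / (1 - w)^2) has_field_derivative (1 + w) / (1 - w)^3) (at w)"
proof -
  have "((\<lambda>w::complex. w / (1 - w)^2) has_field_derivative
      ((1 - w)^2 + w * (2 * (1 - w))) / ((1 - w)^2 * (1 - w)^2)) (at w)"
    by (rule derivative_eq_intros refl)+ (use w in \<open>auto simp: algebra_simps\<close>)
  also have "(1 - w)^2 + w * (2 * (1 - w)) = (1 - w) * (1 + w)"
    by (simp add: power2_eq_square algebra_simps)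
  also have "(1 - w)^2 * (1 - w)^2 = (1 - w) * (1 - w)^3"
    by (simp add: power2_eq_square power3_eq_cube)
  also have "(1 - w) * (1 + w) / ((1 - w) * (1 - w)^3) = (1 + w) / (1 - w)^3"
    using w by (intro mult_divide_mult_cancel_left) auto
  finally show ?thesis .
qed

lemma rational_deriv_2:
  assumes w: "w \<noteq> 1"
  shows "((\<lambda>w::complex. w * (1 + w) / (1 - w)^3) has_field_derivative
     (1 + 4 * w + w^2) / (1 - w)^4) (at w)"
proof -
  have "((\<lambda>w::complex. w * (1 + w) / (1 - w)^3) has_field_derivative
      ((1 + 2 * w) * (1 - w)^3 + w * (1 + w) * (3 * (1 - w)^2)) / ((1 - w)^3 * (1 - w)^3)) (at w)"
    by (rule derivative_eq_intros refl)+ (use w in \<open>auto simp: algebra_simps\<close>)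
  also have "(1 + 2 * w) * (1 - w)^3 + w * (1 + w) * (3 * (1 - w)^2) = (1 - w)^2 * (1 + 4 * w + w^2)"
    by (simp add: power2_eq_square power3_eq_cube algebra_simps)
  also have "(1 - w)^3 * (1 - w)^3 = (1 - w)^2 * (1 - w)^4"
    by (simp flip: power_add)
  also have "(1 - w)^2 * (1 + 4 * w + w^2) / ((1 - w)^2 * (1 - w)^4) = (1 + 4 * w + w^2) / (1 - w)^4"
    using w by (intro mult_divide_mult_cancel_left) auto
  finally show ?thesis .
qed

lemma DERIV_qexp: "(qexp has_field_derivative 2 * pi * \<i> * qexp z) (at z)"
  by (rule derivative_eq_intros refl)+ simp

text \<open>Repeated differentiation of the Digamma reflection: after an odd number of steps the
  sign turns the difference into a sum, and each chain rule through \<open>qexp\<close> contributes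
  a factor 2 pi i.\<close>

lemma Polygamma_reflection_1_3:
  assumes z: "z \<notin> \<int>"
  defines "w \<equiv> qexp z"
  shows "Polygamma 1 (1 - z) + Polygamma 1 z = (2 * pi * \<i>)^2 * (w / (1 - w)^2)"
    and "Polygamma 3 (1 - z) + Polygamma 3 z = (2 * pi * \<i>)^4 * (w * (1 + 4 * w + w^2) / (1 - w)^4)"
proof -
  have w: "qexp z \<noteq> 1" if "z \<notin> \<int>" for z using that qexp_eq_1_iff by auto
  define c where "c = 2 * pi * \<i>"
  have 1: "(- 1) * Polygamma (Suc 0) (1 - z) - Polygamma (Suc 0) z = - (c / (1 - qexp z)^2) * (c * qexp z)"
    if z: "z \<notin> \<int>" for z
  proof (rule Polygamma_reflection_step[OF _ _ z])
    show "1 * Digamma (1 - z) - Digamma z = pi * \<i> * (qexp z + 1) / (qexp z - 1)" if "z \<notin> \<int>" for z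
      using Digamma_reflection[OF that] by simp
    show "((\<lambda>z. pi * \<i> * (qexp z + 1) / (qexp z - 1)) has_field_derivative
        - (c / (1 - qexp z)^2) * (c * qexp z)) (at z)" if "z \<notin> \<int>" for z
      using DERIV_chain2[OF rational_deriv_0[OF w[OF that]] DERIV_qexp] by (simp add: c_def)
  qed
  have 2: "- (-1) * Polygamma (Suc (Suc 0)) (1 - z) - Polygamma (Suc (Suc 0)) z
      = - (c^2) * ((1 + qexp z) / (1 - qexp z)^3 * (c * qexp z))"
    if z: "z \<notin> \<int>" for z
  proof (rule Polygamma_reflection_step[OF _ _ z])
    show "(- 1) * Polygamma (Suc 0) (1 - z) - Polygamma (Suc 0) z = - (c^2) * (qexp z / (1 - qexp z)^2)"
      if "z \<notin> \<int>" for z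
      using 1[OF that] by (simp add: power2_eq_square)
    show "((\<lambda>z. - (c^2) * (qexp z / (1 - qexp z)^2)) has_field_derivative
        - (c^2) * ((1 + qexp z) / (1 - qexp z)^3 * (c * qexp z))) (at z)" if "z \<notin> \<int>" for z
      using DERIV_cmult[OF DERIV_chain2[OF rational_deriv_1[OF w[OF that]] DERIV_qexp], of "- (c^2)"]
      by (simp add: c_def)
  qed
  have 3: "(- 1) * Polygamma (Suc (Suc (Suc 0))) (1 - z) - Polygamma (Suc (Suc (Suc 0))) z
      = - (c^3) * ((1 + 4 * qexp z + (qexp z)^2) / (1 - qexp z)^4 * (c * qexp z))"
    if z: "z \<notin> \<int>" for z
  proof (rule Polygamma_reflection_step[OF _ _ z])
    show "1 * Polygamma (Suc (Suc 0)) (1 - z) - Polygamma (Suc (Suc 0)) z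
      = - (c^3) * (qexp z * (1 + qexp z) / (1 - qexp z)^3)"
      if "z \<notin> \<int>" for z
      using 2[OF that] by (simp add: power2_eq_square power3_eq_cube)
    show "((\<lambda>z. - (c^3) * (qexp z * (1 + qexp z) / (1 - qexp z)^3)) has_field_derivative
        - (c^3) * ((1 + 4 * qexp z + (qexp z)^2) / (1 - qexp z)^4 * (c * qexp z))) (at z)" if "z \<notin> \<int>" for z
      using DERIV_cmult[OF DERIV_chain2[OF rational_deriv_2[OF w[OF that]] DERIV_qexp], of "- (c^3)"]
      by (simp add: c_def)
  qed
  have neg: "x + y = b" if "- 1 * x - y = - b" for x y b :: complex
  proof -
    have "x + y = - (- 1 * x - y)" by simp
    then show ?thesis unfolding that by simp
  qed
  have "Polygamma (Suc 0) (1 - z) + Polygamma (Suc 0) z = c^2 * (w / (1 - w)^2)"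
    by (rule neg) (use 1[OF z] in \<open>simp add: w_def power2_eq_square\<close>)
  then show "Polygamma 1 (1 - z) + Polygamma 1 z = (2 * pi * \<i>)^2 * (w / (1 - w)^2)"
    by (simp add: c_def)
  have "Polygamma (Suc (Suc (Suc 0))) (1 - z) + Polygamma (Suc (Suc (Suc 0))) z
     = c^4 * (w * (1 + 4 * w + w^2) / (1 - w)^4)"
  proof (rule neg)
    have c4: "c^4 = c^3 * c" by (simp add: power3_eq_cube power4_eq_xxxx)
    show "(- 1) * Polygamma (Suc (Suc (Suc 0))) (1 - z) - Polygamma (Suc (Suc (Suc 0))) z
      = - (c^4 * (w * (1 + 4 * w + w^2) / (1 - w)^4))"
      unfolding 3[OF z] w_def[symmetric] c4 by (simp add: mult_ac)
  qed
  then show "Polygamma 3 (1 - z) + Polygamma 3 z = (2 * pi * \<i>)^4 * (w * (1 + 4 * w + w^2) / (1 - w)^4)"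
    unfolding c_def numeral_3_eq_3 .
qed

lemma power_sums_has_sum:
  fixes w :: complex
  assumes w: "norm w < 1"
  shows "((\<lambda>n::nat. of_nat n * w ^ n) has_sum (w / (1 - w)^2)) UNIV"
    and "((\<lambda>n::nat. of_nat n ^ 3 * w ^ n) has_sum (w * (1 + 4 * w + w^2) / (1 - w)^4)) UNIV"
proof -
  \<comment> \<open>The operator X d/dX multiplies the n-th coefficient by n, and on the disc it
    sends the closed form \<open>h\<close> to \<open>w * h' w\<close>.\<close>
  have step: "fps_conv_radius (fps_X * fps_deriv f) \<ge> 1 \<and>
     (\<forall>w. norm w < 1 \<longrightarrow> eval_fps (fps_X * fps_deriv f) w = w * h' w)"
    if f: "fps_conv_radius f \<ge> 1 \<and> (\<forall>w. norm w < 1 \<longrightarrow> eval_fps f w = h w)"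
      and h: "\<And>w. w \<noteq> 1 \<Longrightarrow> (h has_field_derivative h' w) (at w)"
    for f :: "complex fps" and h h'
  proof (intro conjI allI impI)
    have r: "fps_conv_radius (fps_deriv f) \<ge> 1"
      using f fps_conv_radius_deriv[of f] by (meson order_trans)
    then show "fps_conv_radius (fps_X * fps_deriv f) \<ge> 1"
      using fps_conv_radius_mult[of fps_X "fps_deriv f"] by simp
    fix w :: complex assume w: "norm w < 1"
    then have w': "ereal (norm w) < fps_conv_radius f" "ereal (norm w) < fps_conv_radius (fps_deriv f)"
      using f r by (auto intro: less_le_trans[of _ 1])
    have "(eval_fps f has_field_derivative eval_fps (fps_deriv f) w) (at w)"
      by (rule has_field_derivative_eval_fps[OF w'(1)])
    moreover have "(eval_fps f has_field_derivative h' w) (at w)"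
    proof (rule DERIV_cong_ev[THEN iffD2, OF refl _ refl h])
      show "\<forall>\<^sub>F z in nhds w. eval_fps f z = h z"
        using f w by (intro eventually_nhds_in_open[THEN eventually_mono, of "ball 0 1"]) auto
    qed (use w in auto)
    ultimately have "eval_fps (fps_deriv f) w = h' w" by (rule DERIV_unique)
    then show "eval_fps (fps_X * fps_deriv f) w = w * h' w"
      using w'(2) by (subst eval_fps_mult) auto
  qed
  define f where "f k = Abs_fps (\<lambda>n::nat. of_nat n ^ k :: complex)" for k :: nat
  have fS: "fps_X * fps_deriv (f k) = f (Suc k)" for k
  proof (rule fps_ext)
    fix n show "fps_nth (fps_X * fps_deriv (f k)) n = fps_nth (f (Suc k)) n"
      by (cases n) (simp_all add: f_def)
  qed
  have f23: "f (Suc 1) = f 2" "f (Suc 2) = f 3" by (simp_all add: numeral_2_eq_2 numeral_3_eq_3)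
  have f0: "fps_conv_radius (f 0) \<ge> 1 \<and> (\<forall>w. norm w < 1 \<longrightarrow> eval_fps (f 0) w = inverse (1 - w))"
  proof -
    have "(\<lambda>n. w ^ n) sums inverse (1 - w)" if "norm w < 1" for w :: complex
      using geometric_sums[OF that] by (simp add: field_simps)
    moreover have "conv_radius (\<lambda>n. 1 :: complex) \<ge> 1"
      by (rule conv_radius_geI_ex') (auto intro: summable_geometric)
    ultimately show ?thesis
      by (auto simp: eval_fps_def f_def sums_iff fps_conv_radius_def)
  qed
  have d0: "((\<lambda>w. inverse (1 - w)) has_field_derivative 1 / (1 - w)^2) (at w)" if "w \<noteq> 1" for w :: complex
    by (rule derivative_eq_intros refl)+ (use that in \<open>auto simp: power2_eq_square divide_simps\<close>)
  have f1: "fps_conv_radius (f 1) \<ge> 1 \<and> (\<forall>w. norm w < 1 \<longrightarrow> eval_fps (f 1) w = w / (1 - w)^2)"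
    using step[OF f0 d0] by (simp add: fS)
  have f2: "fps_conv_radius (f 2) \<ge> 1 \<and> (\<forall>w. norm w < 1 \<longrightarrow> eval_fps (f 2) w = w * (1 + w) / (1 - w)^3)"
    using step[OF f1 rational_deriv_1] unfolding fS f23 by simp
  have f3: "fps_conv_radius (f 3) \<ge> 1 \<and>
     (\<forall>w. norm w < 1 \<longrightarrow> eval_fps (f 3) w = w * (1 + 4 * w + w^2) / (1 - w)^4)"
    using step[OF f2 rational_deriv_2] unfolding fS f23 by simp
  have hs: "((\<lambda>n. fps_nth g n * w ^ n) has_sum eval_fps g w) UNIV" if "fps_conv_radius g \<ge> 1" for g
    using that w by (intro norm_summable_imp_has_sum sums_eval_fps norm_summable_fps) (auto intro: less_le_trans[of _ 1])
  show "((\<lambda>n::nat. of_nat n * w ^ n) has_sum (w / (1 - w)^2)) UNIV"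
    using hs[of "f 1"] f1 w by (simp add: f_def)
  show "((\<lambda>n::nat. of_nat n ^ 3 * w ^ n) has_sum (w * (1 + 4 * w + w^2) / (1 - w)^4)) UNIV"
    using hs[of "f 3"] f3 w by (simp add: f_def)
qed

lemma has_sum_shifted_inverse_power:
  fixes z :: complex
  assumes z: "z \<notin> \<int>" and k: "k \<ge> 2"
  shows "((\<lambda>n::nat. inverse ((z + of_nat n) ^ k)) has_sum
    ((-1) ^ k * Polygamma (k - 1) z / fact (k - 1))) UNIV"
proof (rule norm_summable_imp_has_sum)
  show "summable (\<lambda>n. norm (inverse ((z + of_nat n) ^ k)))"
  proof (rule summable_comparison_test_ev)
    show "\<forall>\<^sub>F n in sequentially. norm (norm (inverse ((z + of_nat n) ^ k))) \<le> 2 ^ k * inverse (real n ^ k)"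
      using eventually_ge_at_top[of "nat \<lceil>2 * norm z\<rceil> + 1"]
    proof eventually_elim
      case (elim n)
      \<comment> \<open>The starting index is chosen such that \<open>norm (z + of_nat n)\<close> is
        at least n / 2.\<close>
      have "real n \<ge> 2 * norm z" "real n \<ge> 1" using elim by linarith+
      then have "norm (z + of_nat n) \<ge> real n / 2"
        using norm_diff_ineq[of "of_nat n" z] by (simp add: add.commute)
      then have "norm (z + of_nat n) ^ k \<ge> (real n / 2) ^ k" by (intro power_mono) auto
      then have "inverse (norm (z + of_nat n) ^ k) \<le> inverse ((real n / 2) ^ k)"
        using \<open>real n \<ge> 1\<close> by (intro le_imp_inverse_le) auto
      then show ?case by (simp add: norm_inverse norm_power norm_divide field_simps)
    qed
    show "summable (\<lambda>n. 2 ^ k * inverse (real n ^ k))"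
      using k by (intro summable_mult inverse_power_summable)
  qed
  have z0: "z \<noteq> 0" using z by auto
  have "Polygamma (k - 1) z = (-1)^k * fact (k - 1) * (\<Sum>n. inverse ((z + of_nat n) ^ k))"
    using k unfolding Polygamma_def by auto
  moreover have "(-1 :: complex)^k * (-1)^k = 1" by (simp flip: power_mult_distrib)
  ultimately have "(\<Sum>n. inverse ((z + of_nat n) ^ k)) = (-1) ^ k * Polygamma (k - 1) z / fact (k - 1)"
    by (simp add: mult.assoc[symmetric])
  then show "(\<lambda>n. inverse ((z + of_nat n) ^ k)) sums ((-1) ^ k * Polygamma (k - 1) z / fact (k - 1))"
    using summable_sums[OF Polygamma_converges'[OF z0 k]] by simp
qed

text \<open>The negative half is enumerated by n -> -1 - n because z + (-1 - n) = -(1 - z + n): the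
  halves of an even power sum are then Polygamma values at z and at 1 - z.\<close>

lemma has_sum_int_split:
  fixes f :: "int \<Rightarrow> 'a :: topological_comm_monoid_add"
  assumes "((\<lambda>n::nat. f (int n)) has_sum a) UNIV" "((\<lambda>n::nat. f (- 1 - int n)) has_sum b) UNIV"
  shows "(f has_sum (a + b)) (UNIV :: int set)"
proof -
  have "(f has_sum a) (range int)"
    using assms(1) by (subst has_sum_reindex) (auto simp: o_def inj_on_def)
  moreover have "(f has_sum b) (range (\<lambda>n. - 1 - int n))"
    using assms(2) by (subst has_sum_reindex) (auto simp: o_def inj_on_def)
  ultimately have "(f has_sum (a + b)) (range int \<union> range (\<lambda>n. - 1 - int n))"
    by (rule has_sum_Un_disjoint) auto
  moreover have "range int \<union> range (\<lambda>n. - 1 - int n) = UNIV"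
  proof -
    have "x \<in> range int \<union> range (\<lambda>n. - 1 - int n)" for x :: int
      by (cases "x \<ge> 0") (auto intro: image_eqI[of _ _ "nat x"] image_eqI[of _ _ "nat (-1-x)"])
    then show ?thesis by blast
  qed
  ultimately show ?thesis by simp
qed

lemma has_sum_int_inverse_power:
  fixes z :: complex
  assumes z: "z \<notin> \<int>" and k: "k \<ge> 2" "even k"
  shows "((\<lambda>n::int. inverse ((z + of_int n) ^ k)) has_sum
    ((Polygamma (k - 1) (1 - z) + Polygamma (k - 1) z) / fact (k - 1))) UNIV"
proof -
  have z': "1 - z \<notin> \<int>" using z by (metis Ints_1 Ints_diff diff_diff_eq2 add_diff_cancel_left')
  have "((\<lambda>n::nat. inverse ((z + of_int (- 1 - int n)) ^ k)) has_sum (Polygamma (k - 1) (1 - z) / fact (k - 1))) UNIV"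
  proof -
    have "(z + of_int (- 1 - int n)) ^ k = (1 - z + of_nat n) ^ k" for n
    proof -
      have "(- (z + of_int (- 1 - int n))) ^ k = (z + of_int (- 1 - int n)) ^ k"
        using k by (simp only: power_minus_even)
      then show ?thesis by (simp add: algebra_simps)
    qed
    then show ?thesis using has_sum_shifted_inverse_power[OF z' k(1)] k by simp
  qed
  moreover have "((\<lambda>n::nat. inverse ((z + of_int (int n)) ^ k)) has_sum (Polygamma (k - 1) z / fact (k - 1))) UNIV"
    using has_sum_shifted_inverse_power[OF z k(1)] k by simp
  ultimately show ?thesis
    using has_sum_int_split[of "\<lambda>n. inverse ((z + of_int n) ^ k)"] by (simp add: add_divide_distrib add.commute)
qed

lemma lipschitz_2:
  assumes z: "z \<notin> \<int>"
  shows "((\<lambda>n::int. inverse ((z + of_int n) ^ 2)) has_sum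
    ((2 * pi * \<i>)^2 * (qexp z / (1 - qexp z)^2))) UNIV"
  using has_sum_int_inverse_power[OF z, of 2] unfolding Polygamma_reflection_1_3(1)[OF z, symmetric] by simp

lemma lipschitz_4:
  assumes z: "z \<notin> \<int>"
  shows "((\<lambda>n::int. inverse ((z + of_int n) ^ 4)) has_sum
    ((2 * pi * \<i>)^4 / 6 * (qexp z * (1 + 4 * qexp z + (qexp z)^2) / (1 - qexp z)^4))) UNIV"
  using has_sum_int_inverse_power[OF z, of 4] Polygamma_reflection_1_3(2)[OF z] by (simp add: fact_numeral mult.commute)

lemma has_sum_nat_even_odd:
  fixes f :: "nat \<Rightarrow> complex"
  assumes "((\<lambda>n. f (2 * n)) has_sum a) UNIV" "((\<lambda>n. f (2 * n + 1)) has_sum b) UNIV"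
  shows "(f has_sum (a + b)) UNIV"
proof -
  have "(f has_sum a) (range (\<lambda>n. 2 * n))"
    using assms(1) by (subst has_sum_reindex) (auto simp: o_def inj_on_def)
  moreover have "(f has_sum b) (range (\<lambda>n. 2 * n + 1))"
    using assms(2) by (subst has_sum_reindex) (auto simp: o_def inj_on_def)
  moreover have even_odd: "range (\<lambda>n::nat. 2 * n) = {n. even n}" "range (\<lambda>n::nat. 2 * n + 1) = {n. odd n}"
    unfolding even_iff_mod_2_eq_zero odd_iff_mod_2_eq_one
    by (auto simp: image_iff; presburger)+
  have "range (\<lambda>n::nat. 2 * n) \<inter> range (\<lambda>n. 2 * n + 1) = {}" unfolding even_odd by auto
  ultimately have "(f has_sum (a + b)) (range (\<lambda>n. 2 * n) \<union> range (\<lambda>n. 2 * n + 1))"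
    using \<open>(f has_sum a) _\<close> \<open>(f has_sum b) _\<close> by (intro has_sum_Un_disjoint)
  moreover have "range (\<lambda>n. 2 * n) \<union> range (\<lambda>n. 2 * n + 1) = (UNIV :: nat set)"
    unfolding even_odd by auto
  ultimately show ?thesis by simp
qed

text \<open>The instance $z = 1/2$ of the Lipschitz formula evaluates the sum over the odd numbers.\<close>

lemma has_sum_inverse_fourth_powers:
  "((\<lambda>n::nat. inverse (of_nat n ^ 4)) has_sum (of_real pi ^ 4 / 90 :: complex)) UNIV"
proof -
  let ?f = "\<lambda>n::nat. inverse (of_nat n ^ 4) :: complex"
  have half: "(1 / 2 :: complex) \<notin> \<int>"
    using fraction_not_in_Ints[where 'a = complex, of 2 1] by simp
  have half': "1 - 1 / 2 = (1 / 2 :: complex)" by simp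
  have q: "qexp (1 / 2) = -1" by (simp add: qexp_def)
  have "Polygamma 3 (1 / 2 :: complex) + Polygamma 3 (1 / 2) = (2 * pi * \<i>)^4 * (-1 * (1 + 4 * (-1) + (-1)^2) / (1 - (-1))^4)"
    using Polygamma_reflection_1_3(2)[OF half] unfolding q half' .
  also have "\<dots> = 2 * pi ^ 4" by (simp add: power_mult_distrib)
  finally have P: "Polygamma 3 (1 / 2 :: complex) = pi ^ 4" by simp
  have "((\<lambda>n::nat. inverse ((1 / 2 + of_nat n) ^ 4)) has_sum (pi ^ 4 / 6 :: complex)) UNIV"
    using has_sum_shifted_inverse_power[OF half, of 4] by (simp add: P fact_numeral)
  from has_sum_cmult_right[OF this, of "1 / 16"]
  have odd: "((\<lambda>n. ?f (2 * n + 1)) has_sum (pi ^ 4 / 96)) UNIV"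
  proof -
    have "1 / 16 * inverse ((1 / 2 + of_nat n) ^ 4) = ?f (2 * n + 1)" for n
    proof -
      have "of_nat (2 * n + 1) = 2 * (1 / 2 + of_nat n :: complex)" by (simp add: algebra_simps)
      then show ?thesis by (simp only: power_mult_distrib) (simp add: inverse_mult_distrib)
    qed
    then show ?thesis using \<open>((\<lambda>n. 1 / 16 * inverse ((1 / 2 + of_nat n) ^ 4)) has_sum _) UNIV\<close> by simp
  qed
  have "summable (\<lambda>n. norm (?f n))"
    using inverse_power_summable[of 4] by (simp add: norm_inverse norm_power)
  then have "?f summable_on UNIV" by (rule norm_summable_imp_summable_on)
  then obtain s where s: "(?f has_sum s) UNIV" by (auto simp: summable_on_def)
  \<comment> \<open>The even terms contribute s / 16, so s = s / 16 + pi^4 / 96.\<close>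
  have "((\<lambda>n. ?f (2 * n)) has_sum (s / 16)) UNIV"
    using has_sum_cmult_right[OF s, of "1 / 16"] by (simp add: power_mult_distrib)
  from has_sum_unique[OF s has_sum_nat_even_odd[of ?f, OF this odd]]
  have s_eq: "s = pi ^ 4 / 90" by (simp add: field_simps)
  show ?thesis using s unfolding s_eq by simp
qed

section \<open>Eisenstein series of weight 4 and 2\<close>

lemma has_sum_nat_Suc:
  fixes f :: "nat \<Rightarrow> 'a :: topological_comm_monoid_add"
  assumes "((\<lambda>n. f (Suc n)) has_sum a) UNIV"
  shows "(f has_sum (f 0 + a)) UNIV"
proof -
  have "(f has_sum a) (range Suc)"
    using assms by (subst has_sum_reindex) (auto simp: o_def)
  then have "(f has_sum (f 0 + a)) (insert 0 (range Suc))"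
    by (intro has_sum_insert) auto
  moreover have "insert 0 (range Suc) = UNIV" by (auto simp: image_iff) (metis not0_implies_Suc)
  ultimately show ?thesis by simp
qed

lemma summable_on_product:
  fixes f :: "'a \<Rightarrow> real" and g :: "'b \<Rightarrow> real"
  assumes "f summable_on A" "g summable_on B" "\<And>x. x \<in> A \<Longrightarrow> f x \<ge> 0" "\<And>x. x \<in> B \<Longrightarrow> g x \<ge> 0"
  shows "(\<lambda>(x, y). f x * g y) summable_on A \<times> B"
proof (rule summable_on_SigmaI)
  show "((\<lambda>y. case (x, y) of (x, y) \<Rightarrow> f x * g y) has_sum f x * infsum g B) B" for x
    using has_sum_cmult_right[OF has_sum_infsum[OF assms(2)], of "f x"] by simp
  show "(\<lambda>x. f x * infsum g B) summable_on A"
    using assms(1) by (rule summable_on_cmult_left)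
qed (use assms in auto)

text \<open>The numbers t and 1 form a real basis of the plane: the imaginary part bounds x, and the
  triangle inequality then bounds y.\<close>

lemma lattice_norm_bound:
  assumes t: "Im t > 0"
  obtains K where "K > 0" "\<And>x y :: real. \<bar>x\<bar> + \<bar>y\<bar> \<le> K * norm (of_real x * t + of_real y)"
proof
  let ?K = "1 / Im t + 1 + norm t / Im t"
  show "?K > 0" using t by (auto intro!: add_pos_nonneg)
  fix x y :: real
  let ?N = "norm (of_real x * t + of_real y)"
  have "\<bar>x\<bar> * Im t \<le> ?N"
    using abs_Im_le_cmod[of "of_real x * t + of_real y"] t by (simp add: abs_mult)
  then have x: "\<bar>x\<bar> \<le> ?N / Im t" using t by (simp add: field_simps)
  have "\<bar>y\<bar> = norm ((of_real x * t + of_real y) - of_real x * t)" by simp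
  also have "\<dots> \<le> ?N + \<bar>x\<bar> * norm t" by (rule norm_triangle_le_diff) (simp add: norm_mult)
  also have "\<bar>x\<bar> * norm t \<le> ?N / Im t * norm t" by (rule mult_right_mono[OF x]) simp
  finally show "\<bar>x\<bar> + \<bar>y\<bar> \<le> ?K * ?N" using x by (simp add: algebra_simps)
qed

lemma summable_on_nat_inverse_square: "(\<lambda>n::nat. inverse ((1 + real n) ^ 2)) summable_on UNIV"
proof (rule norm_summable_imp_summable_on)
  have "summable (\<lambda>n. inverse (real (n + 1) ^ 2))"
    using inverse_power_summable[of 2, where 'a = real] by (subst summable_iff_shift) auto
  then show "summable (\<lambda>n::nat. norm (inverse ((1 + real n) ^ 2)))" by (simp add: add.commute)
qed

lemma summable_on_int_inverse_square: "(\<lambda>n::int. inverse ((1 + \<bar>real_of_int n\<bar>) ^ 2)) summable_on UNIV"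
proof -
  obtain a where a: "((\<lambda>n::nat. inverse ((1 + real n) ^ 2)) has_sum a) UNIV"
    using summable_on_nat_inverse_square by (auto simp: summable_on_def)
  have "(\<lambda>n::nat. inverse ((1 + \<bar>real_of_int (- 1 - int n)\<bar>) ^ 2)) summable_on UNIV"
  proof (rule summable_on_comparison_test[OF summable_on_nat_inverse_square])
    fix n :: nat
    have "\<bar>real_of_int (- 1 - int n)\<bar> = 1 + real n" by simp
    then show "inverse ((1 + \<bar>real_of_int (- 1 - int n)\<bar>) ^ 2) \<le> inverse ((1 + real n) ^ 2)"
      by (intro le_imp_inverse_le power_mono) auto
  qed auto
  then obtain b where b: "((\<lambda>n::nat. inverse ((1 + \<bar>real_of_int (- 1 - int n)\<bar>) ^ 2)) has_sum b) UNIV"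
    by (auto simp: summable_on_def)
  have "((\<lambda>n::int. inverse ((1 + \<bar>real_of_int n\<bar>) ^ 2)) has_sum (a + b)) UNIV"
    by (rule has_sum_int_split) (use a b in simp_all)
  then show ?thesis by (auto simp: summable_on_def)
qed

text \<open>Splits decay of order four in two variables into decay of order two in each, to which
  \<open>summable_on_product\<close> applies: as |x| + |y| is at least 1, both 1 + |x| and 1 + |y|
  are at most 2 (|x| + |y|).\<close>

lemma inverse_power4_le:
  fixes x y s :: real
  assumes "\<bar>x\<bar> + \<bar>y\<bar> \<le> K * s" "\<bar>x\<bar> + \<bar>y\<bar> \<ge> 1" "K > 0"
  shows "inverse (s ^ 4) \<le> 16 * K ^ 4 * (inverse ((1 + \<bar>x\<bar>) ^ 2) * inverse ((1 + \<bar>y\<bar>) ^ 2))"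
proof -
  have s: "s > 0" using assms by (smt (verit) zero_less_mult_pos)
  have "(1 + \<bar>x\<bar>) * (1 + \<bar>y\<bar>) \<le> (2 * (\<bar>x\<bar> + \<bar>y\<bar>)) * (2 * (\<bar>x\<bar> + \<bar>y\<bar>))"
    using assms(2) by (intro mult_mono) auto
  also have "\<dots> \<le> (2 * (K * s)) * (2 * (K * s))"
    using assms s by (intro mult_mono) auto
  finally have "((1 + \<bar>x\<bar>) * (1 + \<bar>y\<bar>))^2 \<le> ((2 * (K * s)) * (2 * (K * s)))^2"
    by (intro power_mono) auto
  also have "\<dots> = 16 * K^4 * s^4" by (simp add: power_mult_distrib flip: power2_eq_square power_mult)
  finally have "inverse (16 * K^4 * s^4) \<le> inverse (((1 + \<bar>x\<bar>) * (1 + \<bar>y\<bar>))^2)"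
    by (intro le_imp_inverse_le) (auto intro!: mult_pos_pos zero_less_power)
  then have "16 * K^4 * inverse (16 * K^4 * s^4) \<le> 16 * K^4 * inverse (((1 + \<bar>x\<bar>) * (1 + \<bar>y\<bar>))^2)"
    using assms(3) by (intro mult_left_mono) auto
  moreover have "16 * K^4 * inverse (16 * K^4 * s^4) = inverse (s^4)"
    using assms(3) by (simp add: field_simps)
  ultimately show ?thesis by (simp only: power_mult_distrib inverse_mult_distrib)
qed

text \<open>The lattice point $(0,0)$ contributes \<open>inverse 0 = 0\<close>.\<close>

definition G4 :: "complex \<Rightarrow> complex" where
  "G4 t = (\<Sum>\<^sub>\<infinity>(m, n)\<in>UNIV. inverse ((of_int m * t + of_int n) ^ 4))"

lemma summable_on_G4:
  assumes t: "Im t > 0"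
  shows "(\<lambda>(m::int, n::int). inverse ((of_int m * t + of_int n) ^ 4)) summable_on UNIV \<times> UNIV"
proof -
  obtain K where K: "K > 0" "\<And>x y :: real. \<bar>x\<bar> + \<bar>y\<bar> \<le> K * norm (of_real x * t + of_real y)"
    using lattice_norm_bound[OF t] by blast
  have "(\<lambda>(m::int, n::int). inverse ((1 + \<bar>real_of_int m\<bar>) ^ 2) * inverse ((1 + \<bar>real_of_int n\<bar>) ^ 2))
      summable_on UNIV \<times> UNIV"
    by (rule summable_on_product) (use summable_on_int_inverse_square in auto)
  then have "(\<lambda>p::int \<times> int. 16 * K^4 * (case p of (m, n) \<Rightarrow>
      inverse ((1 + \<bar>real_of_int m\<bar>) ^ 2) * inverse ((1 + \<bar>real_of_int n\<bar>) ^ 2)))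
      summable_on UNIV \<times> UNIV"
    by (rule summable_on_cmult_right)
  then have "(\<lambda>p. norm (case p of (m::int, n::int) \<Rightarrow> inverse ((of_int m * t + of_int n) ^ 4))) summable_on UNIV \<times> UNIV"
  proof (rule Infinite_Sum.abs_summable_on_comparison_test')
    fix p :: "int \<times> int"
    obtain m n where p: "p = (m, n)" by (cases p)
    have "norm (inverse ((of_int m * t + of_int n) ^ 4)) \<le> 16 * K^4 *
      (inverse ((1 + \<bar>real_of_int m\<bar>) ^ 2) * inverse ((1 + \<bar>real_of_int n\<bar>) ^ 2))"
    proof (cases "m = 0 \<and> n = 0")
      case False
      then have "\<bar>real_of_int m\<bar> + \<bar>real_of_int n\<bar> \<ge> 1" by linarith
      then show ?thesis
        using inverse_power4_le[OF K(2) _ K(1), of "of_int m" "of_int n"]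
        by (simp add: norm_inverse norm_power)
    qed auto
    then show "norm (case p of (m, n) \<Rightarrow> inverse ((of_int m * t + of_int n) ^ 4)) \<le> 16 * K^4 *
      (case p of (m, n) \<Rightarrow> inverse ((1 + \<bar>real_of_int m\<bar>) ^ 2) * inverse ((1 + \<bar>real_of_int n\<bar>) ^ 2))"
      by (simp add: p)
  qed
  then show ?thesis by (simp only: summable_on_iff_abs_summable_on_complex)
qed

text \<open>The rotation (m, n) -> (n, -m) preserves the lattice of summation, and m (-1 / t) + n =
  (n t - m) / t.\<close>

lemma G4_inversion:
  assumes t: "Im t > 0"
  shows "G4 (-1 / t) = t ^ 4 * G4 t"
proof -
  have t0: "t \<noteq> 0" using t by auto
  have eq: "(\<Sum>\<^sub>\<infinity>(m, n)\<in>UNIV. inverse ((of_int m * t + of_int n) ^ 4)) =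
    (\<Sum>\<^sub>\<infinity>(m, n)\<in>UNIV. inverse ((of_int n * t - of_int m) ^ 4))"
    by (rule infsum_reindex_bij_witness[of _ "\<lambda>(m, n). (n, -m)" "\<lambda>(m, n). (-n, m)"]) auto
  have key: "t ^ 4 * inverse ((of_int n * t - of_int m) ^ 4) = inverse ((of_int m * (-1 / t) + of_int n) ^ 4)"
    for m n :: int
  proof -
    have "of_int m * (-1 / t) + of_int n = (of_int n * t - of_int m) / t" using t0 by (simp add: field_simps)
    then show ?thesis by (simp only: power_divide inverse_divide) (simp only: divide_inverse)
  qed
  have "t ^ 4 * G4 t = (\<Sum>\<^sub>\<infinity>p\<in>UNIV. t ^ 4 * (case p of (m, n) \<Rightarrow> inverse ((of_int n * t - of_int m) ^ 4)))"
    by (simp only: G4_def eq infsum_cmult_right')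
  also have "\<dots> = G4 (-1 / t)"
    unfolding G4_def by (rule infsum_cong) (simp only: key split: prod.split, simp)
  finally show ?thesis by simp
qed

text \<open>Lambert series: the double sum of d^k q^((m + 1) d) is evaluated over d first, and then
  regrouped by n = (m + 1) d.\<close>

lemma has_sum_lambert:
  fixes q :: complex
  assumes q: "norm q < 1" and k: "k > 0"
    and h: "\<And>w. norm w < 1 \<Longrightarrow> ((\<lambda>n::nat. of_nat n ^ k * w ^ n) has_sum h w) UNIV"
  obtains s where "((\<lambda>m. h (q ^ Suc m)) has_sum s) UNIV"
    "((\<lambda>n. of_nat (divisor_sigma k n) * q ^ n) has_sum s) UNIV"
proof -
  define F where "F = (\<lambda>(m::nat, d::nat). of_nat d ^ k * (q ^ Suc m) ^ d)"
  have "(\<lambda>(m::nat, d::nat). norm q ^ m * (real d ^ k * norm q ^ d)) summable_on UNIV \<times> UNIV"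
  proof (rule summable_on_product)
    show "(\<lambda>m. norm q ^ m) summable_on UNIV"
      using q by (intro norm_summable_imp_summable_on) (simp add: summable_geometric)
    have "(\<lambda>n. norm (of_nat n ^ k * q ^ n)) summable_on UNIV"
      using has_sum_imp_summable[OF h[OF q]] by (simp only: summable_on_iff_abs_summable_on_complex)
    then show "(\<lambda>d. real d ^ k * norm q ^ d) summable_on UNIV"
      by (simp add: norm_mult norm_power)
  qed auto
  then have "(\<lambda>p. norm (F p)) summable_on UNIV \<times> UNIV"
  proof (rule Infinite_Sum.abs_summable_on_comparison_test', clarify)
    fix m d :: nat
    show "norm (F (m, d)) \<le> norm q ^ m * (real d ^ k * norm q ^ d)"
    proof (cases d)
      case 0
      then show ?thesis using k by (simp add: F_def zero_power)
    next
      case (Suc e)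
      \<comment> \<open>For d at least 1 the product (m + 1) d dominates m + d, which separates the
        variables.\<close>
      have "norm q ^ (Suc m * d) \<le> norm q ^ (m + d)"
        using q Suc by (intro power_decreasing) auto
      then have "real d ^ k * norm q ^ (Suc m * d) \<le> real d ^ k * norm q ^ (m + d)"
        by (rule mult_left_mono) simp
      then show ?thesis
        unfolding F_def prod.case norm_mult norm_power norm_of_nat power_add power_mult
        by (simp only: mult.left_commute)
    qed
  qed
  then have "F summable_on UNIV \<times> UNIV" by (simp only: summable_on_iff_abs_summable_on_complex)
  then obtain s where s: "(F has_sum s) (UNIV \<times> UNIV)" by (auto simp: summable_on_def)
  have 1: "((\<lambda>m. h (q ^ Suc m)) has_sum s) UNIV"
  proof (rule has_sum_SigmaD[OF s])
    fix m :: nat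
    have "norm (q ^ Suc m) < 1" unfolding norm_power using q by (subst power_less_one_iff) auto
    from h[OF this] show "((\<lambda>d. F (m, d)) has_sum h (q ^ Suc m)) UNIV" by (simp add: F_def)
  qed
  have w: "Suc (n div d - Suc 0) * d = n" if "d dvd n" "0 < n" for n d :: nat
  proof -
    have "n div d > 0" using that by (simp add: div_greater_zero_iff dvd_imp_le dvd_pos_nat)
    then have "Suc (n div d - Suc 0) = n div d" by simp
    then show ?thesis using that(1) by (simp only: dvd_div_mult_self)
  qed
  \<comment> \<open>The terms with d = 0 vanish because k > 0; without them (m, d) -> (Suc m * d, d)
    is a bijection onto the pairs of a positive n and one of its divisors.\<close>
  have "(F has_sum s) {(m, d). d > 0}"
    using s by (subst has_sum_cong_neutral[where T = "UNIV \<times> UNIV" and g = F]) (use k in \<open>auto simp: F_def\<close>)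
  also have "?this \<longleftrightarrow> ((\<lambda>(n, d). of_nat d ^ k * q ^ n) has_sum s) (Sigma {1..} (\<lambda>n. {d. d dvd n}))"
    by (rule has_sum_reindex_bij_witness[of _ "\<lambda>(n, d). (n div d - 1, d)" "\<lambda>(m, d). (Suc m * d, d)"])
       (auto simp del: power_Suc mult_Suc simp: F_def power_mult w dvd_pos_nat Suc_le_eq)
  finally have "((\<lambda>n. of_nat (divisor_sigma k n) * q ^ n) has_sum s) {1..}"
  proof (rule has_sum_SigmaD)
    fix n :: nat assume "n \<in> {1..}"
    then have "finite {d. d dvd n}" by auto
    then show "((\<lambda>d. case (n, d) of (n, d) \<Rightarrow> of_nat d ^ k * q ^ n) has_sum
      of_nat (divisor_sigma k n) * q ^ n) {d. d dvd n}"
      by (intro has_sum_finiteI) (simp_all add: divisor_sigma_def sum_distrib_right)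
  qed
  \<comment> \<open>The term added at n = 0 is 0: every number divides 0, and a sum over an infinite
    set is 0 by convention.\<close>
  then have 2: "((\<lambda>n. of_nat (divisor_sigma k n) * q ^ n) has_sum s) UNIV"
    by (subst has_sum_cong_neutral[where T = "{1..}" and g = "\<lambda>n. of_nat (divisor_sigma k n) * q ^ n"])
       (auto simp: divisor_sigma_def not_le)
  from that[OF 1 2] show ?thesis .
qed

definition E4q :: "complex \<Rightarrow> complex" where
  "E4q q = 1 + 240 * (\<Sum>\<^sub>\<infinity>n. of_nat (divisor_sigma 3 n) * q ^ n)"

definition E2q :: "complex \<Rightarrow> complex" where
  "E2q q = 1 - 24 * (\<Sum>\<^sub>\<infinity>n. of_nat (divisor_sigma 1 n) * q ^ n)"

lemma of_nat_mult_notin_Ints: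
  assumes "Im t \<noteq> 0" "m > 0"
  shows "of_nat m * t \<notin> \<int>"
  using assms by (auto elim!: Ints_cases dest!: arg_cong[of _ _ Im])

text \<open>Summation by rows. The row m = 0 is 2 zeta(4) = pi^4 / 45, the rows m > 0 are instances
  of the Lipschitz formula, and the rows m and -m agree because the exponent is even.\<close>

lemma G4_eq:
  assumes t: "Im t > 0"
  shows "G4 t = pi ^ 4 / 45 * E4q (qexp t)"
proof -
  define h where "h w = w * (1 + 4 * w + w^2) / (1 - w)^4" for w :: complex
  define c where "c = (2 * pi * \<i>)^4 / 6"
  define f where "f = (\<lambda>(m::int, n::int). inverse ((of_int m * t + of_int n) ^ 4))"
  define r where "r m = (if m = 0 then pi^4 / 45 else c * h (qexp t ^ nat \<bar>m\<bar>))" for m :: int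
  have pos: "((\<lambda>n. f (int m, n)) has_sum (c * h (qexp t ^ m))) UNIV" if "m > 0" for m
    using lipschitz_4[OF of_nat_mult_notin_Ints, of t m] t that by (simp add: f_def c_def h_def qexp_of_nat_mult)
  have row: "((\<lambda>n. f (m, n)) has_sum r m) UNIV" for m
  proof -
    consider "m = 0" | "m > 0" | "m < 0" by linarith
    then show ?thesis
    proof cases
      case 1
      let ?g = "\<lambda>n::nat. inverse (of_nat n ^ 4) :: complex"
      have "?g summable_on range Suc"
        using has_sum_imp_summable[OF has_sum_inverse_fourth_powers] by (rule summable_on_subset_banach) auto
      then have "(\<lambda>n. ?g (Suc n)) summable_on UNIV"
        by (subst (asm) summable_on_reindex) (auto simp: o_def)
      then obtain a where a: "((\<lambda>n. ?g (Suc n)) has_sum a) UNIV" by (auto simp: summable_on_def)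
      have a_eq: "a = pi^4 / 90"
        using has_sum_unique[OF has_sum_nat_Suc[of ?g, OF a] has_sum_inverse_fourth_powers] by simp
      have "((\<lambda>n. f (0, n)) has_sum (pi^4 / 90 + a)) UNIV"
      proof (rule has_sum_int_split)
        show "((\<lambda>n. f (0, int n)) has_sum (pi^4 / 90)) UNIV"
          using has_sum_inverse_fourth_powers by (simp add: f_def)
        have "(complex_of_int (- 1 - int n)) ^ 4 = of_nat (Suc n) ^ 4" for n
        proof -
          have "complex_of_int (- 1 - int n) = - of_nat (Suc n)" by simp
          then show ?thesis by (simp only: power_minus_even even_numeral)
        qed
        then show "((\<lambda>n. f (0, - 1 - int n)) has_sum a) UNIV" using a by (simp add: f_def)
      qed
      then show ?thesis using 1 unfolding a_eq by (simp add: r_def)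
    next
      case 2
      then show ?thesis using pos[of "nat m"] by (simp add: r_def)
    next
      case 3
      have "((\<lambda>n. f (- m, - n)) has_sum r m) UNIV"
        using 3 pos[of "nat (-m)"]
        by (subst has_sum_reindex_bij_witness[where i = uminus and j = uminus and T = UNIV and h = "\<lambda>n. f (-m, n)"])
           (auto simp: r_def)
      moreover have "f (- m, - n) = f (m, n)" for n
      proof -
        have "(- (of_int m * t + of_int n)) ^ 4 = (of_int m * t + of_int n) ^ 4"
          by (simp only: power_minus_even even_numeral)
        then show ?thesis by (simp add: f_def algebra_simps)
      qed
      ultimately show ?thesis by simp
    qed
  qed
  have "(f has_sum G4 t) (UNIV \<times> UNIV)"
    using has_sum_infsum[OF summable_on_G4[OF t]] by (simp add: f_def G4_def)
  then have G: "(r has_sum G4 t) UNIV" by (rule has_sum_SigmaD) (rule row)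
  obtain s where s: "((\<lambda>m. h (qexp t ^ Suc m)) has_sum s) UNIV"
      "((\<lambda>n. of_nat (divisor_sigma 3 n) * qexp t ^ n) has_sum s) UNIV"
    by (rule has_sum_lambert[of "qexp t" 3 h]) (use t power_sums_has_sum(2) in \<open>auto simp: h_def\<close>)
  have r0: "r 0 = pi^4 / 45" by (simp add: r_def)
  have c: "((\<lambda>m. r (int (Suc m))) has_sum (c * s)) UNIV" "((\<lambda>m. r (- 1 - int m)) has_sum (c * s)) UNIV"
    using has_sum_cmult_right[OF s(1), of c] by (simp_all add: r_def nat_add_distrib)
  have "(r has_sum (pi^4 / 45 + c * s + c * s)) UNIV"
    using has_sum_int_split[OF has_sum_nat_Suc[of "\<lambda>m. r (int m)", OF c(1)] c(2)] by (simp add: r0)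
  then have "G4 t = pi^4 / 45 + c * s + c * s" using G has_sum_unique by blast
  moreover have "E4q (qexp t) = 1 + 240 * s" using infsumI[OF s(2)] by (simp add: E4q_def)
  moreover have "c = 240 * (pi^4 / 90)" by (simp add: c_def power_mult_distrib)
  ultimately show ?thesis by (simp add: algebra_simps)
qed

lemma E4q_inversion:
  assumes t: "Im t > 0"
  shows "E4q (qexp (-1 / t)) = t ^ 4 * E4q (qexp t)"
proof -
  have "Im (-1 / t) > 0" using t by (simp add: Im_divide power2_eq_square add_pos_pos divide_pos_pos sum_squares_gt_zero_iff)
  then show ?thesis using G4_inversion[OF t] G4_eq[OF t] G4_eq[of "-1 / t"] by simp
qed

section \<open>The weight 2 Eisenstein series and its anomaly\<close>

lemma has_sum_int_symmetric:
  fixes f :: "int \<Rightarrow> complex"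
  assumes "(f has_sum S) UNIV"
  shows "(\<lambda>N. \<Sum>n\<in>{- int N..int N}. f n) \<longlonglongrightarrow> S"
proof -
  have "filterlim (\<lambda>N. {- int N..int N}) (finite_subsets_at_top UNIV) sequentially"
    unfolding filterlim_finite_subsets_at_top
  proof safe
    fix X :: "int set" assume "finite X"
    define M where "M = Max (insert 0 (abs ` X))"
    have M: "\<bar>x\<bar> \<le> M" if "x \<in> X" for x
      unfolding M_def using \<open>finite X\<close> that by (intro Max_ge) auto
    show "\<forall>\<^sub>F N in sequentially. finite {- int N..int N} \<and> X \<subseteq> {- int N..int N} \<and> {- int N..int N} \<subseteq> UNIV"
      using eventually_ge_at_top[of "nat M"] by eventually_elim (use M in \<open>fastforce simp: abs_le_iff\<close>)
  qed
  from filterlim_compose[OF assms[unfolded has_sum_def] this] show ?thesis by simp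
qed

lemma sum_int_symmetric_Suc:
  fixes f :: "int \<Rightarrow> complex"
  shows "(\<Sum>n\<in>{- int (Suc N)..int (Suc N)}. f n) = (\<Sum>n\<in>{- int N..int N}. f n) + (f (int (Suc N)) + f (- int (Suc N)))"
proof -
  have "{- int (Suc N)..int (Suc N)} = insert (int (Suc N)) (insert (- int (Suc N)) {- int N..int N})"
    by auto
  then show ?thesis by simp
qed

lemma sum_int_telescope:
  fixes g :: "int \<Rightarrow> complex"
  shows "(\<Sum>n\<in>{- int N..int N}. g n - g (n + 1)) = g (- int N) - g (int N + 1)"
proof (induction N)
  case (Suc N)
  then show ?case unfolding sum_int_symmetric_Suc by (simp add: add_ac)
qed simp

lemma inverse_shifted_int_tendsto_0:
  fixes z :: complex
  shows "(\<lambda>N. inverse (z + of_int (int N + 1) - 1 / 2)) \<longlonglongrightarrow> 0"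
    and "(\<lambda>N. inverse (z + of_int (- int N) - 1 / 2)) \<longlonglongrightarrow> 0"
proof -
  have "(\<lambda>N. inverse (z + 1 / 2 + of_nat N)) \<longlonglongrightarrow> 0"
    by (intro filterlim_compose[OF tendsto_inverse_0] tendsto_add_filterlim_at_infinity[OF tendsto_const] tendsto_of_nat)
  then show "(\<lambda>N. inverse (z + of_int (int N + 1) - 1 / 2)) \<longlonglongrightarrow> 0"
    by (simp add: algebra_simps)
  have "(\<lambda>N. - inverse ((1 / 2 - z) + of_nat N)) \<longlonglongrightarrow> - 0"
    by (intro tendsto_minus filterlim_compose[OF tendsto_inverse_0] tendsto_add_filterlim_at_infinity[OF tendsto_const] tendsto_of_nat)
  moreover have "- inverse ((1 / 2 - z) + of_nat N) = inverse (z + of_int (- int N) - 1 / 2)" for N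
    by (simp flip: inverse_minus_eq)
  ultimately show "(\<lambda>N. inverse (z + of_int (- int N) - 1 / 2)) \<longlonglongrightarrow> 0" by simp
qed

lemma Digamma_diff_sums:
  fixes u v :: complex
  assumes "u \<noteq> 0" "v \<noteq> 0"
  shows "(\<lambda>k. inverse (u + of_nat k) - inverse (v + of_nat k)) sums (Digamma v - Digamma u)"
proof -
  have "(\<lambda>k. inverse (of_nat (Suc k)) - inverse (z + of_nat k)) sums (Digamma z + euler_mascheroni)"
    if "z \<noteq> 0" for z :: complex
    using summable_sums[OF summable_Digamma[OF that]] by (simp add: Digamma_def)
  from sums_diff[OF this[OF assms(2)] this[OF assms(1)]] show ?thesis by simp
qed

text \<open>Digamma (1 + x) - Digamma (1 - x) = 1 / x - pi cot (pi x), and the cotangent tends to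
  \<open>\<i>\<close> as Im x tends to minus infinity.\<close>

lemma Digamma_reflection_limit:
  assumes t: "Im t > 0"
  shows "(\<lambda>N. Digamma (1 + (of_nat N + 1 / 2) / t) - Digamma (1 - (of_nat N + 1 / 2) / t)) \<longlonglongrightarrow> - pi * \<i>"
proof -
  define x where "x N = (of_nat N + 1 / 2) / t" for N :: nat
  have Im: "Im (x N) = - (real N + 1 / 2) * (Im t / (norm t)^2)" for N
  proof -
    have "Im (inverse t) = - (Im t / (norm t)^2)" by (simp add: cmod_power2)
    moreover have "x N = (real N + 1 / 2) *\<^sub>R inverse t"
      by (simp only: x_def scaleR_conv_of_real divide_inverse[of _ t]) simp
    ultimately show ?thesis by (simp only: scaleR_complex.sel mult_minus_right mult_minus_left)
  qed
  have y: "Im t / (norm t)^2 > 0" using t by (auto intro!: divide_pos_pos)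
  then have neg: "Im (x N) < 0" for N unfolding Im using y by (intro mult_neg_pos) linarith+
  then have Z: "x N \<notin> \<int>" for N by (metis Ints_cases complex_Im_of_int less_irrefl)
  have x0: "x N \<noteq> 0" for N using neg[of N] by auto
  have w: "qexp (- x N) \<noteq> 1" for N using Z[of N] by (simp add: qexp_eq_1_iff minus_in_Ints_iff)
  \<comment> \<open>Written in \<open>qexp (- x N)\<close>, which tends to 0, whereas
    \<open>qexp (x N)\<close> is unbounded.\<close>
  have "Digamma (1 + x N) - Digamma (1 - x N) = 1 / x N - pi * \<i> * (1 + qexp (- x N)) / (1 - qexp (- x N))" for N
  proof -
    have "qexp (x N) * qexp (- x N) = 1" by (simp flip: qexp_add) (simp add: qexp_def)
    then have "(qexp (x N) + 1) = qexp (x N) * (1 + qexp (- x N))" "(qexp (x N) - 1) = qexp (x N) * (1 - qexp (- x N))"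
      by (simp_all add: algebra_simps)
    then have "pi * \<i> * (qexp (x N) + 1) / (qexp (x N) - 1) = pi * \<i> * (1 + qexp (- x N)) / (1 - qexp (- x N))"
      by simp
    then show ?thesis
      using Digamma_reflection[OF Z[of N]] Digamma_plus1[OF x0[of N]] by (simp add: add.commute algebra_simps)
  qed
  moreover have "(\<lambda>N. 1 / x N - pi * \<i> * (1 + qexp (- x N)) / (1 - qexp (- x N))) \<longlonglongrightarrow> 0 - pi * \<i> * (1 + 0) / (1 - 0)"
  proof -
    have "(\<lambda>N. t * inverse (1 / 2 + of_nat N)) \<longlonglongrightarrow> t * 0"
      by (intro tendsto_mult tendsto_const filterlim_compose[OF tendsto_inverse_0] tendsto_add_filterlim_at_infinity[OF tendsto_const] tendsto_of_nat)
    moreover have "1 / x N = t * inverse (1 / 2 + of_nat N)" for N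
      by (simp add: x_def add.commute inverse_eq_divide)
    ultimately have A: "(\<lambda>N. 1 / x N) \<longlonglongrightarrow> 0" by simp
    have "filterlim (\<lambda>N. 2 * pi * (Im t / (norm t)^2) * (1 / 2 + real N)) at_top sequentially"
      by (rule filterlim_tendsto_pos_mult_at_top[OF tendsto_const mult_pos_pos[OF _ y]
          filterlim_tendsto_add_at_top[OF tendsto_const filterlim_real_sequentially]]) simp
    then have "(\<lambda>N. exp (- (2 * pi * (Im t / (norm t)^2) * (1 / 2 + real N)))) \<longlonglongrightarrow> 0"
      by (intro filterlim_compose[OF exp_at_bot] filterlim_compose[OF filterlim_uminus_at_bot_at_top])
    then have "(\<lambda>N. norm (qexp (- x N))) \<longlonglongrightarrow> 0" by (simp add: norm_qexp Im algebra_simps)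
    then have B: "(\<lambda>N. qexp (- x N)) \<longlonglongrightarrow> 0" by (rule tendsto_norm_zero_cancel)
    show ?thesis by (intro tendsto_intros A B) simp
  qed
  ultimately show ?thesis by (simp add: x_def)
qed

text \<open>The sum of inverse squares alone does not converge absolutely. The subtracted term
  telescopes in n and equals inverse (z^2 - 1/4) with z = (m + 1) t + n; the symmetric shift by 1/2
  cancels the third order as well, leaving decay of order four.\<close>

lemma summable_on_shifted_lattice:
  assumes t: "Im t > 0"
  shows "(\<lambda>(m::nat, n::int). inverse ((of_nat (Suc m) * t + of_int n) ^ 2) -
      (inverse (of_nat (Suc m) * t + of_int n - 1 / 2) - inverse (of_nat (Suc m) * t + of_int (n + 1) - 1 / 2)))
    summable_on UNIV \<times> UNIV"
proof -
  obtain K where K: "K > 0" "\<And>x y :: real. \<bar>x\<bar> + \<bar>y\<bar> \<le> K * norm (of_real x * t + of_real y)"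
    using lattice_norm_bound[OF t] by blast
  let ?c = "\<lambda>(m::nat, n::int). inverse ((of_nat (Suc m) * t + of_int n) ^ 2) -
      (inverse (of_nat (Suc m) * t + of_int n - 1 / 2) - inverse (of_nat (Suc m) * t + of_int (n + 1) - 1 / 2))"
  let ?b = "\<lambda>(m::nat, n::int). inverse ((1 + real m) ^ 2) * inverse ((1 + \<bar>real_of_int n\<bar>) ^ 2)"
  have "?b summable_on UNIV \<times> UNIV"
    by (rule summable_on_product) (use summable_on_int_inverse_square summable_on_nat_inverse_square in auto)
  then have "(\<lambda>p. 16 * (2 * K)^4 * ?b p) summable_on UNIV \<times> UNIV"
    by (rule summable_on_cmult_right)
  then have "(\<lambda>p. norm (?c p)) summable_on UNIV \<times> UNIV"
  proof (rule Infinite_Sum.abs_summable_on_comparison_test')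
    fix p :: "nat \<times> int"
    obtain m n where p: "p = (m, n)" by (cases p)
    define z where "z = of_nat (Suc m) * t + of_int n"
    define S where "S = \<bar>real (Suc m)\<bar> + \<bar>real_of_int n\<bar>"
    have S: "S \<ge> 1" by (simp add: S_def)
    \<comment> \<open>One bound for all three denominators z, z - 1/2 and z + 1/2; the loss of 1/2
      is absorbed by the factor 2 since S is at least 1.\<close>
    have z: "S \<le> 2 * K * norm (z + of_real r)" if "\<bar>r\<bar> \<le> 1 / 2" for r
    proof -
      have "S - 1 / 2 \<le> \<bar>real (Suc m)\<bar> + \<bar>real_of_int n + r\<bar>" using that unfolding S_def by linarith
      also have "\<dots> \<le> K * norm (of_real (real (Suc m)) * t + of_real (real_of_int n + r))" by (rule K)
      also have "of_real (real (Suc m)) * t + of_real (real_of_int n + r) = z + of_real r" by (simp add: z_def)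
      finally show ?thesis using S by linarith
    qed
    have nz: "z + of_real r \<noteq> 0" if "\<bar>r\<bar> \<le> 1 / 2" for r
    proof
      assume "z + of_real r = 0"
      then show False using z[OF that] S by simp
    qed
    have nz': "z \<noteq> 0" "z - 1 / 2 \<noteq> 0" "z + 1 / 2 \<noteq> 0"
      using nz[of 0] nz[of "- 1/2"] nz[of "1/2"] by simp_all
    have "?c p = inverse (z ^ 2) - (inverse (z - 1 / 2) - inverse (z + 1 / 2))"
      by (simp add: p z_def algebra_simps)
    also have "inverse (z - 1 / 2) - inverse (z + 1 / 2) = inverse ((z - 1 / 2) * (z + 1 / 2))"
      using nz' by (simp add: field_simps)
    also have "inverse (z ^ 2) - inverse ((z - 1 / 2) * (z + 1 / 2)) = - 1 / 4 * inverse (z ^ 2 * ((z - 1 / 2) * (z + 1 / 2)))"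
    proof -
      have u: "(z - 1 / 2) * (z + 1 / 2) = z ^ 2 - 1 / 4" by (simp add: power2_eq_square algebra_simps)
      have "z ^ 2 \<noteq> 0" "z ^ 2 - 1 / 4 \<noteq> 0" using nz' unfolding u[symmetric] by auto
      then show ?thesis unfolding u by (simp add: inverse_diff_inverse)
    qed
    finally have "norm (?c p) = 1 / 4 * inverse (norm z ^ 2 * (norm (z - 1 / 2) * norm (z + 1 / 2)))"
      by (simp add: norm_mult norm_inverse norm_power)
    also have "\<dots> \<le> inverse ((S / (2 * K)) ^ 4)"
    proof -
      have p: "S / (2 * K) \<le> norm (z + of_real r)" if "\<bar>r\<bar> \<le> 1 / 2" for r
        using z[OF that] K(1) by (simp add: field_simps)
      have "(S / (2 * K))^2 * (S / (2 * K) * (S / (2 * K))) \<le> norm z ^ 2 * (norm (z - 1 / 2) * norm (z + 1 / 2))"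
        using p[of 0] p[of "- 1/2"] p[of "1/2"] S K(1) by (intro mult_mono power_mono) auto
      moreover have "(S / (2 * K))^2 * (S / (2 * K) * (S / (2 * K))) = (S / (2 * K)) ^ 4"
        by (simp add: power2_eq_square power4_eq_xxxx)
      moreover have "(S / (2 * K)) ^ 4 > 0" using S K(1) by simp
      ultimately have "inverse (norm z ^ 2 * (norm (z - 1 / 2) * norm (z + 1 / 2))) \<le> inverse ((S / (2 * K)) ^ 4)"
        by (intro le_imp_inverse_le) auto
      moreover have "inverse (norm z ^ 2 * (norm (z - 1 / 2) * norm (z + 1 / 2))) \<ge> 0" by simp
      ultimately show ?thesis by linarith
    qed
    also have "\<dots> \<le> 16 * (2 * K)^4 * (inverse ((1 + \<bar>real (Suc m)\<bar>) ^ 2) * inverse ((1 + \<bar>real_of_int n\<bar>) ^ 2))"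
      using S K(1) by (intro inverse_power4_le) (auto simp: S_def)
    also have "\<dots> \<le> 16 * (2 * K)^4 * (inverse ((1 + real m) ^ 2) * inverse ((1 + \<bar>real_of_int n\<bar>) ^ 2))"
      using K(1) by (intro mult_left_mono mult_right_mono le_imp_inverse_le power_mono) auto
    finally show "norm (?c p) \<le> 16 * (2 * K)^4 * ?b p" by (simp add: p)
  qed
  then show ?thesis by (simp only: summable_on_iff_abs_summable_on_complex)
qed

lemma has_sum_diff:
  fixes f g :: "'a \<Rightarrow> complex"
  assumes "(f has_sum a) A" "(g has_sum b) A"
  shows "((\<lambda>x. f x - g x) has_sum (a - b)) A"
  using has_sum_add[OF assms(1), of "\<lambda>x. - g x" "- b"] assms(2) by (simp add: has_sum_uminus)

text \<open>The rows of the absolutely convergent double series sum to \<open>E2q (qexp t)\<close> up to constants,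
  the columns to \<open>E2q (qexp (-1 / t))\<close> plus a telescoping sum of Digamma values, which is the
  source of the anomaly.\<close>

lemma E2q_inversion:
  assumes t: "Im t > 0"
  shows "E2q (qexp (-1 / t)) = t ^ 2 * E2q (qexp t) + 6 * t / (pi * \<i>)"
proof -
  define z where "z m = of_nat (Suc m) * t" for m :: nat
  define c where "c = (\<lambda>(m::nat, n::int). inverse ((z m + of_int n) ^ 2) -
      (inverse (z m + of_int n - 1 / 2) - inverse (z m + of_int (n + 1) - 1 / 2)))"
  define h where "h w = w / (1 - w)^2" for w :: complex
  define k where "k = (2 * pi * \<i>)^2"
  define q q' where "q = qexp t" and "q' = qexp (-1 / t)"
  have t0: "t \<noteq> 0" using t by auto
  have t': "Im (-1 / t) > 0" using t by (simp add: Im_divide add_nonneg_pos divide_pos_pos)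
  have zZ: "z m \<notin> \<int>" for m
    unfolding z_def using t by (intro of_nat_mult_notin_Ints) auto
  have csum: "c summable_on UNIV \<times> UNIV"
    using summable_on_shifted_lattice[OF t] by (simp add: c_def z_def)
  then obtain S where S: "(c has_sum S) (UNIV \<times> UNIV)" by (auto simp: summable_on_def)
  have S': "((\<lambda>(n, m). c (m, n)) has_sum S) (UNIV \<times> UNIV)"
    using S by (subst (asm) has_sum_swap) simp
  have lip: "((\<lambda>n. inverse ((z m + of_int n) ^ 2)) has_sum (k * h (q ^ Suc m))) UNIV" for m
    using lipschitz_2[OF zZ, of m] by (simp only: k_def h_def q_def z_def qexp_of_nat_mult)
  \<comment> \<open>Along a row the subtracted terms telescope to 0, so the row keeps its Lipschitz
    value; symmetric partial sums suffice because the sum is known to exist.\<close>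
  have row: "((\<lambda>n. c (m, n)) has_sum (k * h (q ^ Suc m))) UNIV" for m
  proof -
    have "(\<lambda>(m, n). c (m, n)) summable_on UNIV \<times> UNIV" using csum by simp
    then have "(\<lambda>n. c (m, n)) summable_on UNIV" by (rule summable_on_SigmaD1) simp
    then obtain a where a: "((\<lambda>n. c (m, n)) has_sum a) UNIV" by (auto simp: summable_on_def)
    let ?g = "\<lambda>n::int. inverse (z m + of_int n - 1 / 2)"
    have "((\<lambda>n. ?g n - ?g (n + 1)) has_sum (k * h (q ^ Suc m) - a)) UNIV"
      using has_sum_diff[OF lip[of m] a] by (simp add: c_def)
    then have "(\<lambda>N. \<Sum>n\<in>{- int N..int N}. ?g n - ?g (n + 1)) \<longlonglongrightarrow> k * h (q ^ Suc m) - a"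
      by (rule has_sum_int_symmetric)
    moreover have "(\<lambda>N. \<Sum>n\<in>{- int N..int N}. ?g n - ?g (n + 1)) \<longlonglongrightarrow> 0 - 0"
      unfolding sum_int_telescope[of ?g] by (intro tendsto_diff inverse_shifted_int_tendsto_0)
    ultimately have "k * h (q ^ Suc m) - a = 0" using LIMSEQ_unique by fastforce
    then show ?thesis using a by simp
  qed
  have h: "((\<lambda>n::nat. of_nat n ^ 1 * w ^ n) has_sum h w) UNIV" if "norm w < 1" for w
    using power_sums_has_sum(1)[OF that] by (simp add: h_def)
  obtain s where s: "((\<lambda>m. h (q ^ Suc m)) has_sum s) UNIV"
      "((\<lambda>n. of_nat (divisor_sigma 1 n) * q ^ n) has_sum s) UNIV"
    by (rule has_sum_lambert[of q 1 h]) (use t h in \<open>auto simp: q_def\<close>)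
  obtain s' where s': "((\<lambda>m. h (q' ^ Suc m)) has_sum s') UNIV"
      "((\<lambda>n. of_nat (divisor_sigma 1 n) * q' ^ n) has_sum s') UNIV"
    by (rule has_sum_lambert[of q' 1 h]) (use t' h in \<open>auto simp: q'_def\<close>)
  have "((\<lambda>m. k * h (q ^ Suc m)) has_sum S) UNIV"
    by (rule has_sum_SigmaD[OF S row])
  then have S_eq: "S = k * s" using has_sum_cmult_right[OF s(1), of k] has_sum_unique by blast

  define V where "V n = (\<Sum>\<^sub>\<infinity>m. inverse ((z m + of_int n) ^ 2))" for n :: int
  define D where "D n = Digamma (1 + (of_int n - 1 / 2) / t) / t" for n :: int
  have nat_half: "1 + (of_int n - 1 / 2) / t \<noteq> 0" for n :: int
  proof
    assume "1 + (of_int n - 1 / 2) / t = 0"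
    then have "t = of_real (1 / 2 - real_of_int n)" using t0 by (simp add: field_simps)
    then have "Im t = 0" by (metis Im_complex_of_real)
    then show False using t by simp
  qed
  have V: "((\<lambda>m. inverse ((z m + of_int n) ^ 2)) has_sum V n) UNIV"
    and col: "((\<lambda>m. c (m, n)) has_sum (V n - (D (n + 1) - D n))) UNIV" for n
  proof -
    have "(\<lambda>m. c (m, n)) summable_on UNIV"
    proof -
      have "(\<lambda>(n, m). c (m, n)) summable_on UNIV \<times> UNIV" using S' by (rule has_sum_imp_summable)
      then show ?thesis by (rule summable_on_SigmaD1) simp
    qed
    then obtain a where a: "((\<lambda>m. c (m, n)) has_sum a) UNIV" by (auto simp: summable_on_def)
    have "summable (\<lambda>m. norm (inverse ((z m + of_int n) ^ 2)))"
    proof -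
      have "((\<lambda>m::nat. inverse ((1 + of_int n / t + of_nat m) ^ 2)) has_sum
          ((-1) ^ 2 * Polygamma (2 - 1) (1 + of_int n / t) / fact (2 - 1))) UNIV" if "n \<noteq> 0"
      proof (rule has_sum_shifted_inverse_power)
        show "1 + of_int n / t \<notin> \<int>"
        proof
          assume "1 + of_int n / t \<in> \<int>"
          then obtain j where "of_int n / t = of_int j - 1" by (metis Ints_cases add_diff_cancel_left')
          then have "of_int n * inverse t = of_int (j - 1)" by (simp only: divide_inverse of_int_diff of_int_1)
          then have "Im (of_int n * inverse t) = 0" by (simp only: complex_Im_of_int)
          then show False using that t by (simp add: sum_power2_eq_zero_iff)
        qed
      qed simp
      moreover have "(\<lambda>m::nat. inverse ((1 + of_nat m :: complex) ^ 2)) summable_on UNIV"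
      proof (rule abs_summable_summable)
        show "(\<lambda>m::nat. norm (inverse ((1 + of_nat m :: complex) ^ 2))) summable_on UNIV"
          using summable_on_nat_inverse_square by (simp add: norm_inverse norm_power flip: of_nat_Suc)
      qed
      ultimately have "(\<lambda>m::nat. inverse ((1 + of_int n / t + of_nat m) ^ 2)) summable_on UNIV"
        by (cases "n = 0") (auto dest: has_sum_imp_summable)
      then have "(\<lambda>m::nat. inverse (t ^ 2) * inverse ((1 + of_int n / t + of_nat m) ^ 2)) summable_on UNIV"
        by (rule summable_on_cmult_right)
      moreover have "inverse (t ^ 2) * inverse ((1 + of_int n / t + of_nat m) ^ 2) = inverse ((z m + of_int n) ^ 2)" for m
      proof -
        have "z m + of_int n = t * (1 + of_int n / t + of_nat m)" using t0 by (simp add: z_def field_simps)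
        then show ?thesis by (simp only: power_mult_distrib inverse_mult_distrib)
      qed
      ultimately have "(\<lambda>m. inverse ((z m + of_int n) ^ 2)) summable_on UNIV" by simp
      then have "(\<lambda>m. norm (inverse ((z m + of_int n) ^ 2))) summable_on UNIV"
        by (simp only: summable_on_iff_abs_summable_on_complex)
      then show ?thesis by (rule summable_on_imp_summable)
    qed
    then have "(\<lambda>m. inverse ((z m + of_int n) ^ 2)) summable_on UNIV"
      by (rule norm_summable_imp_summable_on)
    then show V: "((\<lambda>m. inverse ((z m + of_int n) ^ 2)) has_sum V n) UNIV"
      unfolding V_def by (rule has_sum_infsum)
    have "(\<lambda>m. inverse t * (inverse (1 + (of_int n - 1 / 2) / t + of_nat m) - inverse (1 + (of_int (n + 1) - 1 / 2) / t + of_nat m)))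
        sums (inverse t * (Digamma (1 + (of_int (n + 1) - 1 / 2) / t) - Digamma (1 + (of_int n - 1 / 2) / t)))"
      by (intro sums_mult Digamma_diff_sums nat_half)
    moreover have "inverse t * (inverse (1 + (of_int n - 1 / 2) / t + of_nat m) - inverse (1 + (of_int (n + 1) - 1 / 2) / t + of_nat m))
        = inverse (z m + of_int n - 1 / 2) - inverse (z m + of_int (n + 1) - 1 / 2)" for m
    proof -
      have "z m + x = t * (1 + x / t + of_nat m)" for x using t0 by (simp add: z_def field_simps)
      then have "inverse (z m + x) = inverse t * inverse (1 + x / t + of_nat m)" for x by simp
      from this[of "of_int n - 1 / 2"] this[of "of_int (n + 1) - 1 / 2"]
      show ?thesis by (simp only: right_diff_distrib add_diff_eq)
    qed
    moreover have "inverse t * (Digamma (1 + (of_int (n + 1) - 1 / 2) / t) - Digamma (1 + (of_int n - 1 / 2) / t)) = D (n + 1) - D n"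
      unfolding D_def by (simp only: divide_inverse[of _ t] left_diff_distrib right_diff_distrib mult.commute)
    ultimately have "(\<lambda>m. inverse (z m + of_int n - 1 / 2) - inverse (z m + of_int (n + 1) - 1 / 2)) sums (D (n + 1) - D n)"
      by simp
    moreover have "(\<lambda>m. inverse (z m + of_int n - 1 / 2) - inverse (z m + of_int (n + 1) - 1 / 2)) sums (V n - a)"
      using has_sum_imp_sums[OF has_sum_diff[OF V a]] by (simp add: c_def)
    ultimately have "V n - a = D (n + 1) - D n" using sums_unique2 by blast
    then have "a = V n - (D (n + 1) - D n)" by (simp add: algebra_simps)
    then show "((\<lambda>m. c (m, n)) has_sum (V n - (D (n + 1) - D n))) UNIV" using a by simp
  qed
  have "((\<lambda>n. V n - (D (n + 1) - D n)) has_sum S) UNIV"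
    by (rule has_sum_SigmaD[OF S']) (simp add: col)
  then have "(\<lambda>N. \<Sum>n\<in>{- int N..int N}. V n + (D n - D (n + 1))) \<longlonglongrightarrow> S"
    by (intro has_sum_int_symmetric) (simp add: algebra_simps)
  then have lim1: "(\<lambda>N. (\<Sum>n\<in>{- int N..int N}. V n) + (D (- int N) - D (int N + 1))) \<longlonglongrightarrow> S"
    by (simp only: sum.distrib sum_int_telescope)
  \<comment> \<open>The shift by 1/2 makes the two boundary arguments 1 - x and 1 + x with the same
    x, so that the reflection limit applies.\<close>
  have "(\<lambda>N. - (Digamma (1 + (of_nat N + 1 / 2) / t) - Digamma (1 - (of_nat N + 1 / 2) / t)) / t) \<longlonglongrightarrow> - (- pi * \<i>) / t"
    by (intro tendsto_intros Digamma_reflection_limit t t0)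
  moreover have "- (Digamma (1 + (of_nat N + 1 / 2) / t) - Digamma (1 - (of_nat N + 1 / 2) / t)) / t = D (- int N) - D (int N + 1)" for N
  proof -
    have e1: "1 + (of_int (- int N) - 1 / 2) / t = 1 - (of_nat N + 1 / 2) / t"
      by (simp add: diff_divide_distrib add_divide_distrib)
    have e2: "of_int (int N + 1) - 1 / 2 = (of_nat N + 1 / 2 :: complex)" by (simp add: algebra_simps)
    show ?thesis unfolding D_def e1 e2 by (simp only: minus_diff_eq diff_divide_distrib)
  qed
  ultimately have "(\<lambda>N. D (- int N) - D (int N + 1)) \<longlonglongrightarrow> - (- pi * \<i>) / t" by simp
  from tendsto_diff[OF lim1 this]
  have lim2: "(\<lambda>N. \<Sum>n\<in>{- int N..int N}. V n) \<longlonglongrightarrow> S - pi * \<i> / t" by simp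

  \<comment> \<open>The columns N and -N, together with the point j = 0, form one Lipschitz sum at N
    (-1 / t); the missing point is the subtracted inverse square. These points add up to pi^2 /
    6.\<close>
  have pair: "V (int (Suc i)) + V (- int (Suc i)) = (k * h (q' ^ Suc i)) / t ^ 2 - inverse (of_nat (Suc i) ^ 2)" for i
  proof -
    define N where "N = Suc i"
    define y where "y = of_nat N * (-1 / t)"
    have yZ: "y \<notin> \<int>" unfolding y_def using t' by (intro of_nat_mult_notin_Ints) (auto simp: N_def)
    define f where "f j = inverse (t ^ 2) * inverse ((y + of_int j) ^ 2)" for j
    have f: "f j = inverse ((of_int j * t - of_nat N) ^ 2)" for j
    proof -
      have "of_int j * t - of_nat N = t * (y + of_int j)" using t0 by (simp add: y_def field_simps)
      then show ?thesis by (simp only: f_def power_mult_distrib inverse_mult_distrib)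
    qed
    have "((\<lambda>j. f j) has_sum (inverse (t ^ 2) * (k * h (q' ^ N)))) UNIV"
      unfolding f_def using lipschitz_2[OF yZ]
      by (intro has_sum_cmult_right) (simp only: k_def h_def q'_def y_def qexp_of_nat_mult)
    moreover have "(f has_sum (f (int 0) + V (- int N) + V (int N))) UNIV"
    proof (rule has_sum_int_split[OF has_sum_nat_Suc])
      show "((\<lambda>n. f (int (Suc n))) has_sum V (- int N)) UNIV"
        using V[of "- int N"] by (simp add: f z_def)
      have "f (- 1 - int m) = inverse ((z m + of_int (int N)) ^ 2)" for m
      proof -
        have "of_int (- 1 - int m) * t - of_nat N = - (z m + of_int (int N))" by (simp add: z_def algebra_simps)
        then show ?thesis unfolding f by (simp only: power2_minus)
      qed
      then show "((\<lambda>n. f (- 1 - int n)) has_sum V (int N)) UNIV" using V[of "int N"] by simp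
    qed
    ultimately have "f (int 0) + V (- int N) + V (int N) = inverse (t ^ 2) * (k * h (q' ^ N))"
      using has_sum_unique by blast
    moreover have "f (int 0) = inverse (of_nat N ^ 2)" by (simp add: f)
    ultimately show ?thesis unfolding N_def by (simp only: divide_inverse eq_diff_eq) (simp only: ac_simps)
  qed
  have basel: "(\<lambda>i. inverse (of_nat (Suc i) ^ 2) :: complex) sums (pi^2 / 6)"
  proof -
    have "(\<lambda>i. complex_of_real (1 / (real i + 1)^2)) sums of_real (pi^2 / 6)"
      using inverse_squares_sums by (subst sums_of_real_iff) (simp add: add.commute)
    then show ?thesis by (simp add: inverse_eq_divide add.commute)
  qed
  have V0: "V 0 = (pi^2 / 6) / t^2"
  proof -
    have "(\<lambda>m. inverse ((z m + of_int 0) ^ 2)) sums V 0" using V by (rule has_sum_imp_sums)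
    moreover have "(\<lambda>m. inverse ((z m + of_int 0) ^ 2)) sums ((pi^2 / 6) / t^2)"
      using sums_divide[OF basel, of "t^2"]
      by (simp only: z_def of_int_0 add_0_right power_mult_distrib inverse_mult_distrib divide_inverse)
    ultimately show ?thesis using sums_unique2 by blast
  qed
  have "(\<Sum>n\<in>{- int N..int N}. V n) = V 0 + (\<Sum>i<N. (k * h (q' ^ Suc i)) / t ^ 2 - inverse (of_nat (Suc i) ^ 2))" for N
  proof (induction N)
    case (Suc N)
    then show ?case unfolding sum_int_symmetric_Suc pair by simp
  qed simp
  moreover have "(\<lambda>N. V 0 + (\<Sum>i<N. (k * h (q' ^ Suc i)) / t ^ 2 - inverse (of_nat (Suc i) ^ 2)))
      \<longlonglongrightarrow> V 0 + (k * s' / t^2 - pi^2 / 6)"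
    using sums_diff[OF sums_divide[OF sums_mult[OF has_sum_imp_sums[OF s'(1)]]] basel, of k "t^2"]
    by (intro tendsto_add tendsto_const) (simp add: sums_def)
  ultimately have "S - pi * \<i> / t = V 0 + (k * s' / t^2 - pi^2 / 6)"
    using LIMSEQ_unique[OF lim2] by simp
  then have main: "k * s - pi * \<i> / t = (pi^2 / 6) / t^2 + (k * s' / t^2 - pi^2 / 6)"
    unfolding S_eq V0 .
  have E: "E2q q = 1 - 24 * s" "E2q q' = 1 - 24 * s'"
    using infsumI[OF s(2)] infsumI[OF s'(2)] by (simp_all add: E2q_def)
  have k: "k = - 4 * pi^2" by (simp add: k_def power_mult_distrib)
  define P where "P = complex_of_real pi"
  have P: "P \<noteq> 0" by (simp add: P_def)
  have "t^2 * (- 4 * P^2 * s - P * \<i> / t) = t^2 * ((P^2 / 6) / t^2 + (- 4 * P^2 * s' / t^2 - P^2 / 6))"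
    using main unfolding k P_def by simp
  then have "- 4 * P^2 * s * t^2 - P * \<i> * t = P^2 / 6 - 4 * P^2 * s' - P^2 / 6 * t^2"
    using t0 by (simp add: distrib_left right_diff_distrib power2_eq_square mult_ac)
  then have "P * (P * (1 - 24 * s')) = P * (P * (t^2 * (1 - 24 * s)) - 6 * \<i> * t)"
    by (simp add: algebra_simps power2_eq_square)
  then have "P * (1 - 24 * s') = P * (t^2 * (1 - 24 * s)) - 6 * \<i> * t"
    using P by (subst (asm) mult_left_cancel) auto
  then have "1 - 24 * s' = (P * (t^2 * (1 - 24 * s)) - 6 * \<i> * t) / P"
    using P by (simp add: eq_divide_eq mult.commute)
  also have "\<dots> = t^2 * (1 - 24 * s) + - (6 * \<i> * t) / P"
    using P by (simp add: diff_divide_distrib)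
  also have "- (6 * \<i> * t) / P = 6 * t / (P * \<i>)"
    using P by (simp add: divide_simps)
  finally have "1 - 24 * s' = t^2 * (1 - 24 * s) + 6 * t / (P * \<i>)" .
  then show ?thesis using E by (simp add: q_def q'_def P_def)
qed

section \<open>The Dedekind eta function\<close>

definition sigma_fps :: "int fps" where "sigma_fps = Abs_fps (\<lambda>n. int (divisor_sigma 1 n))"

lemma divisor_sigma_0 [simp]: "divisor_sigma k 0 = 0"
  by (simp add: divisor_sigma_def)

lemma fps_X_deriv_nth:
  "fps_nth (fps_X * fps_deriv F) n = of_nat n * fps_nth (F :: 'a :: comm_ring_1 fps) n"
  by (cases n) simp_all

text \<open>Logarithmic derivative without division: the factor 1 - X^m contributes m (X^m + X^(2m)
  + ...), so \<open>R\<close> collects the divisors up to \<open>Suc N\<close>.\<close>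

lemma euler_partial_log_deriv:
  "\<exists>R. fps_X * fps_deriv (\<Prod>i\<le>N. 1 - fps_X ^ Suc i :: int fps) = - ((\<Prod>i\<le>N. 1 - fps_X ^ Suc i) * R) \<and>
     (\<forall>n. fps_nth R n = (if n = 0 then 0 else \<Sum>d | d dvd n \<and> d \<le> Suc N. int d))"
proof -
  have factor: "\<exists>R. fps_X * fps_deriv (1 - fps_X ^ m :: int fps) = - ((1 - fps_X ^ m) * R) \<and>
      (\<forall>n. fps_nth R n = (if n > 0 \<and> m dvd n then int m else 0))" if "m > 0" for m :: nat
  proof (intro exI conjI allI)
    let ?R = "Abs_fps (\<lambda>n. if n > 0 \<and> m dvd n then int m else 0)"
    show "fps_nth ?R n = (if n > 0 \<and> m dvd n then int m else 0)" for n by simp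
    \<comment> \<open>The recursion of the geometric series m X^m / (1 - X^m).\<close>
    have R: "?R = fps_X ^ m * ?R + fps_const (int m) * fps_X ^ m"
    proof (rule fps_ext)
      fix n
      show "fps_nth ?R n = fps_nth (fps_X ^ m * ?R + fps_const (int m) * fps_X ^ m) n"
        using that by (auto simp: fps_X_power_mult_nth dvd_minus_self dest: dvd_imp_le)
    qed
    have "fps_X * fps_deriv (1 - fps_X ^ m :: int fps) = - (fps_const (int m) * fps_X ^ m)"
      by (rule fps_ext) (simp add: fps_X_deriv_nth fps_X_power_nth)
    also have "fps_const (int m) * fps_X ^ m = (1 - fps_X ^ m) * ?R"
      using R by (simp add: algebra_simps)
    finally show "fps_X * fps_deriv (1 - fps_X ^ m :: int fps) = - ((1 - fps_X ^ m) * ?R)" .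
  qed
  show ?thesis
  proof (induction N)
    case 0
    obtain R where R: "fps_X * fps_deriv (1 - fps_X ^ Suc 0 :: int fps) = - ((1 - fps_X ^ Suc 0) * R)"
      "\<And>n. fps_nth R n = (if n > 0 \<and> Suc 0 dvd n then int (Suc 0) else 0)"
      using factor[of "Suc 0"] by auto
    have "{d. d dvd n \<and> d \<le> Suc 0} = {1}" if "n > 0" for n :: nat
      using that by (auto simp: le_Suc_eq)
    then show ?case using R by (intro exI[of _ R]) auto
  next
    case (Suc N)
    let ?P = "\<Prod>i\<le>N. 1 - fps_X ^ Suc i :: int fps"
    let ?m = "Suc (Suc N)"
    obtain R where R: "fps_X * fps_deriv ?P = - (?P * R)"
      "\<And>n. fps_nth R n = (if n = 0 then 0 else \<Sum>d | d dvd n \<and> d \<le> Suc N. int d)"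
      using Suc.IH by blast
    obtain T where T: "fps_X * fps_deriv (1 - fps_X ^ ?m :: int fps) = - ((1 - fps_X ^ ?m) * T)"
      "\<And>n. fps_nth T n = (if n > 0 \<and> ?m dvd n then int ?m else 0)"
      using factor[of ?m] by auto
    have "fps_X * fps_deriv (?P * (1 - fps_X ^ ?m)) =
      (fps_X * fps_deriv ?P) * (1 - fps_X ^ ?m) + ?P * (fps_X * fps_deriv (1 - fps_X ^ ?m))"
      by (simp only: fps_deriv_mult) (simp add: algebra_simps)
    also have "\<dots> = - ((?P * (1 - fps_X ^ ?m)) * (R + T))"
      unfolding R(1) T(1) by (simp add: algebra_simps)
    finally have "fps_X * fps_deriv (\<Prod>i\<le>Suc N. 1 - fps_X ^ Suc i :: int fps) =
      - ((\<Prod>i\<le>Suc N. 1 - fps_X ^ Suc i) * (R + T))"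
      unfolding prod.atMost_Suc .
    moreover have "fps_nth (R + T) n = (if n = 0 then 0 else \<Sum>d | d dvd n \<and> d \<le> Suc (Suc N). int d)" for n
    proof (cases "n = 0")
      case False
      then have fin: "finite {d. d dvd n}" by simp
      have "{d. d dvd n \<and> d \<le> Suc (Suc N)} = {d. d dvd n \<and> d \<le> Suc N} \<union> (if ?m dvd n then {?m} else {})"
        by (auto simp: le_Suc_eq)
      then show ?thesis using False fin R(2) T(2) by (auto simp: sum.union_disjoint)
    qed (simp add: R(2) T(2))
    ultimately show ?case by blast
  qed
qed

lemma fps_mult_nth_cong:
  assumes "\<And>i. i \<le> n \<Longrightarrow> fps_nth F i = fps_nth F' i" "\<And>i. i \<le> n \<Longrightarrow> fps_nth G i = fps_nth G' i"
  shows "fps_nth (F * G) n = fps_nth (F' * G') n"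
  using assms by (simp add: fps_mult_nth)

text \<open>The n-th coefficients only involve the factors up to n, and up to that index the
  truncated divisor sums are complete.\<close>

lemma euler_fps_log_deriv: "fps_X * fps_deriv euler_fps = - (euler_fps * sigma_fps)"
proof (rule fps_ext)
  fix n
  let ?P = "\<Prod>i\<le>n. 1 - fps_X ^ Suc i :: int fps"
  obtain R where R: "fps_X * fps_deriv ?P = - (?P * R)"
    "\<And>k. fps_nth R k = (if k = 0 then 0 else \<Sum>d | d dvd k \<and> d \<le> Suc n. int d)"
    using euler_partial_log_deriv[of n] by blast
  have P: "fps_nth euler_fps i = fps_nth ?P i" if "i \<le> n" for i
    using that euler_partial_nth[of i n] by (simp add: euler_fps_nth)
  have S: "fps_nth sigma_fps i = fps_nth R i" if "i \<le> n" for i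
  proof (cases "i = 0")
    case False
    then have "{d. d dvd i \<and> d \<le> Suc n} = {d. d dvd i}" using that by (auto dest: dvd_imp_le)
    then show ?thesis using False by (simp add: sigma_fps_def R(2) divisor_sigma_def)
  qed (simp add: sigma_fps_def R(2))
  have "fps_nth (fps_X * fps_deriv euler_fps) n = fps_nth (fps_X * fps_deriv ?P) n"
    unfolding fps_X_deriv_nth P[OF order_refl] ..
  also have "\<dots> = fps_nth (- (euler_fps * sigma_fps)) n"
    unfolding R(1) fps_neg_nth using P S by (intro arg_cong[of _ _ uminus] fps_mult_nth_cong) auto
  finally show "fps_nth (fps_X * fps_deriv euler_fps) n = fps_nth (- (euler_fps * sigma_fps)) n" .
qed

definition cfps :: "int fps \<Rightarrow> complex fps" where "cfps F = Abs_fps (\<lambda>n. of_int (fps_nth F n))"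

lemma cfps_nth [simp]: "fps_nth (cfps F) n = of_int (fps_nth F n)" by (simp add: cfps_def)

lemma cfps_mult: "cfps (F * G) = cfps F * cfps G" by (rule fps_ext) (simp add: fps_mult_nth)

lemma cfps_1 [simp]: "cfps 1 = 1" by (rule fps_ext) simp

lemma cfps_power: "cfps (F ^ n) = cfps F ^ n" by (induction n) (simp_all add: cfps_mult)

lemma divisor_sigma_series:
  assumes "norm (q::complex) < 1" "k = 1 \<or> k = 3"
  shows "summable (\<lambda>n. norm (of_nat (divisor_sigma k n) * q ^ n))"
    "(\<lambda>n. of_nat (divisor_sigma k n) * q ^ n) sums (\<Sum>\<^sub>\<infinity>n. of_nat (divisor_sigma k n) * q ^ n)"
proof -
  have "\<exists>h. \<forall>w::complex. norm w < 1 \<longrightarrow> ((\<lambda>n::nat. of_nat n ^ k * w ^ n) has_sum h w) UNIV"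
    using assms(2)
  proof
    assume "k = 1"
    then show ?thesis
      by (intro exI[of _ "\<lambda>w. w / (1 - w)^2"]) (simp add: power_sums_has_sum(1))
  next
    assume "k = 3"
    then show ?thesis
      by (intro exI[of _ "\<lambda>w. w * (1 + 4 * w + w^2) / (1 - w)^4"]) (simp add: power_sums_has_sum(2))
  qed
  then obtain h where h: "\<And>w::complex. norm w < 1 \<Longrightarrow> ((\<lambda>n::nat. of_nat n ^ k * w ^ n) has_sum h w) UNIV"
    by blast
  obtain s where s: "((\<lambda>n. of_nat (divisor_sigma k n) * q ^ n) has_sum s) UNIV"
    by (rule has_sum_lambert[OF assms(1) _ h]) (use assms(2) in auto)
  have "(\<lambda>n. norm (of_nat (divisor_sigma k n) * q ^ n)) summable_on UNIV"
    using has_sum_imp_summable[OF s] by (simp only: summable_on_iff_abs_summable_on_complex)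
  then show "summable (\<lambda>n. norm (of_nat (divisor_sigma k n) * q ^ n))" by (rule summable_on_imp_summable)
  show "(\<lambda>n. of_nat (divisor_sigma k n) * q ^ n) sums (\<Sum>\<^sub>\<infinity>n. of_nat (divisor_sigma k n) * q ^ n)"
    using s infsumI has_sum_imp_sums by blast
qed

lemma conv_radius_ge_1I:
  fixes F :: "complex fps"
  assumes "\<And>q. norm q < 1 \<Longrightarrow> summable (\<lambda>n. fps_nth F n * q ^ n)"
  shows "fps_conv_radius F \<ge> 1"
  unfolding fps_conv_radius_def by (rule conv_radius_geI_ex') (auto intro!: assms)

text \<open>The bridge between formal and analytic arguments: identities of functions on the unit
  disc become identities of series through \<open>represents_unique\<close>.\<close>

definition represents :: "complex fps \<Rightarrow> (complex \<Rightarrow> complex) \<Rightarrow> bool" where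
  "represents F f \<longleftrightarrow> fps_conv_radius F \<ge> 1 \<and> (\<forall>q. norm q < 1 \<longrightarrow> eval_fps F q = f q)"

lemma represents_radius: "represents F f \<Longrightarrow> norm (q :: complex) < 1 \<Longrightarrow> ereal (norm q) < fps_conv_radius F"
  by (auto simp: represents_def intro: less_le_trans[of _ 1])

lemma represents_mult:
  assumes "represents F f" "represents G g"
  shows "represents (F * G) (\<lambda>q. f q * g q)"
  unfolding represents_def
proof (intro conjI allI impI)
  show "fps_conv_radius (F * G) \<ge> 1"
    using fps_conv_radius_mult[of F G] assms unfolding represents_def by (meson min.bounded_iff order_trans)
  show "eval_fps (F * G) q = f q * g q" if "norm q < 1" for q
    using assms that represents_radius[OF assms(1) that] represents_radius[OF assms(2) that]
    by (simp add: eval_fps_mult represents_def)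
qed

lemma represents_power: "represents F f \<Longrightarrow> represents (F ^ n) (\<lambda>q. f q ^ n)"
proof (induction n)
  case 0
  then show ?case by (simp add: represents_def)
next
  case (Suc n)
  then show ?case using represents_mult[of F f "F ^ n" "\<lambda>q. f q ^ n"] by simp
qed

lemma represents_holomorphic: "represents F f \<Longrightarrow> f holomorphic_on ball 0 1"
proof -
  assume F: "represents F f"
  have "eval_fps F holomorphic_on ball 0 1"
    by (rule holomorphic_on_eval_fps) (use represents_radius[OF F] in \<open>auto simp: in_eball_iff\<close>)
  then show ?thesis
    by (rule holomorphic_transform) (use F in \<open>auto simp: represents_def\<close>)
qed

lemma represents_expansion: "represents F f \<Longrightarrow> f has_fps_expansion F"
  unfolding has_fps_expansion_def represents_def
  by (auto intro: less_le_trans[of _ 1] intro!: eventually_nhds_in_open[THEN eventually_mono, of "ball 0 1"])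

lemma represents_fps_expansion:
  assumes "f holomorphic_on ball 0 1"
  shows "represents (fps_expansion f 0) f"
proof -
  have "f holomorphic_on eball 0 1" using assms by (simp add: one_ereal_def)
  then show ?thesis
    using conv_radius_fps_expansion[of f 0 1] eval_fps_expansion'[of f 0 1] by (simp add: represents_def)
qed

lemma represents_unique: "represents F f \<Longrightarrow> represents G f \<Longrightarrow> F = G"
  using fps_expansion_unique_complex represents_expansion by blast

lemma represents_E4: "represents (cfps E4_fps) E4q"
proof -
  have *: "(\<lambda>n. fps_nth (cfps E4_fps) n * q ^ n) sums E4q q" if "norm q < 1" for q
  proof -
    have "(\<lambda>n. (if n = 0 then 1 else 0) + 240 * (of_nat (divisor_sigma 3 n) * q ^ n)) sums E4q q"
      unfolding E4q_def using sums_single[of 0 "\<lambda>_. 1 :: complex"]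
      by (intro sums_add sums_mult divisor_sigma_series that) (simp_all add: if_distrib cong: if_cong)
    also have "(\<lambda>n. (if n = 0 then 1 else 0) + 240 * (of_nat (divisor_sigma 3 n) * q ^ n)) =
      (\<lambda>n. fps_nth (cfps E4_fps) n * q ^ n)" by (auto simp: E4_fps_def)
    finally show ?thesis .
  qed
  then have "fps_conv_radius (cfps E4_fps) \<ge> 1" by (intro conv_radius_ge_1I) (auto simp: sums_iff)
  then show ?thesis using * by (auto simp: represents_def eval_fps_def sums_iff)
qed

text \<open>Minus the logarithm of the Euler product. The coefficient at n = 0 is 0 / 0 = 0, so
  \<open>log_euler 0 = 0\<close>.\<close>

definition log_euler :: "complex \<Rightarrow> complex" where
  "log_euler = eval_fps (Abs_fps (\<lambda>n. of_nat (divisor_sigma 1 n) / of_nat n))"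

lemma has_field_derivative_log_euler:
  assumes q: "norm q < 1"
  shows "\<exists>D. (log_euler has_field_derivative D) (at q) \<and> q * D = eval_fps (cfps sigma_fps) q"
    "1 - 24 * eval_fps (cfps sigma_fps) q = E2q q"
proof -
  let ?L = "Abs_fps (\<lambda>n. of_nat (divisor_sigma 1 n) / of_nat n) :: complex fps"
  have r: "fps_conv_radius ?L \<ge> 1"
  proof (rule conv_radius_ge_1I, rule summable_comparison_test)
    fix q :: complex assume q: "norm q < 1"
    show "\<exists>N. \<forall>n\<ge>N. norm (fps_nth ?L n * q ^ n) \<le> norm (of_nat (divisor_sigma 1 n) * q ^ n)"
    proof (intro exI allI impI)
      fix n :: nat assume n: "1 \<le> n"
      have "real (divisor_sigma 1 n) / real n \<le> real (divisor_sigma 1 n) / 1"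
        using n by (intro divide_left_mono) auto
      then have "real (divisor_sigma 1 n) / real n * norm (q ^ n) \<le> real (divisor_sigma 1 n) / 1 * norm (q ^ n)"
        by (rule mult_right_mono) simp
      then show "norm (fps_nth ?L n * q ^ n) \<le> norm (of_nat (divisor_sigma 1 n) * q ^ n)"
        by (simp add: norm_mult norm_divide)
    qed
    show "summable (\<lambda>n. norm (of_nat (divisor_sigma 1 n) * q ^ n))"
      by (rule divisor_sigma_series) (use q in auto)
  qed
  have r': "ereal (norm q) < fps_conv_radius ?L" "ereal (norm q) < fps_conv_radius (fps_deriv ?L)"
    using r fps_conv_radius_deriv[of ?L] q by (auto intro: less_le_trans[of _ 1] less_le_trans)
  have "fps_X * fps_deriv ?L = cfps sigma_fps"
  proof (rule fps_ext)
    fix n show "fps_nth (fps_X * fps_deriv ?L) n = fps_nth (cfps sigma_fps) n"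
      by (cases n) (simp_all add: sigma_fps_def del: of_nat_Suc)
  qed
  then have "q * eval_fps (fps_deriv ?L) q = eval_fps (cfps sigma_fps) q"
    using eval_fps_mult[of q fps_X "fps_deriv ?L"] r' by simp
  then show "\<exists>D. (log_euler has_field_derivative D) (at q) \<and> q * D = eval_fps (cfps sigma_fps) q"
    unfolding log_euler_def using has_field_derivative_eval_fps[OF r'(1)] by blast
  have "eval_fps (cfps sigma_fps) q = (\<Sum>\<^sub>\<infinity>n. of_nat (divisor_sigma 1 n) * q ^ n)"
    using sums_unique[OF divisor_sigma_series(2)[OF q, of 1]] by (simp add: eval_fps_def sigma_fps_def)
  then show "1 - 24 * eval_fps (cfps sigma_fps) q = E2q q" by (simp add: E2q_def)
qed

lemma log_euler_holomorphic: "log_euler holomorphic_on ball 0 1"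
  unfolding holomorphic_on_open[OF open_ball] using has_field_derivative_log_euler(1) by (metis dist_0_norm mem_ball)

text \<open>The differential equation \<open>q P' = - P (\<Sum>n. divisor_sigma 1 n * q ^ n)\<close> identifies
  $(q;q)_\infty$ with \<open>exp (- log_euler q)\<close>, so that convergence and nonvanishing on the disc come
  without any infinite product of functions.\<close>

lemma represents_euler: "represents (cfps euler_fps) (\<lambda>q. exp (- log_euler q))"
proof -
  let ?P = "\<lambda>q. exp (- log_euler q)"
  define F where "F = fps_expansion ?P 0"
  have F: "represents F ?P" unfolding F_def
    by (intro represents_fps_expansion holomorphic_intros log_euler_holomorphic)
  have S: "represents (cfps sigma_fps) (\<lambda>q. eval_fps (cfps sigma_fps) q)"
  proof -
    have "summable (\<lambda>n. fps_nth (cfps sigma_fps) n * q ^ n)" if "norm q < 1" for q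
      using sums_summable[OF divisor_sigma_series(2)[OF that, of 1]] by (simp add: sigma_fps_def)
    then show ?thesis by (auto simp: represents_def intro: conv_radius_ge_1I)
  qed
  have "represents (fps_X * fps_deriv F) (\<lambda>q. - (?P q * eval_fps (cfps sigma_fps) q))"
    unfolding represents_def
  proof (intro conjI allI impI)
    have "fps_conv_radius (fps_deriv F) \<ge> 1"
      using fps_conv_radius_deriv[of F] F unfolding represents_def by (meson order_trans)
    then show "fps_conv_radius (fps_X * fps_deriv F) \<ge> 1"
      using fps_conv_radius_mult[of fps_X "fps_deriv F"] by simp
    fix q :: complex assume q: "norm q < 1"
    obtain D where D: "(log_euler has_field_derivative D) (at q)" "q * D = eval_fps (cfps sigma_fps) q"
      using has_field_derivative_log_euler(1)[OF q] by blast
    have r: "ereal (norm q) < fps_conv_radius F" "ereal (norm q) < fps_conv_radius (fps_deriv F)"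
      using represents_radius[OF F q] fps_conv_radius_deriv[of F] by (auto intro: less_le_trans)
    have "(?P has_field_derivative ?P q * - D) (at q)"
      by (rule derivative_eq_intros D refl)+
    moreover have "(?P has_field_derivative eval_fps (fps_deriv F) q) (at q)"
    proof (rule DERIV_cong_ev[THEN iffD1, OF refl _ refl has_field_derivative_eval_fps[OF r(1)]])
      show "\<forall>\<^sub>F z in nhds q. eval_fps F z = ?P z"
        using F q by (intro eventually_nhds_in_open[THEN eventually_mono, of "ball 0 1"]) (auto simp: represents_def)
    qed
    ultimately have "eval_fps (fps_deriv F) q = ?P q * - D" by (rule DERIV_unique[rotated])
    then show "eval_fps (fps_X * fps_deriv F) q = - (?P q * eval_fps (cfps sigma_fps) q)"
      using r by (simp add: eval_fps_mult flip: D(2))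
  qed
  moreover have "represents (- (F * cfps sigma_fps)) (\<lambda>q. - (?P q * eval_fps (cfps sigma_fps) q))"
    using represents_mult[OF F S] represents_radius[OF represents_mult[OF F S]]
    by (simp add: represents_def eval_fps_minus)
  ultimately have ode: "fps_X * fps_deriv F = - (F * cfps sigma_fps)" by (rule represents_unique)
  have "fps_X * fps_deriv (cfps euler_fps) = cfps (fps_X * fps_deriv euler_fps)"
  proof (rule fps_ext)
    fix n show "fps_nth (fps_X * fps_deriv (cfps euler_fps)) n = fps_nth (cfps (fps_X * fps_deriv euler_fps)) n"
      by (cases n) simp_all
  qed
  also have "\<dots> = - (cfps euler_fps * cfps sigma_fps)"
    unfolding euler_fps_log_deriv cfps_mult[symmetric] by (rule fps_ext) simp
  finally have ode': "fps_X * fps_deriv (cfps euler_fps) = - (cfps euler_fps * cfps sigma_fps)" .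
  have "fps_nth F n = fps_nth (cfps euler_fps) n" for n
  proof (induction n rule: less_induct)
    case (less n)
    show ?case
    proof (cases n)
      case 0
      have "eval_fps F 0 = ?P 0" using F by (simp add: represents_def)
      then have "fps_nth F 0 = 1"
        by (simp add: eval_fps_at_0 log_euler_def)
      then show ?thesis using 0 by (simp add: euler_fps_nth)
    next
      case (Suc m)
      \<comment> \<open>The differential equation read as a recursion; the term i = n drops out
        since the divisor sum at 0 is 0, so the constant term determines the series.\<close>
      have rec: "of_nat n * fps_nth G n = - (\<Sum>i=0..m. fps_nth G i * fps_nth (cfps sigma_fps) (n - i))"
        if "fps_X * fps_deriv G = - (G * cfps sigma_fps)" for G
      proof -
        have "of_nat n * fps_nth G n = fps_nth (fps_X * fps_deriv G) n" using Suc by simp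
        also have "\<dots> = - (\<Sum>i=0..n. fps_nth G i * fps_nth (cfps sigma_fps) (n - i))"
          unfolding that by (simp add: fps_mult_nth)
        also have "(\<Sum>i=0..n. fps_nth G i * fps_nth (cfps sigma_fps) (n - i)) =
          (\<Sum>i=0..m. fps_nth G i * fps_nth (cfps sigma_fps) (n - i))"
          using Suc by (simp add: sigma_fps_def)
        finally show ?thesis .
      qed
      have "of_nat n * fps_nth F n = of_nat n * fps_nth (cfps euler_fps) n"
        unfolding rec[OF ode] rec[OF ode'] using less.IH Suc by (intro arg_cong[of _ _ uminus] sum.cong) auto
      then show ?thesis using Suc by (simp del: of_nat_Suc)
    qed
  qed
  then have "F = cfps euler_fps" by (rule fps_ext)
  then show ?thesis using F by simp
qed

definition partition_fps :: "int fps" where "partition_fps = fps_right_inverse euler_fps 1"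

lemma euler_times_partition: "euler_fps * partition_fps = 1"
  unfolding partition_fps_def by (rule fps_right_inverse) (simp add: euler_fps_nth)

lemma represents_partition: "represents (cfps partition_fps) (\<lambda>q. exp (log_euler q))"
proof -
  define F where "F = fps_expansion (\<lambda>q. exp (log_euler q)) 0"
  have F: "represents F (\<lambda>q. exp (log_euler q))" unfolding F_def
    by (intro represents_fps_expansion holomorphic_intros log_euler_holomorphic)
  have "represents (cfps euler_fps * F) (\<lambda>q. 1)"
    using represents_mult[OF represents_euler F] by (simp add: represents_def flip: exp_add)
  moreover have "represents 1 (\<lambda>q. 1)" by (simp add: represents_def)
  ultimately have "cfps euler_fps * F = 1" by (rule represents_unique)
  moreover have "cfps euler_fps * cfps partition_fps = 1"
    by (simp add: euler_times_partition flip: cfps_mult)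
  ultimately have "F = cfps partition_fps" by (metis mult.assoc mult.commute mult_1)
  then show ?thesis using F by simp
qed

text \<open>A single exponential: it never vanishes, and the factor q^(1/24) requires no choice of a
  root.\<close>

definition eta :: "complex \<Rightarrow> complex" where
  "eta t = exp (2 * pi * \<i> * t / 24 - log_euler (qexp t))"

lemma eta_nonzero [simp]: "eta t \<noteq> 0" by (simp add: eta_def)

lemma has_field_derivative_eta:
  assumes t: "Im t > 0"
  shows "(eta has_field_derivative (2 * pi * \<i> / 24 * E2q (qexp t)) * eta t) (at t)"
proof -
  have q: "norm (qexp t) < 1" using t by simp
  obtain D where D: "(log_euler has_field_derivative D) (at (qexp t))" "qexp t * D = eval_fps (cfps sigma_fps) (qexp t)"
    using has_field_derivative_log_euler(1)[OF q] by blast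
  have "((\<lambda>t. log_euler (qexp t)) has_field_derivative D * (2 * pi * \<i> * qexp t)) (at t)"
    by (rule DERIV_chain2[OF D(1) DERIV_qexp])
  moreover have "((\<lambda>t. 2 * pi * \<i> * t / 24) has_field_derivative 2 * pi * \<i> / 24) (at t)"
    by (rule DERIV_cdivide) (rule DERIV_cmult_Id)
  ultimately have "((\<lambda>t. 2 * pi * \<i> * t / 24 - log_euler (qexp t)) has_field_derivative
      2 * pi * \<i> / 24 - D * (2 * pi * \<i> * qexp t)) (at t)"
    by (intro DERIV_diff)
  from DERIV_chain2[OF DERIV_exp this]
  have "(eta has_field_derivative eta t * (2 * pi * \<i> / 24 - D * (2 * pi * \<i> * qexp t))) (at t)"
    unfolding eta_def[abs_def] .
  also have "D * (2 * pi * \<i> * qexp t) = 2 * pi * \<i> * eval_fps (cfps sigma_fps) (qexp t)"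
    unfolding D(2)[symmetric] by simp
  also have "eta t * (2 * pi * \<i> / 24 - 2 * pi * \<i> * eval_fps (cfps sigma_fps) (qexp t)) =
     (2 * pi * \<i> / 24 * E2q (qexp t)) * eta t"
    unfolding has_field_derivative_log_euler(2)[OF q, symmetric] by (simp add: algebra_simps)
  finally show ?thesis .
qed

text \<open>The quotient of the two sides is constant, because the anomaly 6 t / (pi
  \<open>\<i>\<close>) of \<open>E2q\<close> contributes exactly the logarithmic derivative 1 / (2
  t) of the square root. The fixed point t = \<open>\<i>\<close> gives the constant 1.\<close>

lemma eta_inversion:
  assumes "Im t > 0"
  shows "eta (-1 / t) = csqrt (- \<i> * t) * eta t"
proof -
  let ?H = "{t. Im t > 0}"
  define g where "g t = eta (-1 / t) / (csqrt (- \<i> * t) * eta t)" for t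
  have "(g has_field_derivative 0) (at t within ?H)" if "t \<in> ?H" for t
  proof -
    have t: "Im t > 0" using that by simp
    have t0: "t \<noteq> 0" using t by auto
    have t': "Im (-1 / t) > 0" using t by (simp add: Im_divide add_nonneg_pos divide_pos_pos)
    have s0: "csqrt (- \<i> * t) \<noteq> 0" using t0 by (simp del: csqrt.simps)
    have nr: "- \<i> * t \<notin> \<real>\<^sub>\<le>\<^sub>0" using t by (auto simp: complex_nonpos_Reals_iff)
    define A where "A = 2 * pi * \<i> / 24 * E2q (qexp t) + 1 / (2 * t)"
    have inv: "((\<lambda>t. -1 / t) has_field_derivative 1 / t ^ 2) (at t)"
      by (rule derivative_eq_intros refl | use t0 in force)+ (use t0 in \<open>simp add: power2_eq_square\<close>)
    have "((\<lambda>t. eta (-1 / t)) has_field_derivative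
        (2 * pi * \<i> / 24 * E2q (qexp (-1 / t))) * eta (-1 / t) * (1 / t^2)) (at t)"
      by (rule DERIV_chain2[OF has_field_derivative_eta[OF t'] inv])
    also have "(2 * pi * \<i> / 24 * E2q (qexp (-1 / t))) * eta (-1 / t) * (1 / t^2) = A * eta (-1 / t)"
    proof -
      have "(2 * pi * \<i> / 24) * (6 * t / (pi * \<i>)) * (1 / t^2) = 1 / (2 * t)"
        using t0 by (simp add: power2_eq_square)
      moreover have "(2 * pi * \<i> / 24) * (t^2 * E2q (qexp t)) * (1 / t^2) = 2 * pi * \<i> / 24 * E2q (qexp t)"
        using t0 by simp
      ultimately have "(2 * pi * \<i> / 24) * E2q (qexp (-1 / t)) * (1 / t^2) = A"
        unfolding E2q_inversion[OF t] A_def distrib_left distrib_right by (simp only: add.commute)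
      then show ?thesis by (metis mult.assoc mult.commute)
    qed
    finally have n: "((\<lambda>t. eta (-1 / t)) has_field_derivative A * eta (-1 / t)) (at t)" .
    have "((\<lambda>t. csqrt (- \<i> * t)) has_field_derivative - \<i> / (2 * csqrt (- \<i> * t))) (at t)"
      by (rule derivative_eq_intros refl nr)+ simp
    also have "- \<i> / (2 * csqrt (- \<i> * t)) = 1 / (2 * t) * csqrt (- \<i> * t)"
    proof -
      have "csqrt (- \<i> * t) * csqrt (- \<i> * t) = - \<i> * t"
        using power2_csqrt[of "- \<i> * t"] by (simp only: power2_eq_square)
      then have "- \<i> = csqrt (- \<i> * t) * csqrt (- \<i> * t) / t" using t0 by simp
      then have "- \<i> / (2 * csqrt (- \<i> * t)) = csqrt (- \<i> * t) * csqrt (- \<i> * t) / t / (2 * csqrt (- \<i> * t))"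
        by (rule arg_cong)
      also have "\<dots> = 1 / (2 * t) * csqrt (- \<i> * t)" using s0 t0 by (simp del: csqrt.simps add: field_simps)
      finally show ?thesis .
    qed
    finally have "((\<lambda>t. csqrt (- \<i> * t) * eta t) has_field_derivative
      1 / (2 * t) * csqrt (- \<i> * t) * eta t + (2 * pi * \<i> / 24 * E2q (qexp t)) * eta t * csqrt (- \<i> * t)) (at t)"
      using has_field_derivative_eta[OF t] by (rule DERIV_mult)
    also have "1 / (2 * t) * csqrt (- \<i> * t) * eta t + (2 * pi * \<i> / 24 * E2q (qexp t)) * eta t * csqrt (- \<i> * t)
       = A * (csqrt (- \<i> * t) * eta t)"
      by (simp add: A_def algebra_simps del: csqrt.simps)
    finally have d: "((\<lambda>t. csqrt (- \<i> * t) * eta t) has_field_derivative A * (csqrt (- \<i> * t) * eta t)) (at t)" .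
    have "(g has_field_derivative (A * eta (-1 / t) * (csqrt (- \<i> * t) * eta t) - eta (-1 / t) * (A * (csqrt (- \<i> * t) * eta t))) /
       ((csqrt (- \<i> * t) * eta t) * (csqrt (- \<i> * t) * eta t))) (at t)"
      unfolding g_def by (rule DERIV_divide[OF n d]) (use s0 in simp)
    then have "(g has_field_derivative 0) (at t)" by simp
    then show ?thesis by (rule has_field_derivative_at_within)
  qed
  moreover have "convex ?H" by (rule convex_halfspace_Im_gt)
  ultimately obtain c where c: "\<And>t. t \<in> ?H \<Longrightarrow> g t = c"
    using has_field_derivative_zero_constant[of ?H g] by blast
  have "g \<i> = 1" by (simp add: g_def)
  then have "g t = 1" using c[of \<i>] c[of t] assms by simp
  moreover have "csqrt (- \<i> * t) \<noteq> 0" using assms by (auto simp del: csqrt.simps)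
  ultimately show ?thesis by (simp add: g_def field_simps del: csqrt.simps)
qed

section \<open>Multipliers in weight 7/2\<close>

lemma csqrt_Re_gt: assumes "Re z > 0" shows "\<bar>Im (csqrt z)\<bar> < Re (csqrt z)"
proof -
  have "Re z = (Re (csqrt z))^2 - (Im (csqrt z))^2"
    using arg_cong[OF power2_csqrt[of z], of Re] by (simp add: power2_eq_square del: csqrt.simps)
  then have "\<bar>Im (csqrt z)\<bar>^2 < (Re (csqrt z))^2" using assms by (simp del: csqrt.simps)
  then show ?thesis using Re_csqrt power2_less_imp_less by blast
qed

lemma eq_if_power2_eq_Re_pos: assumes "w^2 = z^2" "Re w > 0" "Re z > 0" shows "w = z"
  using assms by (auto simp: power2_eq_iff)

text \<open>The roots of u, v, w have arguments strictly between -pi/4 and pi/4, and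
  \<open>cis (-pi/4)\<close> is a root of \<open>- \<i>\<close>; hence both sides have the same
  square and positive real part.\<close>

lemma csqrt_mult_Re:
  assumes "Re u > 0" "Re v > 0" "Re w > 0" "u * v = - \<i> * w"
  shows "csqrt u * csqrt v = cis (-pi/4) * csqrt w"
proof (rule eq_if_power2_eq_Re_pos)
  have "cis (-pi/4)^2 = -\<i>"
    by (simp add: power2_eq_square cis_mult complex_eq_iff)
  then show "(csqrt u * csqrt v)^2 = (cis (-pi/4) * csqrt w)^2"
    using assms(4) by (simp add: power_mult_distrib)
  have "\<bar>Im (csqrt u) * Im (csqrt v)\<bar> < Re (csqrt u) * Re (csqrt v)"
    unfolding abs_mult using csqrt_Re_gt[OF assms(1)] csqrt_Re_gt[OF assms(2)]
    by (intro mult_strict_mono') auto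
  then show "Re (csqrt u * csqrt v) > 0" by simp
  have "Re (csqrt w) + Im (csqrt w) > 0" using csqrt_Re_gt[OF assms(3)] by linarith
  then have "sqrt 2 / 2 * (Re (csqrt w) + Im (csqrt w)) > 0" by simp
  then show "Re (cis (-pi/4) * csqrt w) > 0"
    by (simp add: cos_45 sin_45 algebra_simps add_divide_distrib)
qed

definition e24 :: "int \<Rightarrow> complex" where "e24 k = cis (2 * pi * of_int k / 24)"

lemma e24_add: "e24 (j + k) = e24 j * e24 k"
  by (simp add: e24_def cis_mult add_divide_distrib algebra_simps)

lemma e24_0 [simp]: "e24 0 = 1" by (simp add: e24_def)

lemma e24_24 [simp]: "e24 (24 * k) = 1"
  using cis_multiple_2pi[of "of_int k"] by (simp add: e24_def mult.assoc)

lemma e24_mod: "e24 k = e24 (k mod 24)"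
proof -
  have "e24 k = e24 (24 * (k div 24) + k mod 24)" by simp
  also have "\<dots> = e24 (k mod 24)" unfolding e24_add by simp
  finally show ?thesis .
qed

lemma e24_12: "e24 12 = -1" by (simp add: e24_def)

text \<open>Weight $7/2$ with the multiplier system of $1/\eta$, prescribed on the two generators only.\<close>

definition weakly_modular :: "(complex \<Rightarrow> complex) \<Rightarrow> bool" where
  "weakly_modular F \<longleftrightarrow> (\<forall>t. Im t > 0 \<longrightarrow>
     F (t + 1) = e24 (-1) * F t \<and> F (-1 / t) = csqrt (-\<i> * t) ^ 7 * F t)"

lemma weakly_modular_shift:
  assumes F: "weakly_modular F" and t: "Im t > 0"
  shows "F (t + of_int n) = e24 (-n) * F t"
proof (induction n rule: int_induct[where k=0])
  case (step1 i)
  have "F (t + of_int i + 1) = e24 (-1) * F (t + of_int i)"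
    using F t by (simp add: weakly_modular_def)
  then show ?case using step1 e24_add[of "-1" "-i"] by (simp add: add.assoc algebra_simps)
next
  case (step2 i)
  have "F (t + of_int (i - 1) + 1) = e24 (-1) * F (t + of_int (i - 1))"
    using F[unfolded weakly_modular_def, rule_format, of "t + of_int (i - 1)"] t
    by (simp add: algebra_simps)
  then have "F (t + of_int (i - 1)) = e24 1 * F (t + of_int i)"
    using e24_add[of 1 "-1"] by simp
  then show ?case using step2 e24_add[of 1 "-i"] by (simp add: algebra_simps)
qed auto

text \<open>The multiplier at a matrix is recorded as the exponent \<open>k\<close> of a 24th root
  of unity. The condition c > 0 keeps \<open>-\<i> * (c t + d)\<close> in the right half-plane, away
  from the branch cut.\<close>

definition mult_at :: "(complex \<Rightarrow> complex) \<Rightarrow> int \<Rightarrow> int \<Rightarrow> int \<Rightarrow> int \<Rightarrow> int \<Rightarrow> bool" where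
  "mult_at F a b c d k \<longleftrightarrow> c > 0 \<and> a * d - b * c = 1 \<and> (\<forall>t. Im t > 0 \<longrightarrow>
     F ((of_int a * t + of_int b) / (of_int c * t + of_int d))
       = e24 k * csqrt (-\<i> * (of_int c * t + of_int d)) ^ 7 * F t)"

lemma Im_moebius_pos:
  fixes a b c d :: int
  assumes "Im t > 0" "a * d - b * c = 1" "c \<noteq> 0"
  shows "Im ((of_int a * t + of_int b) / (of_int c * t + of_int d)) > 0"
    and "of_int c * t + of_int d \<noteq> (0::complex)"
proof -
  have "Im (of_int c * t + of_int d) \<noteq> 0" using assms by simp
  then show nz: "of_int c * t + of_int d \<noteq> (0::complex)" by (metis zero_complex.sel(2))
  have ne: "(norm (of_int c * t + of_int d))^2 > 0" using nz by simp
  have "Im ((of_int a * t + of_int b) / (of_int c * t + of_int d)) =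
     Im ((of_int a * t + of_int b) * cnj (of_int c * t + of_int d)) / (norm (of_int c * t + of_int d))^2"
    by (subst complex_div_cnj) (simp add: Im_divide_of_real flip: of_real_power)
  also have "Im ((of_int a * t + of_int b) * cnj (of_int c * t + of_int d)) = of_int (a * d - b * c) * Im t"
    by (simp add: algebra_simps)
  finally show "Im ((of_int a * t + of_int b) / (of_int c * t + of_int d)) > 0"
    using assms ne by simp
qed

lemma mult_at_T:
  assumes F: "weakly_modular F"
  shows "mult_at F a (-1) 1 0 (-a)"
  unfolding mult_at_def
proof (intro conjI allI impI)
  fix t :: complex assume t: "Im t > 0"
  have t0: "t \<noteq> 0" using t by auto
  have Im: "Im (-1/t) > 0" using Im_moebius_pos(1)[OF t, of 0 0 "-1" 1] by simp
  have "F ((of_int a * t + of_int (- 1)) / (of_int 1 * t + of_int 0)) = F (-1/t + of_int a)"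
    using t0 by (simp add: field_simps)
  also have "\<dots> = e24 (-a) * F (-1/t)" by (rule weakly_modular_shift[OF F Im])
  finally show "F ((of_int a * t + of_int (- 1)) / (of_int 1 * t + of_int 0)) =
         e24 (- a) * csqrt (- \<i> * (of_int 1 * t + of_int 0)) ^ 7 * F t"
    using F t by (simp add: weakly_modular_def)
qed auto

text \<open>Left multiplication by the matrix of t -> n - 1 / t. The 3 is the cocycle of the square
  root: the seventh power of \<open>cis (-pi/4)\<close> is \<open>e24 (-21) = e24 3\<close>.\<close>

lemma mult_at_step:
  assumes F: "weakly_modular F" and m: "mult_at F a b c d k" and a: "a > 0"
  shows "mult_at F (n * a - c) (n * b - d) a b (k + 3 - n)"
  unfolding mult_at_def
proof (intro conjI allI impI)
  have c: "c > 0" and det: "a * d - b * c = 1" using m by (auto simp: mult_at_def)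
  show "(n * a - c) * b - (n * b - d) * a = 1" using det by (simp add: algebra_simps)
  fix t :: complex assume t: "Im t > 0"
  let ?g = "(of_int a * t + of_int b) / (of_int c * t + of_int d) :: complex"
  have g: "Im ?g > 0" "of_int c * t + of_int d \<noteq> (0::complex)"
    using Im_moebius_pos[OF t det] c by auto
  have nz: "of_int a * t + of_int b \<noteq> (0::complex)"
    using g(1) by force
  have Im: "Im (-1/?g) > 0" using Im_moebius_pos(1)[OF g(1), of 0 0 "-1" 1] by simp
  have "F ((of_int (n * a - c) * t + of_int (n * b - d)) / (of_int a * t + of_int b))
    = F (-1/?g + of_int n)"
    using nz g by (intro arg_cong[of _ _ F]) (simp add: divide_simps; simp add: algebra_simps)
  also have "\<dots> = e24 (-n) * F (-1/?g)" by (rule weakly_modular_shift[OF F Im])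
  also have "F (-1/?g) = csqrt (-\<i> * ?g)^7 * F ?g"
    using F g(1) unfolding weakly_modular_def by blast
  also have "F ?g = e24 k * csqrt (-\<i> * (of_int c * t + of_int d)) ^ 7 * F t"
    using m t by (simp add: mult_at_def)
  also have "e24 (-n) * (csqrt (-\<i> * ?g)^7 * (e24 k * csqrt (-\<i> * (of_int c * t + of_int d)) ^ 7 * F t))
    = e24 (-n) * e24 k * (csqrt (-\<i> * ?g) * csqrt (-\<i> * (of_int c * t + of_int d)))^7 * F t"
    by (simp add: power_mult_distrib)
  also have "csqrt (-\<i> * ?g) * csqrt (-\<i> * (of_int c * t + of_int d)) =
      cis (-pi/4) * csqrt (-\<i> * (of_int a * t + of_int b))"
  proof (rule csqrt_mult_Re)
    have Re: "Re (-\<i> * z) = Im z" for z by simp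
    show "Re (-\<i> * ?g) > 0" unfolding Re by (rule g)
    show "Re (-\<i> * (of_int c * t + of_int d)) > 0" "Re (-\<i> * (of_int a * t + of_int b)) > 0"
      using t c a by simp_all
    have "?g * (of_int c * t + of_int d) = of_int a * t + of_int b" using g(2) by simp
    moreover have "(-\<i> * y) * (-\<i> * z) = -\<i> * (-\<i> * (y * z))" for y z
      by (simp only: mult_ac)
    ultimately show "(-\<i> * ?g) * (-\<i> * (of_int c * t + of_int d)) = -\<i> * (-\<i> * (of_int a * t + of_int b))"
      by metis
  qed
  also have "(cis (-pi/4) * csqrt (-\<i> * (of_int a * t + of_int b)))^7 =
      cis (-7*pi/4) * csqrt (-\<i> * (of_int a * t + of_int b))^7"
    using Complex.DeMoivre[of "-pi/4" 7] by (simp add: power_mult_distrib)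
  also have "cis (-7*pi/4) = e24 3"
  proof -
    have "cis (-7*pi/4) = e24 (-21)" by (simp add: e24_def)
    also have "\<dots> = e24 3" by (subst e24_mod) simp
    finally show ?thesis .
  qed
  also have "e24 (-n) * e24 k * (e24 3 * csqrt (-\<i> * (of_int a * t + of_int b))^7) * F t
     = e24 (k + 3 - n) * csqrt (-\<i> * (of_int a * t + of_int b))^7 * F t"
    using e24_add[of "k+3" "-n"] e24_add[of k 3] by simp
  finally show "F ((of_int (n * a - c) * t + of_int (n * b - d)) / (of_int a * t + of_int b))
     = e24 (k + 3 - n) * csqrt (-\<i> * (of_int a * t + of_int b))^7 * F t" .
qed (use a in auto)

text \<open>Right multiplication by a translation keeps the first column; it is used to turn
  \<open>d\<close> into a multiple of 24.\<close>

lemma mult_at_shift: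
  assumes F: "weakly_modular F" and m: "mult_at F a b c d k"
  shows "mult_at F a (b + n * a) c (d + n * c) (k - n)"
  unfolding mult_at_def
proof (intro conjI allI impI)
  show "c > 0" and "a * (d + n * c) - (b + n * a) * c = 1"
    using m by (auto simp: mult_at_def algebra_simps)
  fix t :: complex assume t: "Im t > 0"
  have "F ((of_int a * (t + of_int n) + of_int b) / (of_int c * (t + of_int n) + of_int d))
       = e24 k * csqrt (-\<i> * (of_int c * (t + of_int n) + of_int d)) ^ 7 * F (t + of_int n)"
    using m t by (simp add: mult_at_def)
  also have "F (t + of_int n) = e24 (-n) * F t" by (rule weakly_modular_shift[OF F t])
  finally show "F ((of_int a * t + of_int (b + n * a)) / (of_int c * t + of_int (d + n * c)))
       = e24 (k - n) * csqrt (-\<i> * (of_int c * t + of_int (d + n * c))) ^ 7 * F t"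
    using e24_add[of k "-n"] by (simp add: algebra_simps)
qed

text \<open>The continued fraction of $a/c$ with minus signs writes a matrix with first column $(a,c)$ as a
  word in the generators; \<open>cf_mult\<close> returns its second column and its multiplier exponent. The first
  argument is fuel, and \<open>cf_ok\<close> states that it does not run out.\<close>

fun cf_mult :: "nat \<Rightarrow> int \<Rightarrow> int \<Rightarrow> int \<times> int \<times> int" where
  "cf_mult 0 a c = (-1, 0, -a)"
| "cf_mult (Suc N) a c = (if c = 1 then (-1, 0, -a) else
     let n = - ((-a) div c); (b, d, k) = cf_mult N c (n * c - a)
     in (n * b - d, b, k + 3 - n))"

fun cf_ok :: "nat \<Rightarrow> int \<Rightarrow> int \<Rightarrow> bool" where
  "cf_ok 0 a c \<longleftrightarrow> c = 1"
| "cf_ok (Suc N) a c \<longleftrightarrow> c = 1 \<or> (c > 1 \<and> cf_ok N c (- ((-a) div c) * c - a))"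

text \<open>Since n is the ceiling of a / c, the next denominator n c - a lies between 0 and c - 1;
  \<open>cf_ok\<close> rules out that it reaches 0 before 1.\<close>

lemma mult_at_cf_mult:
  assumes F: "weakly_modular F"
  shows "cf_ok N a c \<Longrightarrow> cf_mult N a c = (b, d, k) \<Longrightarrow> mult_at F a b c d k"
proof (induction N arbitrary: a c b d k)
  case 0
  then show ?case using mult_at_T[OF F] by auto
next
  case (Suc N)
  show ?case
  proof (cases "c = 1")
    case True
    then show ?thesis using mult_at_T[OF F] Suc.prems by auto
  next
    case False
    define n where "n = - ((-a) div c)"
    obtain b' d' k' where r: "cf_mult N c (n * c - a) = (b', d', k')" by (metis prod_cases3)
    have m: "mult_at F c b' (n * c - a) d' k'"
      using Suc.IH[OF _ r] Suc.prems(1) False by (auto simp: n_def)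
    have "mult_at F (n * c - (n * c - a)) (n * b' - d') c b' (k' + 3 - n)"
      using mult_at_step[OF F m, of n] Suc.prems(1) False by auto
    moreover have "(n * b' - d', b', k' + 3 - n) = (b, d, k)"
      using Suc.prems(2) False r by (auto simp: Let_def simp flip: n_def)
    ultimately show ?thesis by auto
  qed
qed

section \<open>Weakly holomorphic forms of weight 7/2\<close>

lemma mod_24_eq_23D: "r mod 24 = 23 \<Longrightarrow> \<exists>q. r = 24 * q + 23" for r :: int
  by (metis mult_div_mod_eq)

lemma qexp_of_int_div_24: "qexp (of_int r / 24) = e24 r"
  by (simp add: qexp_def e24_def cis_conv_exp mult_ac)

text \<open>The coefficient of $q^n$ in $F \cdot q^{1/24}$ is stored at the index $r = 24n-1$, so that Hecke
  operators act by multiplication on indices.\<close>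

definition mform :: "(complex \<Rightarrow> complex) \<Rightarrow> (int \<Rightarrow> int) \<Rightarrow> bool" where
  "mform F a \<longleftrightarrow> (\<exists>N. \<forall>r < N. a r = 0) \<and> (\<forall>r. a r \<noteq> 0 \<longrightarrow> r mod 24 = 23) \<and>
     (\<forall>t. Im t > 0 \<longrightarrow> ((\<lambda>r. of_int (a r) * qexp (of_int r * t / 24)) has_sum F t) UNIV) \<and>
     weakly_modular F"

text \<open>The translation law follows termwise from the support, every index being -1 modulo 24;
  only the inversion has to be supplied.\<close>

lemma mformI:
  assumes N: "\<And>r. r < N \<Longrightarrow> a r = 0" and supp: "\<And>r. a r \<noteq> 0 \<Longrightarrow> r mod 24 = 23"
    and F: "\<And>t. Im t > 0 \<Longrightarrow> ((\<lambda>r. of_int (a r) * qexp (of_int r * t / 24)) has_sum F t) UNIV"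
    and S: "\<And>t. Im t > 0 \<Longrightarrow> F (-1 / t) = csqrt (-\<i> * t) ^ 7 * F t"
  shows "mform F a"
proof -
  have "F (t + 1) = e24 (-1) * F t" if t: "Im t > 0" for t
  proof -
    have "((\<lambda>r. of_int (a r) * qexp (of_int r * (t + 1) / 24)) has_sum F (t + 1)) UNIV"
      using F[of "t + 1"] t by simp
    moreover have "of_int (a r) * qexp (of_int r * (t + 1) / 24) = e24 (-1) * (of_int (a r) * qexp (of_int r * t / 24))" for r
    proof (cases "a r = 0")
      case False
      obtain p where "r = 24 * p + 23" using mod_24_eq_23D[OF supp[OF False]] by blast
      then have r: "r = 24 * (p + 1) + (-1)" by simp
      have "qexp (of_int r * (t + 1) / 24) = qexp (of_int r * t / 24) * e24 r"
        by (simp add: distrib_left add_divide_distrib qexp_add qexp_of_int_div_24)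
      also have "e24 r = e24 (24 * (p + 1) + (-1))" using r by (rule arg_cong)
      also have "\<dots> = e24 (-1)" by (simp only: e24_add e24_24 mult_1_left)
      finally show ?thesis by simp
    qed simp
    ultimately have "((\<lambda>r. e24 (-1) * (of_int (a r) * qexp (of_int r * t / 24))) has_sum F (t + 1)) UNIV"
      by simp
    then show ?thesis using has_sum_cmult_right[OF F[OF t], of "e24 (-1)"] has_sum_unique by blast
  qed
  then show ?thesis
    using assms unfolding mform_def weakly_modular_def by blast
qed

lemma mform_inversion: "mform F a \<Longrightarrow> Im t > 0 \<Longrightarrow> F (-1 / t) = csqrt (-\<i> * t) ^ 7 * F t"
  by (simp add: mform_def weakly_modular_def del: csqrt.simps)

lemma mform_add_scaled:
  assumes "mform F a" "mform G b"
  shows "mform (\<lambda>t. F t + of_int c * G t) (\<lambda>r. a r + c * b r)"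
proof -
  obtain M N where MN: "\<And>r. r < M \<Longrightarrow> a r = 0" "\<And>r. r < N \<Longrightarrow> b r = 0"
    using assms by (auto simp: mform_def)
  show ?thesis
  proof (rule mformI)
    show "a r + c * b r = 0" if "r < min M N" for r using that MN by simp
    show "r mod 24 = 23" if "a r + c * b r \<noteq> 0" for r using that assms by (cases "a r = 0") (auto simp: mform_def)
    fix t :: complex assume t: "Im t > 0"
    have "((\<lambda>r. of_int (a r) * qexp (of_int r * t / 24) + of_int c * (of_int (b r) * qexp (of_int r * t / 24)))
      has_sum F t + of_int c * G t) UNIV"
      using assms t by (intro has_sum_add has_sum_cmult_right) (auto simp: mform_def)
    then show "((\<lambda>r. of_int (a r + c * b r) * qexp (of_int r * t / 24)) has_sum F t + of_int c * G t) UNIV"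
      by (simp add: algebra_simps)
    show "F (-1 / t) + of_int c * G (-1 / t) = csqrt (-\<i> * t) ^ 7 * (F t + of_int c * G t)"
      unfolding mform_inversion[OF assms(1) t] mform_inversion[OF assms(2) t]
      by (simp add: distrib_left mult.left_commute del: csqrt.simps)
  qed
qed

text \<open>Coefficients of E_4/eta times the i-th power of the modular invariant E_4^3/Delta;
  accordingly the weight 4 (3 i + 1) - (24 i + 1) / 2 is 7/2 for every i.\<close>

definition base_coeff :: "nat \<Rightarrow> int \<Rightarrow> int" where
  "base_coeff i r = (if r mod 24 = 23 \<and> r \<ge> - (24 * int i + 1)
     then fps_nth (E4_fps ^ (3 * i + 1) * partition_fps ^ (24 * i + 1)) (nat ((r + (24 * int i + 1)) div 24)) else 0)"

lemma mform_base:
  "mform (\<lambda>t. E4q (qexp t) ^ (3 * i + 1) / eta t ^ (24 * i + 1)) (base_coeff i)"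
proof (rule mformI)
  show "base_coeff i r = 0" if "r < - (24 * int i + 1)" for r using that by (simp add: base_coeff_def)
  show "r mod 24 = 23" if "base_coeff i r \<noteq> 0" for r using that by (simp add: base_coeff_def split: if_splits)
  fix t :: complex assume t: "Im t > 0"
  define A where "A = E4_fps ^ (3 * i + 1) * partition_fps ^ (24 * i + 1)"
  define m where "m = 24 * i + 1"
  have im: "int m = 24 * int i + 1" by (simp add: m_def)
  have q: "norm (qexp t) < 1" using t by simp
  have A: "represents (cfps A) (\<lambda>q. E4q q ^ (3 * i + 1) * exp (log_euler q) ^ m)"
    unfolding A_def cfps_mult cfps_power m_def
    by (intro represents_mult represents_power represents_E4 represents_partition)
  have "((\<lambda>n. fps_nth (cfps A) n * qexp t ^ n) has_sum eval_fps (cfps A) (qexp t)) UNIV"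
    using represents_radius[OF A q] by (intro norm_summable_imp_has_sum sums_eval_fps norm_summable_fps)
  then have "((\<lambda>n. of_int (fps_nth A n) * qexp t ^ n) has_sum E4q (qexp t) ^ (3 * i + 1) * exp (log_euler (qexp t)) ^ m) UNIV"
    using A q by (simp add: represents_def)
  from has_sum_cmult_right[OF this, of "qexp (- of_nat m * t / 24)"]
  have "((\<lambda>n. of_int (base_coeff i (24 * int n - int m)) * qexp (of_int (24 * int n - int m) * t / 24)) has_sum
     qexp (- of_nat m * t / 24) * (E4q (qexp t) ^ (3 * i + 1) * exp (log_euler (qexp t)) ^ m)) UNIV"
  proof (rule has_sum_cong[THEN iffD1, rotated])
    fix n :: nat
    have "of_int (24 * int n - int m) * t / 24 = - of_nat m * t / 24 + of_nat n * t"
      by (simp add: field_simps)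
    then have "qexp (of_int (24 * int n - int m) * t / 24) = qexp (- of_nat m * t / 24) * qexp t ^ n"
      by (simp only: qexp_add qexp_of_nat_mult)
    moreover have "base_coeff i (24 * int n - int m) = fps_nth A n"
    proof -
      have "24 * int n - int m = 23 + 24 * (int n - int i - 1)" by (simp add: im)
      then have "(24 * int n - int m) mod 24 = 23" by (simp only: mod_mult_self2) simp
      then show ?thesis by (simp add: base_coeff_def A_def m_def)
    qed
    ultimately show "qexp (- of_nat m * t / 24) * (of_int (fps_nth A n) * qexp t ^ n) =
      of_int (base_coeff i (24 * int n - int m)) * qexp (of_int (24 * int n - int m) * t / 24)"
      by simp
  qed
  then have "((\<lambda>r. of_int (base_coeff i r) * qexp (of_int r * t / 24)) has_sum
     qexp (- of_nat m * t / 24) * (E4q (qexp t) ^ (3 * i + 1) * exp (log_euler (qexp t)) ^ m)) (range (\<lambda>n. 24 * int n - int m))"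
    by (subst has_sum_reindex) (auto simp: o_def inj_on_def)
  also have "?this \<longleftrightarrow> ((\<lambda>r. of_int (base_coeff i r) * qexp (of_int r * t / 24)) has_sum
     qexp (- of_nat m * t / 24) * (E4q (qexp t) ^ (3 * i + 1) * exp (log_euler (qexp t)) ^ m)) UNIV"
  proof (rule has_sum_cong_neutral)
    fix r assume r: "r \<in> UNIV - range (\<lambda>n. 24 * int n - int m)"
    have "\<not> (r mod 24 = 23 \<and> r \<ge> - (24 * int i + 1))"
    proof
      assume *: "r mod 24 = 23 \<and> r \<ge> - (24 * int i + 1)"
      then obtain p where p: "r = 24 * p + 23" using mod_24_eq_23D by blast
      then have "p + int i + 1 \<ge> 0" using * by linarith
      then have "r = 24 * int (nat (p + int i + 1)) - int m" using p im by simp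
      then show False using r by blast
    qed
    then have "base_coeff i r = 0" unfolding base_coeff_def by (rule if_not_P)
    then show "of_int (base_coeff i r) * qexp (of_int r * t / 24) = 0" by simp
  qed auto
  also have "qexp (- of_nat m * t / 24) * (E4q (qexp t) ^ (3 * i + 1) * exp (log_euler (qexp t)) ^ m)
    = E4q (qexp t) ^ (3 * i + 1) / eta t ^ m"
  proof -
    have "qexp (- of_nat m * t / 24) * exp (log_euler (qexp t)) ^ m * eta t ^ m = 1"
      by (simp add: eta_def qexp_def flip: exp_of_nat_mult exp_add) (simp add: algebra_simps)
    then have "qexp (- of_nat m * t / 24) * exp (log_euler (qexp t)) ^ m = 1 / eta t ^ m"
      by (simp add: eq_divide_eq)
    then show ?thesis by (simp only: mult.left_commute) simp
  qed
  finally show "((\<lambda>r. of_int (base_coeff i r) * qexp (of_int r * t / 24)) has_sum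
    E4q (qexp t) ^ (3 * i + 1) / eta t ^ (24 * i + 1)) UNIV" unfolding m_def .
  define s where "s = csqrt (-\<i> * t)"
  have s2: "s ^ 2 = -\<i> * t" unfolding s_def by (rule power2_csqrt)
  have s0: "s \<noteq> 0" using s2 t by auto
  \<comment> \<open>The fourth power removes the factor \<open>-\<i>\<close>, so everything becomes
    a power of s with exponent 8 (3 i + 1) - (24 i + 1) = 7.\<close>
  have "(s ^ 2) ^ 4 = t ^ 4" unfolding s2 power_mult_distrib by simp
  then have t4: "t ^ 4 = s ^ 8" by (simp flip: power_mult)
  have "(t ^ 4) ^ (3 * i + 1) = s ^ (8 * (3 * i + 1))" unfolding t4 power_mult ..
  also have "8 * (3 * i + 1) = 7 + (24 * i + 1)" by simp
  also have "s ^ (7 + (24 * i + 1)) = s ^ 7 * s ^ (24 * i + 1)" by (rule power_add)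
  finally have "(t ^ 4) ^ (3 * i + 1) / s ^ (24 * i + 1) = s ^ 7" using s0 by simp
  then show "E4q (qexp (-1 / t)) ^ (3 * i + 1) / eta (-1 / t) ^ (24 * i + 1) =
    csqrt (-\<i> * t) ^ 7 * (E4q (qexp t) ^ (3 * i + 1) / eta t ^ (24 * i + 1))"
    unfolding E4q_inversion[OF t] eta_inversion[OF t] power_mult_distrib s_def[symmetric]
    by (simp only: times_divide_times_eq[symmetric])
qed

lemma base_coeff_leading: "base_coeff i (- (24 * int i + 1)) = 1"
proof -
  have "- (24 * int i + 1) = 23 + 24 * (- int i - 1)" by simp
  then have "(- (24 * int i + 1)) mod 24 = 23" by (simp only: mod_mult_self2) simp
  moreover have "fps_nth (F * G) 0 = 1" if "fps_nth F 0 = 1" "fps_nth G 0 = 1" for F G :: "int fps"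
    using that by simp
  moreover have "fps_nth (F ^ n) 0 = 1" if "fps_nth F 0 = 1" for F :: "int fps" and n
    using that by (induction n) simp_all
  moreover have "fps_nth E4_fps 0 = 1" by (simp add: E4_fps_def)
  moreover have "fps_nth partition_fps 0 = 1" by (simp add: partition_fps_def)
  ultimately show ?thesis by (simp add: base_coeff_def)
qed

lemma base_coeff_below: "r < - (24 * int i + 1) \<Longrightarrow> base_coeff i r = 0"
  by (simp add: base_coeff_def)

text \<open>Elimination of negative indices one at a time; integrality survives because the pivots
  are the leading coefficients 1 of the base forms.\<close>

lemma mform_reduce:
  assumes "mform F a"
  shows "\<exists>G b. mform G b \<and> (\<forall>r \<le> - (24 * int k + 1). b r = a r) \<and> (\<forall>r. - (24 * int k + 1) < r \<longrightarrow> r < 0 \<longrightarrow> b r = 0)"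
  using assms
proof (induction k arbitrary: F a)
  case 0
  then show ?case by (intro exI[of _ F] exI[of _ a]) auto
next
  case (Suc k)
  let ?m = "- (24 * int k + 1)"
  obtain G b where b: "mform G b" "\<And>r. r \<le> ?m \<Longrightarrow> b r = a r" "\<And>r. ?m < r \<Longrightarrow> r < 0 \<Longrightarrow> b r = 0"
    using Suc.IH[OF Suc.prems] by blast
  \<comment> \<open>The eliminating form is reduced first, so that subtracting it disturbs no index
    already cleared.\<close>
  obtain H c where c: "mform H c" "\<And>r. r \<le> ?m \<Longrightarrow> c r = base_coeff k r" "\<And>r. ?m < r \<Longrightarrow> r < 0 \<Longrightarrow> c r = 0"
    using Suc.IH[OF mform_base[of k]] by blast
  have c1: "c ?m = 1" "\<And>r. r < ?m \<Longrightarrow> c r = 0" using c(2) base_coeff_leading base_coeff_below by auto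
  define b' where "b' r = b r + (- b ?m) * c r" for r
  have "mform (\<lambda>t. G t + of_int (- b ?m) * H t) b'"
    unfolding b'_def by (rule mform_add_scaled[OF b(1) c(1)])
  moreover have "b' r = a r" if "r \<le> - (24 * int (Suc k) + 1)" for r
    using that b(2) c1(2) by (simp add: b'_def)
  moreover have "b' r = 0" if r: "- (24 * int (Suc k) + 1) < r" "r < 0" for r
  proof -
    consider "r < ?m" | "r = ?m" | "?m < r" by linarith
    then show ?thesis
    proof cases
      case 1
      \<comment> \<open>Admissible indices differ by multiples of 24, so none lies strictly between
        -(24 (k + 1) + 1) and -(24 k + 1).\<close>
      have "\<not> r mod 24 = 23"
      proof
        assume "r mod 24 = 23"
        then obtain p where "r = 24 * p + 23" using mod_24_eq_23D by blast
        moreover have "- (24 * int k + 25) < r" using r(1) by simp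
        ultimately have "p + int k < - 1" "p + int k > - 2" using 1 by linarith+
        then show False by linarith
      qed
      then have "b r = 0" using b(1) by (auto simp: mform_def)
      then show ?thesis using 1 c1(2) by (simp add: b'_def)
    next
      case 2
      then show ?thesis using c1(1) by (simp add: b'_def)
    next
      case 3
      then show ?thesis using b(3) c(3) r(2) by (simp add: b'_def)
    qed
  qed
  ultimately show ?case by blast
qed

lemma mform_basis:
  obtains F a where "mform F a" "a (- (24 * int i + 1)) = 1" "\<And>r. r < 0 \<Longrightarrow> r \<noteq> - (24 * int i + 1) \<Longrightarrow> a r = 0"
proof -
  obtain G b where b: "mform G b" "\<And>r. r \<le> - (24 * int i + 1) \<Longrightarrow> b r = base_coeff i r"
    "\<And>r. - (24 * int i + 1) < r \<Longrightarrow> r < 0 \<Longrightarrow> b r = 0"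
    using mform_reduce[OF mform_base[of i], of i] by blast
  show ?thesis
  proof (rule that[OF b(1)])
    show "b (- (24 * int i + 1)) = 1" using b(2) base_coeff_leading by simp
    fix r :: int assume r: "r < 0" "r \<noteq> - (24 * int i + 1)"
    then show "b r = 0" using b(2,3)[of r] base_coeff_below[of r i] by (cases "r < - (24 * int i + 1)") auto
  qed
qed

text \<open>After a translation |Re u| is at most 1/2, so Im u < 4/5 gives |u|^2 at most 1/4 + 16/25
  = 89/100, and inversion enlarges the imaginary part by at least 100/89. The threshold is a
  rational number below sqrt 3 / 2.\<close>

lemma reduce_to_large_Im:
  assumes inv: "\<And>t. Im t > 0 \<Longrightarrow> W (qexp (-1 / t)) = W (qexp t)"
  shows "Im t > 0 \<Longrightarrow> \<exists>t'. Im t' \<ge> 4 / 5 \<and> W (qexp t') = W (qexp t)"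
proof -
  have *: "Im t > 0 \<Longrightarrow> Im t \<ge> 4 / 5 * (89 / 100) ^ k \<Longrightarrow> \<exists>t'. Im t' \<ge> 4 / 5 \<and> W (qexp t') = W (qexp t)" for k t
  proof (induction k arbitrary: t)
    case (Suc k)
    show ?case
    proof (cases "Im t \<ge> 4 / 5")
      case False
      define u where "u = t - of_int (round (Re t))"
      have u: "Im u = Im t" "\<bar>Re u\<bar> \<le> 1 / 2"
        using of_int_round_abs_le[of "Re t"] by (auto simp: u_def abs_minus_commute)
      have "qexp u = qexp t * qexp (of_int (- round (Re t)))" by (simp add: u_def flip: qexp_add)
      then have q: "qexp u = qexp t" by (simp only: qexp_of_int mult_1_right)
      have "\<bar>Re u\<bar>^2 \<le> (1 / 2)^2" by (rule power_mono[OF u(2)]) simp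
      moreover have "(Im u)^2 \<le> (4 / 5)^2" using u(1) Suc.prems False by (intro power_mono) auto
      moreover have "(norm u)^2 = \<bar>Re u\<bar>^2 + (Im u)^2" by (simp add: cmod_power2)
      moreover have "(1 / 2)^2 + (4 / 5)^2 = (89 / 100 :: real)" by (simp add: power2_eq_square)
      ultimately have n: "(norm u)^2 \<le> 89 / 100" by linarith
      have n0: "(norm u)^2 > 0" using u(1) Suc.prems by auto
      have Im: "Im (-1 / u) = Im t / (norm u)^2" using u by (simp add: Im_divide cmod_power2)
      have "Im t / (norm u)^2 \<ge> Im t / (89 / 100)"
        using n n0 Suc.prems by (intro divide_left_mono) auto
      then have "Im (-1 / u) \<ge> 4 / 5 * (89 / 100) ^ k" unfolding Im using Suc.prems(2) by simp
      moreover have "Im (-1 / u) > 0" unfolding Im using n0 Suc.prems by simp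
      ultimately obtain t' where "Im t' \<ge> 4 / 5" "W (qexp t') = W (qexp (-1 / u))"
        using Suc.IH by blast
      then show ?thesis using inv[of u] u Suc.prems q by auto
    qed auto
  qed auto
  assume t: "Im t > 0"
  obtain k where "(89 / 100 :: real) ^ k < Im t / (4 / 5)"
    using real_arch_pow_inv[of "Im t / (4 / 5)" "89 / 100"] t by auto
  then show ?thesis using *[of t k] t by (simp add: field_simps)
qed

lemma qexp_surj:
  assumes "q \<noteq> 0" "norm q < 1"
  obtains t where "Im t > 0" "qexp t = q"
proof -
  define t where "t = Ln q / (2 * pi * \<i>)"
  have "qexp t = q" using assms(1) by (simp add: qexp_def t_def)
  then show ?thesis using that[of t] assms(2) by (metis norm_qexp_less_1_iff)
qed

text \<open>By invariance every value at q different from 0 recurs in the closed disc of radius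
  \<open>\<rho>\<close>, the value of |q| at Im t = 4/5. The maximum of |W| over that disc is
  therefore global and attained at an interior point of the unit disc.\<close>

lemma modular_function_vanishes:
  assumes W: "represents F W" "W 0 = 0"
    and inv: "\<And>t. Im t > 0 \<Longrightarrow> W (qexp (-1 / t)) = W (qexp t)"
  shows "F = 0"
proof -
  define \<rho> where "\<rho> = exp (- 2 * pi * (4 / 5))"
  have \<rho>: "0 < \<rho>" "\<rho> < 1" by (simp_all add: \<rho>_def)
  have hol: "W holomorphic_on ball 0 1" by (rule represents_holomorphic[OF W(1)])
  have "continuous_on (cball 0 \<rho>) (\<lambda>q. norm (W q))"
    by (intro continuous_on_norm continuous_on_subset[OF holomorphic_on_imp_continuous_on[OF hol]]) (use \<rho> in auto)
  then obtain \<xi> where \<xi>: "\<xi> \<in> cball 0 \<rho>" "\<And>q. q \<in> cball 0 \<rho> \<Longrightarrow> norm (W q) \<le> norm (W \<xi>)"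
    using continuous_attains_sup[of "cball 0 \<rho>" "\<lambda>q. norm (W q)"] \<rho> by auto
  have max: "norm (W q) \<le> norm (W \<xi>)" if q: "q \<in> ball 0 1" for q
  proof (cases "q = 0")
    case False
    then obtain t where t: "Im t > 0" "qexp t = q" using qexp_surj[of q] q by auto
    obtain t' where t': "Im t' \<ge> 4 / 5" "W (qexp t') = W (qexp t)"
      using reduce_to_large_Im[of W, OF inv t(1)] by blast
    have "norm (qexp t') \<le> \<rho>" using t'(1) by (simp add: norm_qexp \<rho>_def)
    then show ?thesis using \<xi>(2)[of "qexp t'"] t' t by simp
  qed (use W(2) in simp)
  have "W constant_on ball 0 1"
    by (rule maximum_modulus_principle[OF hol _ _ _ order_refl, of \<xi>]) (use \<xi>(1) \<rho> max in auto)
  then have "\<And>q. q \<in> ball 0 1 \<Longrightarrow> W q = 0" using W(2) unfolding constant_on_def by (metis centre_in_ball zero_less_one)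
  then have "represents 0 W" by (simp add: represents_def)
  then show ?thesis using W(1) represents_unique by blast
qed

text \<open>$F^{24}/\eta^{168}$ has weight $0$ and vanishes at the cusp, so the maximum modulus principle
  applies.\<close>

lemma mform_vanishes:
  assumes F: "mform F a" and neg: "\<And>r. r < 0 \<Longrightarrow> a r = 0"
  shows "a r = 0"
proof -
  define G where "G = Abs_fps (\<lambda>n. of_int (a (24 * int n + 23)) :: complex)"
  define g where "g = eval_fps G"
  have exp: "((\<lambda>n. fps_nth G n * qexp t ^ n) has_sum (qexp (- 23 * t / 24) * F t)) UNIV" if t: "Im t > 0" for t
  proof -
    have "((\<lambda>r. of_int (a r) * qexp (of_int r * t / 24)) has_sum F t) UNIV" using F t by (simp add: mform_def)
    also have "?this \<longleftrightarrow> ((\<lambda>r. of_int (a r) * qexp (of_int r * t / 24)) has_sum F t) (range (\<lambda>n. 24 * int n + 23))"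
    proof (rule has_sum_cong_neutral)
      fix r assume r: "r \<in> UNIV - range (\<lambda>n. 24 * int n + 23)"
      have "\<not> (r mod 24 = 23 \<and> r \<ge> 0)"
      proof
        assume "r mod 24 = 23 \<and> r \<ge> 0"
        then obtain p where "r = 24 * p + 23" "r \<ge> 0" using mod_24_eq_23D by blast
        then have "r = 24 * int (nat p) + 23" by simp
        then show False using r by blast
      qed
      then have "a r = 0" using F neg[of r] unfolding mform_def by (metis not_le)
      then show "of_int (a r) * qexp (of_int r * t / 24) = 0" by simp
    qed auto
    finally have "((\<lambda>n. of_int (a (24 * int n + 23)) * qexp (of_int (24 * int n + 23) * t / 24)) has_sum F t) UNIV"
      by (subst (asm) has_sum_reindex) (auto simp: o_def inj_on_def)
    from has_sum_cmult_right[OF this, of "qexp (- 23 * t / 24)"] show ?thesis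
    proof (rule has_sum_cong[THEN iffD1, rotated])
      fix n :: nat
      have "qexp (- 23 * t / 24) * qexp (of_int (24 * int n + 23) * t / 24) = qexp (of_nat n * t)"
        unfolding qexp_add[symmetric] by (rule arg_cong[of _ _ qexp]) (simp add: field_simps)
      then show "qexp (- 23 * t / 24) * (of_int (a (24 * int n + 23)) * qexp (of_int (24 * int n + 23) * t / 24)) =
         fps_nth G n * qexp t ^ n"
        by (simp add: G_def qexp_of_nat_mult mult.left_commute)
    qed
  qed
  have "fps_conv_radius G \<ge> 1"
  proof (rule conv_radius_ge_1I)
    fix q :: complex assume q: "norm q < 1"
    show "summable (\<lambda>n. fps_nth G n * q ^ n)"
    proof (cases "q = 0")
      case False
      then obtain t where t: "Im t > 0" "qexp t = q" using qexp_surj q by blast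
      show ?thesis using has_sum_imp_sums[OF exp[OF t(1)]] t(2) by (auto simp: sums_iff)
    qed (auto intro: summable_finite[of "{0}"])
  qed
  then have G: "represents G g" by (simp add: represents_def g_def)
  have Fg: "F t = qexp (23 * t / 24) * g (qexp t)" if t: "Im t > 0" for t
  proof -
    have "g (qexp t) = qexp (- 23 * t / 24) * F t"
      using has_sum_imp_sums[OF exp[OF t]] by (simp add: g_def eval_fps_def sums_iff)
    then show ?thesis by (simp add: mult.assoc[symmetric] flip: qexp_add) (simp add: qexp_def)
  qed
  \<comment> \<open>\<open>F ^ 24\<close> contributes q^23 and \<open>eta ^ 168\<close> contributes
    q^7, which leaves q^16.\<close>
  define W where "W q = q ^ 16 * (g q ^ 24 * exp (log_euler q) ^ 168)" for q
  have W: "represents (fps_X ^ 16 * (G ^ 24 * cfps partition_fps ^ 168)) W"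
    unfolding W_def
    by (intro represents_mult represents_power G represents_partition) (simp add: represents_def)
  have WF: "W (qexp t) = F t ^ 24 / eta t ^ 168" if t: "Im t > 0" for t
  proof -
    have "F t ^ 24 = qexp (23 * t) * g (qexp t) ^ 24"
      unfolding Fg[OF t] power_mult_distrib qexp_of_nat_mult[symmetric] by simp
    moreover have "qexp t ^ 16 * exp (log_euler (qexp t)) ^ 168 * eta t ^ 168 = qexp (23 * t)"
      by (simp add: eta_def qexp_def flip: exp_of_nat_mult exp_add) (simp add: algebra_simps)
    ultimately show ?thesis by (simp add: W_def eq_divide_eq mult_ac)
  qed
  have "fps_X ^ 16 * (G ^ 24 * cfps partition_fps ^ 168) = 0"
  proof (rule modular_function_vanishes[OF W])
    show "W 0 = 0" by (simp add: W_def)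
    fix t :: complex assume t: "Im t > 0"
    have t': "Im (-1 / t) > 0" using t by (simp add: Im_divide add_nonneg_pos divide_pos_pos)
    have s0: "csqrt (-\<i> * t) \<noteq> 0" using t by (auto simp del: csqrt.simps)
    show "W (qexp (-1 / t)) = W (qexp t)"
      unfolding WF[OF t] WF[OF t'] mform_inversion[OF F t] eta_inversion[OF t] power_mult_distrib
      using s0 by (simp del: csqrt.simps flip: power_mult)
  qed
  moreover have "cfps partition_fps \<noteq> 0"
    using arg_cong[OF euler_times_partition, of cfps] by (auto simp: cfps_mult)
  ultimately have "G = 0" by simp
  then have "fps_nth G n = 0" for n by simp
  then have z: "a (24 * int n + 23) = 0" for n by (simp add: G_def)
  show ?thesis
  proof (rule ccontr)
    assume r: "a r \<noteq> 0"
    have "r mod 24 = 23" using F r by (simp add: mform_def)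
    moreover have "r \<ge> 0" using neg[of r] r by (cases "r < 0") auto
    ultimately obtain p where "r = 24 * p + 23" "r \<ge> 0" using mod_24_eq_23D by blast
    then have "r = 24 * int (nat p) + 23" by simp
    then show False using r z by metis
  qed
qed

section \<open>The Hecke operator\<close>

definition chi :: "int \<Rightarrow> int" where
  "chi r = (if 13 dvd r then 0 else if r mod 13 \<in> {1, 3, 4, 9, 10, 12} then 1 else -1)"

lemma chi_mod: "chi (r mod 13) = chi r"
  by (simp add: chi_def dvd_eq_mod_eq_0)

lemma chi_mult: "chi (a * b) = chi a * chi b"
proof -
  have "\<forall>x\<in>set [0..12]. \<forall>y\<in>set [0..12]. chi (x * y) = chi x * chi y" by code_simp
  then have "chi ((a mod 13) * (b mod 13)) = chi (a mod 13) * chi (b mod 13)" by simp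
  then show ?thesis using chi_mod[of "(a mod 13) * (b mod 13)"] chi_mod[of "a * b"]
    by (simp add: chi_mod mod_mult_eq)
qed

lemma chi_square: "\<not> 13 dvd r \<Longrightarrow> chi r * chi r = 1" by (simp add: chi_def)

lemma chi_sum: "(\<Sum>b\<in>{0..<13}. chi b) = 0"
proof -
  have "(\<Sum>b\<leftarrow>[0..12]. chi b) = 0" by code_simp
  moreover have "(\<Sum>b\<leftarrow>[0..12]. chi b) = (\<Sum>b\<in>set [0..12]. chi b)"
    by (rule sum_list_distinct_conv_sum_set) (rule distinct_upto)
  moreover have "set [0..12] = {0..<13::int}" by auto
  ultimately show ?thesis by simp
qed

lemma sum_roots_of_unity:
  assumes "N > 0"
  shows "(\<Sum>b\<in>{0..<int N}. qexp (of_int (b * k) / of_nat N)) = (if int N dvd k then of_nat N else 0)"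
proof -
  define x where "x = qexp (of_int k / of_nat N)"
  have "x ^ N = qexp (of_int k)" using assms by (simp add: x_def flip: qexp_of_nat_mult)
  then have xN: "x ^ N = 1" by simp
  have x1: "x = 1 \<longleftrightarrow> int N dvd k"
  proof
    assume "x = 1"
    then obtain j where "of_int k / of_nat N = (of_int j :: complex)"
      unfolding x_def qexp_eq_1_iff by (auto elim: Ints_cases)
    then have "(of_int k :: complex) = of_int (int N * j)" using assms by (simp add: field_simps)
    then show "int N dvd k" by (simp only: of_int_eq_iff dvd_triv_left)
  next
    assume "int N dvd k"
    then show "x = 1" using assms by (auto simp: x_def elim!: dvdE)
  qed
  have "(\<Sum>b\<in>{0..<int N}. qexp (of_int (b * k) / of_nat N)) = (\<Sum>b<N. x ^ b)"
  proof (rule sum.reindex_bij_witness[of _ int nat])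
    fix b assume "b \<in> {0..<int N}"
    then have "of_int (b * k) / of_nat N = of_nat (nat b) * (of_int k / of_nat N :: complex)" by simp
    then show "x ^ nat b = qexp (of_int (b * k) / of_nat N)"
      by (simp only: x_def qexp_of_nat_mult)
  qed auto
  also have "\<dots> = (if x = 1 then of_nat N else 0)"
    using power_diff_1_eq[of x N] xN by auto
  finally show ?thesis by (simp add: x1)
qed

definition gauss_sum :: "int \<Rightarrow> complex" where
  "gauss_sum r = (\<Sum>b\<in>{0..<13}. of_int (chi b) * qexp (of_int (b * r) / 13))"

lemma qexp_div_mod: "N \<noteq> 0 \<Longrightarrow> qexp (of_int (k mod N) / of_int N) = qexp (of_int k / of_int N)"
proof -
  assume "N \<noteq> 0"
  then have "of_int k / of_int N = (of_int (k div N) + of_int (k mod N) / of_int N :: complex)"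
    by (simp add: field_simps flip: of_int_mult of_int_add)
  then show ?thesis by (simp only: qexp_add qexp_of_int mult_1_left)
qed

lemma gauss_sum_eq: "gauss_sum r = of_int (chi r) * gauss_sum 1"
proof (cases "13 dvd r")
  case True
  have "gauss_sum r = (\<Sum>b\<in>{0..<13}. of_int (chi b))"
    unfolding gauss_sum_def
  proof (rule sum.cong)
    fix b :: int
    from True obtain j where "r = 13 * j" by (auto elim: dvdE)
    then have "of_int (b * r) / 13 = (of_int (b * j) :: complex)" by simp
    then show "of_int (chi b) * qexp (of_int (b * r) / 13) = of_int (chi b)" by (simp only: qexp_of_int mult_1_right)
  qed simp
  then show ?thesis using True chi_sum by (simp add: chi_def flip: of_int_sum)
next
  case False
  have "coprime r 13" using False prime_imp_coprime[of 13 r] by (simp add: coprime_commute)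
  then obtain s where s: "[r * s = 1] (mod 13)" using cong_solve_coprime_int by blast
  have rs: "(r * (s * x)) mod 13 = x mod 13" for x
    using cong_mult[OF s cong_refl[of x]] by (simp add: cong_def mult.assoc)
  show ?thesis
    unfolding gauss_sum_def sum_distrib_left
  proof (rule sum.reindex_bij_witness[of _ "\<lambda>x. (s * x) mod 13" "\<lambda>x. (r * x) mod 13"])
    fix b :: int assume b: "b \<in> {0..<13}"
    have "(s * ((r * b) mod 13)) mod 13 = (r * (s * b)) mod 13" by (simp add: mod_mult_right_eq mult.left_commute)
    then show "(s * ((r * b) mod 13)) mod 13 = b" using rs[of b] b by simp
    have "(r * ((s * b) mod 13)) mod 13 = (r * (s * b)) mod 13" by (simp add: mod_mult_right_eq)
    then show "(r * ((s * b) mod 13)) mod 13 = b" using rs[of b] b by simp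
    have "chi r * chi ((r * b) mod 13) = chi b"
      using chi_square[OF False] by (simp add: chi_mod chi_mult flip: mult.assoc)
    moreover have "qexp (of_int ((r * b) mod 13 * 1) / 13) = qexp (of_int (b * r) / 13)"
      using qexp_div_mod[of 13 "r * b"] by (simp add: mult.commute)
    ultimately show "of_int (chi r) * (of_int (chi ((r * b) mod 13)) * qexp (of_int ((r * b) mod 13 * 1) / 13)) =
      of_int (chi b) * qexp (of_int (b * r) / 13)"
      by (simp only: mult.assoc[symmetric] of_int_mult[symmetric])
  qed auto
qed

text \<open>Orthogonality leaves only the term c = -1, and the character is 1 there because 13 is 1
  modulo 4.\<close>

lemma gauss_sum_square: "gauss_sum 1 ^ 2 = 13"
proof -
  have "gauss_sum 1 ^ 2 = (\<Sum>b\<in>{0..<13}. qexp (of_int (b * 1) / 13) * (of_int (chi b) * gauss_sum 1))"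
    unfolding power2_eq_square by (subst (1) gauss_sum_def) (simp add: sum_distrib_right sum_distrib_left mult_ac)
  also have "\<dots> = (\<Sum>b\<in>{0..<13}. \<Sum>c\<in>{0..<13}. of_int (chi c) * qexp (of_int (b * (1 + c)) / 13))"
    unfolding gauss_sum_eq[symmetric] unfolding gauss_sum_def sum_distrib_left
  proof (intro sum.cong refl)
    fix b c :: int
    have "qexp (of_int (b * 1) / 13) * qexp (of_int (c * b) / 13) = qexp (of_int (b * (1 + c)) / 13)"
      by (simp add: field_simps flip: qexp_add)
    then show "qexp (of_int (b * 1) / 13) * (of_int (chi c) * qexp (of_int (c * b) / 13)) = of_int (chi c) * qexp (of_int (b * (1 + c)) / 13)"
      by (metis mult.left_commute)
  qed
  also have "\<dots> = (\<Sum>c\<in>{0..<13}. of_int (chi c) * (\<Sum>b\<in>{0..<13}. qexp (of_int (b * (1 + c)) / 13)))"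
    by (subst sum.swap) (simp add: sum_distrib_left)
  also have "\<dots> = (\<Sum>c\<in>{0..<13::int}. if c = 12 then 13 else 0)"
  proof (intro sum.cong refl)
    fix c :: int assume c: "c \<in> {0..<13}"
    have "(\<Sum>b\<in>{0..<13}. qexp (of_int (b * (1 + c)) / 13)) = (if 13 dvd (1 + c) then 13 else 0)"
      using sum_roots_of_unity[of 13 "1 + c"] by simp
    moreover have "13 dvd (1 + c) \<longleftrightarrow> c = 12" using c by (auto; presburger)
    moreover have "chi 12 = 1" by code_simp
    ultimately show "of_int (chi c) * (\<Sum>b\<in>{0..<13}. qexp (of_int (b * (1 + c)) / 13)) = (if c = 12 then 13 else 0)"
      by simp
  qed
  also have "\<dots> = 13" by simp
  finally show ?thesis .
qed

text \<open>Only the square of the Gauss sum matters, so its sign \<open>gauss_sign\<close> is left undetermined.\<close>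

definition gauss_sign :: int where
  "gauss_sign = (if gauss_sum 1 = of_real (sqrt 13) then 1 else - 1)"

lemma gauss_sum_sign: "gauss_sum r = of_int (gauss_sign * chi r) * of_real (sqrt 13)"
proof -
  have "(of_real (sqrt 13) :: complex) ^ 2 = 13" by (simp flip: of_real_power)
  then have "gauss_sum 1 ^ 2 = of_real (sqrt 13) ^ 2" using gauss_sum_square by simp
  then have "gauss_sum 1 = of_int gauss_sign * of_real (sqrt 13)"
    unfolding power2_eq_iff by (auto simp: gauss_sign_def)
  then show ?thesis using gauss_sum_eq[of r] by simp
qed

text \<open>Shimura's operator T(p^2) for p = 13 in weight l + 1/2 with l = 3: the factors 169 and
  13^5 are p^(l - 1) and p^(2 l - 1).\<close>

definition hecke_coeff :: "(int \<Rightarrow> int) \<Rightarrow> int \<Rightarrow> int" where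
  "hecke_coeff a r = a (169 * r) + 169 * gauss_sign * chi r * a r + (if 169 dvd r then 13 ^ 5 * a (r div 169) else 0)"

text \<open>The three lines belong to upper triangular matrices with diagonals (1, 169), (13, 13)
  and (169, 1). Translations by multiples of 24 have trivial multiplier, so the terms depend only on
  b modulo 169 and 13.\<close>

definition hecke :: "(complex \<Rightarrow> complex) \<Rightarrow> complex \<Rightarrow> complex" where
  "hecke F t = (\<Sum>b\<in>{0..<169}. F ((t + 24 * of_int b) / 169)) / 169 +
     13 * of_real (sqrt 13) * (\<Sum>b\<in>{0..<13}. of_int (chi b) * F (t + 24 * of_int b / 13)) +
     13 ^ 5 * F (169 * t)"

lemma has_sum_finite_sum:
  fixes f :: "'i \<Rightarrow> 'a \<Rightarrow> complex"
  assumes "finite I" "\<And>i. i \<in> I \<Longrightarrow> (f i has_sum S i) A"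
  shows "((\<lambda>x. \<Sum>i\<in>I. f i x) has_sum (\<Sum>i\<in>I. S i)) A"
  using assms by (induction I rule: finite_induct) (auto intro!: has_sum_add)

lemma hecke_expansion:
  assumes F: "mform F a" and t: "Im t > 0"
  shows "((\<lambda>r. of_int (hecke_coeff a r) * qexp (of_int r * t / 24)) has_sum hecke F t) UNIV"
proof -
  have exp: "((\<lambda>r. of_int (a r) * qexp (of_int r * u / 24)) has_sum F u) UNIV" if "Im u > 0" for u
    using F that by (simp add: mform_def)
  \<comment> \<open>Averaging over b keeps exactly the indices divisible by 169.\<close>
  have 1: "((\<lambda>r. of_int (a (169 * r)) * qexp (of_int r * t / 24)) has_sum
      (\<Sum>b\<in>{0..<169}. F ((t + 24 * of_int b) / 169)) / 169) UNIV"
  proof -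
    have "((\<lambda>r. inverse 169 * (\<Sum>b\<in>{0..<169}. of_int (a r) * qexp (of_int r * ((t + 24 * of_int b) / 169) / 24))) has_sum
      inverse 169 * (\<Sum>b\<in>{0..<169}. F ((t + 24 * of_int b) / 169))) UNIV"
      by (intro has_sum_cmult_right has_sum_finite_sum exp) (use t in auto)
    also have "(\<lambda>r. inverse 169 * (\<Sum>b\<in>{0..<169}. of_int (a r) * qexp (of_int r * ((t + 24 * of_int b) / 169) / 24))) =
      (\<lambda>r. if 169 dvd r then of_int (a r) * qexp (of_int r / 169 * t / 24) else 0)"
    proof
      fix r :: int
      have "qexp (of_int r * ((t + 24 * of_int b) / 169) / 24) = qexp (of_int r / 169 * t / 24) * qexp (of_int (b * r) / 169)" for b
        unfolding qexp_add[symmetric] by (rule arg_cong[of _ _ qexp]) (simp add: field_simps)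
      then have "(\<Sum>b\<in>{0..<169}. of_int (a r) * qexp (of_int r * ((t + 24 * of_int b) / 169) / 24)) =
        of_int (a r) * qexp (of_int r / 169 * t / 24) * (\<Sum>b\<in>{0..<169}. qexp (of_int (b * r) / 169))"
        by (simp add: sum_distrib_left mult.assoc)
      also have "(\<Sum>b\<in>{0..<169}. qexp (of_int (b * r) / 169)) = (if 169 dvd r then 169 else 0)"
        using sum_roots_of_unity[of 169 r] by simp
      finally show "inverse 169 * (\<Sum>b\<in>{0..<169}. of_int (a r) * qexp (of_int r * ((t + 24 * of_int b) / 169) / 24)) =
        (if 169 dvd r then of_int (a r) * qexp (of_int r / 169 * t / 24) else 0)" by simp
    qed
    finally have "((\<lambda>r. if 169 dvd r then of_int (a r) * qexp (of_int r / 169 * t / 24) else 0) has_sum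
      inverse 169 * (\<Sum>b\<in>{0..<169}. F ((t + 24 * of_int b) / 169))) (range (\<lambda>m. 169 * m))"
      by (rule has_sum_cong_neutral[THEN iffD1, rotated 3]) auto
    then show ?thesis
      by (subst (asm) has_sum_reindex) (auto simp: o_def inj_on_def field_simps)
  qed
  \<comment> \<open>The sum over b is a Gauss sum, whose factor sqrt 13 completes 13 sqrt 13 to
    169.\<close>
  have 2: "((\<lambda>r. of_int (169 * gauss_sign * chi r * a r) * qexp (of_int r * t / 24)) has_sum
      13 * of_real (sqrt 13) * (\<Sum>b\<in>{0..<13}. of_int (chi b) * F (t + 24 * of_int b / 13))) UNIV"
  proof -
    have "((\<lambda>r. 13 * of_real (sqrt 13) * (\<Sum>b\<in>{0..<13}. of_int (chi b) * (of_int (a r) * qexp (of_int r * (t + 24 * of_int b / 13) / 24)))) has_sum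
      13 * of_real (sqrt 13) * (\<Sum>b\<in>{0..<13}. of_int (chi b) * F (t + 24 * of_int b / 13))) UNIV"
      by (intro has_sum_cmult_right has_sum_finite_sum exp) (use t in auto)
    also have "(\<lambda>r. 13 * of_real (sqrt 13) * (\<Sum>b\<in>{0..<13}. of_int (chi b) * (of_int (a r) * qexp (of_int r * (t + 24 * of_int b / 13) / 24)))) =
      (\<lambda>r. of_int (169 * gauss_sign * chi r * a r) * qexp (of_int r * t / 24))"
    proof
      fix r :: int
      have "qexp (of_int r * (t + 24 * of_int b / 13) / 24) = qexp (of_int r * t / 24) * qexp (of_int (b * r) / 13)" for b
        unfolding qexp_add[symmetric] by (rule arg_cong[of _ _ qexp]) (simp add: field_simps)
      then have "(\<Sum>b\<in>{0..<13}. of_int (chi b) * (of_int (a r) * qexp (of_int r * (t + 24 * of_int b / 13) / 24))) =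
        of_int (a r) * qexp (of_int r * t / 24) * gauss_sum r"
        by (simp add: gauss_sum_def sum_distrib_left mult_ac)
      also have "13 * of_real (sqrt 13) * \<dots> = of_real (sqrt 13 * sqrt 13) * 13 * of_int (gauss_sign * chi r) * (of_int (a r) * qexp (of_int r * t / 24))"
        unfolding gauss_sum_sign of_real_mult by (simp only: mult_ac)
      also have "\<dots> = of_int (169 * gauss_sign * chi r * a r) * qexp (of_int r * t / 24)" by simp
      finally show "13 * of_real (sqrt 13) * (\<Sum>b\<in>{0..<13}. of_int (chi b) * (of_int (a r) * qexp (of_int r * (t + 24 * of_int b / 13) / 24))) =
         of_int (169 * gauss_sign * chi r * a r) * qexp (of_int r * t / 24)" .
    qed
    finally show ?thesis .
  qed
  have 3: "((\<lambda>r. of_int (if 169 dvd r then 13 ^ 5 * a (r div 169) else 0) * qexp (of_int r * t / 24)) has_sum 13 ^ 5 * F (169 * t)) UNIV"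
  proof -
    have "((\<lambda>r. 13 ^ 5 * (of_int (a r) * qexp (of_int r * (169 * t) / 24))) has_sum 13 ^ 5 * F (169 * t)) UNIV"
      by (intro has_sum_cmult_right exp) (use t in auto)
    then have "((\<lambda>r. of_int (if 169 dvd r then 13 ^ 5 * a (r div 169) else 0) * qexp (of_int r * t / 24)) has_sum 13 ^ 5 * F (169 * t)) (range (\<lambda>m. 169 * m))"
      by (subst has_sum_reindex) (auto simp: o_def inj_on_def mult_ac)
    then show ?thesis by (rule has_sum_cong_neutral[THEN iffD1, rotated 3]) auto
  qed
  from has_sum_add[OF has_sum_add[OF 1 2] 3] show ?thesis
    by (simp add: hecke_coeff_def hecke_def algebra_simps)
qed

section \<open>The Hecke operator under inversion\<close>

lemma csqrt_scale:
  assumes "c > 0" "Re z > 0"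
  shows "csqrt (of_real (c ^ 2) * z) = of_real c * csqrt z"
proof (rule eq_if_power2_eq_Re_pos)
  show "(csqrt (of_real (c ^ 2) * z))^2 = (of_real c * csqrt z)^2"
    by (simp only: power_mult_distrib power2_csqrt of_real_power)
  have "Re (csqrt z) > 0" using csqrt_Re_gt[OF assms(2)] by linarith
  then show "Re (of_real c * csqrt z) > 0" using assms by (simp del: csqrt.simps)
  have "Re (of_real (c ^ 2) * z) > 0" using assms by (simp flip: of_real_power)
  from csqrt_Re_gt[OF this] show "Re (csqrt (of_real (c ^ 2) * z)) > 0" by linarith
qed

lemma Im_divide_of_int: "Im (z / of_int c) = Im z / of_int c"
  using Im_divide_of_real[of z "of_int c"] by simp

text \<open>At u = (t - d) / c the automorphy factor c u + d is t itself, so all matrices share the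
  factor \<open>csqrt (-\<i> * t) ^ 7\<close> and the sums over b can be compared term by
  term.\<close>

lemma mult_at_apply:
  assumes "mult_at F a b c d k" "Im t > 0"
  shows "F ((-1 / t + of_int a) / of_int c) = e24 k * csqrt (-\<i> * t) ^ 7 * F ((t - of_int d) / of_int c)"
proof -
  have c: "c > 0" and det: "a * d - b * c = 1" using assms(1) by (auto simp: mult_at_def)
  have t0: "t \<noteq> 0" using assms(2) by auto
  define u where "u = (t - of_int d) / of_int c"
  have "of_int c * u + of_int d = t" using c by (simp add: u_def)
  moreover have "of_int a * u + of_int b = (of_int a * t - 1) / of_int c"
  proof -
    have "of_int a * u + of_int b = (of_int a * t - of_int (a * d - b * c)) / of_int c"
      using c by (simp add: u_def field_simps)
    then show ?thesis unfolding det by simp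
  qed
  moreover have "(of_int a * t - 1) / of_int c / t = (-1 / t + of_int a) / of_int c"
    using t0 c by (simp add: field_simps)
  moreover have "Im u > 0" using assms(2) c by (simp add: u_def Im_divide_of_int)
  ultimately show ?thesis using assms(1) unfolding mult_at_def u_def by metis
qed

text \<open>For b prime to 13 this is the residue b' with 576 b b' = -1 modulo 169, to which
  inversion moves b: \<open>d\<close> inverts 24 b, and 24 * 7 = -1 modulo 169. Denominators drop
  strictly from 169, so fuel 200 is enough.\<close>

definition inv169 :: "int \<Rightarrow> int" where
  "inv169 b = (case cf_mult 200 (24 * b) 169 of (_, d, _) \<Rightarrow> (7 * d) mod 169)"

definition inv13 :: "int \<Rightarrow> int" where
  "inv13 b = (case cf_mult 200 (24 * b) 13 of (_, d, _) \<Rightarrow> (7 * d) mod 13)"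

definition units169 :: "int list" where "units169 = filter (\<lambda>b. b mod 13 \<noteq> 0) [1..168]"

text \<open>\<open>k + d\<close> is the multiplier exponent after the shift in
  \<open>inversion_169\<close>. It is trivial for the square modulus 169, whereas modulo 13 the sign
  \<open>chi b\<close> survives, 12 being the exponent of -1.\<close>

definition check169 :: "int \<Rightarrow> bool" where
  "check169 b \<longleftrightarrow> cf_ok 200 (24 * b) 169 \<and> inv169 b mod 13 \<noteq> 0 \<and>
     (case cf_mult 200 (24 * b) 169 of (_, d, k) \<Rightarrow> (k + d) mod 24 = 0)"

definition check13 :: "int \<Rightarrow> bool" where
  "check13 b \<longleftrightarrow> cf_ok 200 (24 * b) 13 \<and> chi (inv13 b) = chi b \<and> inv13 b \<noteq> 0 \<and>
     (case cf_mult 200 (24 * b) 13 of (_, d, k) \<Rightarrow> (k + 13 * d) mod 24 = (if chi b = 1 then 0 else 12))"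

lemma check169: "list_all check169 units169" by code_simp
lemma distinct169: "distinct (map inv169 units169)" by code_simp
lemma check13: "list_all check13 [1..12]" by code_simp
lemma distinct13: "distinct (map inv13 [1..12])" by code_simp

lemma weakly_modular_periodic:
  assumes F: "weakly_modular F" and t: "Im t > 0" and N: "N > 0"
  shows "F ((t + 24 * of_int (x mod N)) / of_int N) = F ((t + 24 * of_int x) / of_int N)"
proof -
  have "of_int x = (of_int N * of_int (x div N) + of_int (x mod N) :: complex)"
    by (simp flip: of_int_mult of_int_add)
  then have "(t + 24 * of_int x) / of_int N = (t + 24 * of_int (x mod N)) / of_int N + of_int (24 * (x div N))"
    using N by (simp add: field_simps)
  moreover have "Im ((t + 24 * of_int (x mod N)) / of_int N) > 0"
    using t N by (simp add: Im_divide_of_int)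
  ultimately show ?thesis
    using weakly_modular_shift[OF F, of "(t + 24 * of_int (x mod N)) / of_int N" "24 * (x div N)"]
    e24_24[of "- (x div N)"] by simp
qed

text \<open>A shift of \<open>mult_at\<close> replaces \<open>d\<close> by \<open>- 168 * d = - 24 * (7 * d)\<close>.\<close>

lemma inversion_169:
  assumes F: "weakly_modular F" and t: "Im t > 0" and b: "b \<in> set units169"
  shows "F ((-1 / t + 24 * of_int b) / 169) = csqrt (-\<i> * t) ^ 7 * F ((t + 24 * of_int (inv169 b)) / 169)"
proof -
  obtain x d k where r: "cf_mult 200 (24 * b) 169 = (x, d, k)" by (metis prod_cases3)
  have c: "cf_ok 200 (24 * b) 169" "(k + d) mod 24 = 0"
  proof -
    have "check169 b" using check169 b by (simp only: list_all_iff)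
    then show "cf_ok 200 (24 * b) 169" "(k + d) mod 24 = 0"
      unfolding check169_def r prod.case by blast+
  qed
  have "mult_at F (24 * b) (x + (- d) * (24 * b)) 169 (d + (- d) * 169) (k - (- d))"
    by (rule mult_at_shift[OF F mult_at_cf_mult[OF F c(1) r]])
  from mult_at_apply[OF this t]
  have "F ((-1 / t + of_int (24 * b)) / of_int 169) =
     e24 (k + d) * csqrt (-\<i> * t) ^ 7 * F ((t - of_int (d + (- d) * 169)) / of_int 169)" by (simp only: diff_minus_eq_add)
  also have "e24 (k + d) = 1" using e24_mod[of "k + d"] c(2) by simp
  also have "t - of_int (d + (- d) * 169) = t + 24 * of_int (7 * d)" by simp
  also have "F ((t + 24 * of_int (7 * d)) / of_int 169) = F ((t + 24 * of_int (inv169 b)) / of_int 169)"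
    using weakly_modular_periodic[OF F t, of 169 "7 * d"] r by (simp add: inv169_def)
  finally show ?thesis by simp
qed

lemma inversion_13:
  assumes F: "weakly_modular F" and t: "Im t > 0" and b: "b \<in> {1..12}"
  shows "F ((-1 / t + 24 * of_int b) / 13) =
    of_int (chi b) * csqrt (-\<i> * t) ^ 7 * F ((t + 24 * of_int (inv13 b)) / 13)"
proof -
  obtain x d k where r: "cf_mult 200 (24 * b) 13 = (x, d, k)" by (metis prod_cases3)
  have c: "cf_ok 200 (24 * b) 13" "(k + 13 * d) mod 24 = (if chi b = 1 then 0 else 12)"
  proof -
    have "check13 b" using check13 b by (simp add: list_all_iff)
    then show "cf_ok 200 (24 * b) 13" "(k + 13 * d) mod 24 = (if chi b = 1 then 0 else 12)"
      unfolding check13_def r prod.case by blast+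
  qed
  \<comment> \<open>The shift by - 13 d again turns d into d - 169 d = - 24 * (7 * d).\<close>
  have "mult_at F (24 * b) (x + (- 13 * d) * (24 * b)) 13 (d + (- 13 * d) * 13) (k - (- 13 * d))"
    by (rule mult_at_shift[OF F mult_at_cf_mult[OF F c(1) r]])
  from mult_at_apply[OF this t]
  have "F ((-1 / t + of_int (24 * b)) / of_int 13) =
     e24 (k + 13 * d) * csqrt (-\<i> * t) ^ 7 * F ((t - of_int (d + (- 13 * d) * 13)) / of_int 13)"
    by (simp only: diff_minus_eq_add mult_minus_left)
  also have "e24 (k + 13 * d) = of_int (chi b)"
  proof -
    have "\<not> 13 dvd b" using b by (auto dest: zdvd_imp_le)
    then show ?thesis
      using e24_mod[of "k + 13 * d"] c(2) e24_12 by (auto simp: chi_def split: if_splits)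
  qed
  also have "t - of_int (d + (- 13 * d) * 13) = t + 24 * of_int (7 * d)" by simp
  also have "F ((t + 24 * of_int (7 * d)) / of_int 13) = F ((t + 24 * of_int (inv13 b)) / of_int 13)"
    using weakly_modular_periodic[OF F t, of 13 "7 * d"] r by (simp add: inv13_def)
  finally show ?thesis by simp
qed

lemma bij_betw_inv169: "bij_betw inv169 (set units169) (set units169)"
proof -
  have "inj_on inv169 (set units169)" using distinct169 by (simp add: distinct_map)
  moreover have "inv169 ` set units169 \<subseteq> set units169"
  proof safe
    fix b assume "b \<in> set units169"
    then have "inv169 b mod 13 \<noteq> 0" using check169 by (auto simp: list_all_iff check169_def)
    moreover have "0 \<le> inv169 b" "inv169 b < 169" by (auto simp: inv169_def split: prod.split)
    moreover have "inv169 b \<noteq> 0" using calculation(1) by auto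
    ultimately show "inv169 b \<in> set units169" by (simp add: units169_def)
  qed
  ultimately show ?thesis by (simp add: bij_betw_def endo_inj_surj)
qed

lemma bij_betw_inv13: "bij_betw inv13 {1..12} {1..12}"
proof -
  have "inj_on inv13 {1..12}" using distinct13 by (simp add: distinct_map)
  moreover have "inv13 ` {1..12} \<subseteq> {1..12}"
  proof safe
    fix b :: int assume "b \<in> {1..12}"
    then have "inv13 b \<noteq> 0" using check13 by (auto simp: list_all_iff check13_def)
    moreover have "0 \<le> inv13 b" "inv13 b < 13" by (auto simp: inv13_def split: prod.split)
    ultimately show "inv13 b \<in> {1..12}" by simp
  qed
  ultimately show ?thesis by (simp add: bij_betw_def endo_inj_surj)
qed

lemma chi_inv13: "b \<in> {1..12} \<Longrightarrow> chi (inv13 b) = chi b"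
  using check13 by (auto simp: list_all_iff check13_def)

lemma sum_residues_169:
  fixes f :: "int \<Rightarrow> complex"
  shows "(\<Sum>b\<in>{0..<169}. f b) = f 0 + (\<Sum>b\<in>set units169. f b) + (\<Sum>b\<in>{1..12}. f (13 * b))"
proof -
  have "{0..<169} = insert 0 (set units169 \<union> (\<lambda>b. 13 * b) ` {1..12::int})"
  proof (intro equalityI subsetI)
    fix b :: int assume b: "b \<in> {0..<169}"
    show "b \<in> insert 0 (set units169 \<union> (\<lambda>b. 13 * b) ` {1..12})"
    proof (cases "b mod 13 = 0")
      case True
      then have b13: "b = 13 * (b div 13)" using mult_div_mod_eq[of 13 b] by linarith
      then have "b = 0 \<or> b div 13 \<in> {1..12}" using b by auto
      then show ?thesis using b13 by blast
    next
      case False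
      then have "b \<in> set units169" using b by (cases "b = 0") (auto simp: units169_def)
      then show ?thesis by blast
    qed
  qed (auto simp: units169_def)
  moreover have "sum f (insert 0 (set units169 \<union> (\<lambda>b. 13 * b) ` {1..12})) =
      f 0 + (sum f (set units169) + sum f ((\<lambda>b. 13 * b) ` {1..12::int}))"
  proof -
    have "0 \<notin> set units169 \<union> (\<lambda>b. 13 * b) ` {1..12::int}"
      "set units169 \<inter> (\<lambda>b. 13 * b) ` {1..12::int} = {}"
      by (auto simp: units169_def)
    then show ?thesis by (subst sum.insert) (auto simp: sum.union_disjoint)
  qed
  moreover have "sum f ((\<lambda>b. 13 * b) ` {1..12::int}) = (\<Sum>b\<in>{1..12}. f (13 * b))"
    by (subst sum.reindex) (auto simp: inj_on_def)
  ultimately show ?thesis by (simp add: add.assoc)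
qed

text \<open>Inversion exchanges the term b = 0 of the first sum with the term at 169 t, permutes the
  terms with b prime to 13, and exchanges the remaining ones with the character sum. The powers of
  13 agree: 13^7 / 169 = 13^5 and 13^3 sqrt 13 / 169 = 13 sqrt 13.\<close>

lemma hecke_inversion:
  assumes F: "mform F a" and t: "Im t > 0"
  shows "hecke F (-1 / t) = csqrt (-\<i> * t) ^ 7 * hecke F t"
proof -
  have wm: "weakly_modular F" using F by (simp add: mform_def)
  have t0: "t \<noteq> 0" using t by auto
  have t': "Im (-1 / t) > 0" using t by (simp add: Im_divide add_nonneg_pos divide_pos_pos)
  define \<sigma> where "\<sigma> = csqrt (-\<i> * t) ^ 7"
  define \<rho> where "\<rho> = complex_of_real (sqrt 13)"
  have rho2: "\<rho> ^ 2 = 13" by (simp add: \<rho>_def flip: of_real_power)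
  have rho0: "\<rho> \<noteq> 0" by (simp add: \<rho>_def)
  have "\<rho> ^ 7 = \<rho> * (\<rho> ^ 2) ^ 3" by (simp flip: power_mult power_Suc)
  then have rho7: "\<rho> ^ 7 = 2197 * \<rho>" unfolding rho2 by simp
  have scale: "csqrt (-\<i> * (of_real (c ^ 2) * u)) ^ 7 = of_real c ^ 7 * csqrt (-\<i> * u) ^ 7" if "c > 0" "Im u > 0" for c u
    using csqrt_scale[of c "-\<i> * u"] that by (simp add: power_mult_distrib mult.left_commute del: csqrt.simps)
  have Im: "Im (of_real (c ^ 2) * u) > 0" if "c > 0" "Im u > 0" for c u
    using that by (simp flip: of_real_power)
  have 1: "F ((-1 / t) / 169) = 13 ^ 7 * \<sigma> * F (169 * t)"
    using mform_inversion[OF F Im[of 13 t]] scale[of 13 t] t by (simp add: \<sigma>_def mult.commute del: csqrt.simps)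
  have 2: "F ((-1 / t + 24 * of_int b) / 169) = \<sigma> * F ((t + 24 * of_int (inv169 b)) / 169)" if "b \<in> set units169" for b
    using inversion_169[OF wm t that] by (simp add: \<sigma>_def)
  have 3: "F ((-1 / t + 24 * of_int (13 * b)) / 169) = of_int (chi b) * (2197 * \<rho>) * \<sigma> * F (t + 24 * of_int (inv13 b) / 13)"
    if b: "b \<in> {1..12}" for b
  proof -
    \<comment> \<open>A factor 13 cancels: (-1 / t + 24 * 13 b) / 169 = (-1 / (13 t) + 24 b) / 13,
      so the law for denominator 13 applies at 13 t.\<close>
    let ?u = "of_real (sqrt 13 ^ 2) * t"
    have "F ((-1 / ?u + 24 * of_int b) / 13) =
      of_int (chi b) * csqrt (-\<i> * ?u) ^ 7 * F ((?u + 24 * of_int (inv13 b)) / 13)"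
      by (rule inversion_13[OF wm Im b]) (use t in auto)
    moreover have "(-1 / ?u + 24 * of_int b) / 13 = (-1 / t + 24 * of_int (13 * b)) / 169"
      using t0 by (simp add: field_simps)
    moreover have "(?u + 24 * of_int (inv13 b)) / 13 = t + 24 * of_int (inv13 b) / 13"
      by (simp add: add_divide_distrib)
    moreover have "csqrt (-\<i> * ?u) ^ 7 = 2197 * \<rho> * \<sigma>"
      using scale[of "sqrt 13" t] t rho7 by (simp only: \<sigma>_def \<rho>_def) simp
    ultimately show ?thesis by (simp only: mult.assoc)
  qed
  have 4: "F (-1 / t + 24 * of_int b / 13) = of_int (chi b) * (\<sigma> / (2197 * \<rho>)) * F ((t + 24 * of_int (13 * inv13 b)) / 169)"
    if b: "b \<in> {1..12}" for b
  proof -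
    let ?u = "of_real ((1 / sqrt 13) ^ 2) * t"
    have u: "?u = t / 13" by (simp add: power_divide)
    have "F ((-1 / ?u + 24 * of_int b) / 13) =
      of_int (chi b) * csqrt (-\<i> * ?u) ^ 7 * F ((?u + 24 * of_int (inv13 b)) / 13)"
      by (rule inversion_13[OF wm Im b]) (use t in auto)
    moreover have "(-1 / (t / 13) + 24 * of_int b) / 13 = -1 / t + 24 * of_int b / 13"
      using t0 by (simp add: field_simps)
    moreover have "(t / 13 + 24 * of_int (inv13 b)) / 13 = (t + 24 * of_int (13 * inv13 b)) / 169"
      by (simp add: field_simps)
    moreover have "csqrt (-\<i> * ?u) ^ 7 = \<sigma> / (2197 * \<rho>)"
    proof -
      have "csqrt (-\<i> * ?u) ^ 7 = of_real (1 / sqrt 13) ^ 7 * \<sigma>"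
        unfolding \<sigma>_def by (rule scale) (use t in auto)
      also have "complex_of_real (1 / sqrt 13) = 1 / \<rho>" by (simp add: \<rho>_def)
      finally show ?thesis by (simp add: power_divide rho7)
    qed
    ultimately show ?thesis unfolding u by (simp only: mult.assoc)
  qed
  have 5: "F (169 * (-1 / t)) = \<sigma> / 13 ^ 7 * F (t / 169)"
  proof -
    let ?u = "of_real ((1 / 13) ^ 2) * t"
    have u: "?u = t / 169" by (simp add: power_divide)
    have "F (-1 / ?u) = csqrt (-\<i> * ?u) ^ 7 * F ?u"
      by (rule mform_inversion[OF F Im]) (use t in auto)
    moreover have "-1 / (t / 169) = 169 * (-1 / t)" using t0 by (simp add: field_simps)
    moreover have "csqrt (-\<i> * ?u) ^ 7 = of_real (1 / 13) ^ 7 * \<sigma>"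
      unfolding \<sigma>_def by (rule scale) (use t in auto)
    ultimately show ?thesis unfolding u by (simp add: power_divide)
  qed
  define U where "U = (\<Sum>b\<in>set units169. F ((t + 24 * of_int b) / 169))"
  define V where "V = (\<Sum>b\<in>{1..12}. F ((t + 24 * of_int (13 * b)) / 169))"
  define X where "X = (\<Sum>b\<in>{1..12}. of_int (chi b) * F (t + 24 * of_int b / 13))"
  have chi0: "(\<Sum>b\<in>{0..<13}. of_int (chi b) * f b) = (\<Sum>b\<in>{1..12}. of_int (chi b) * f b)" for f :: "int \<Rightarrow> complex"
  proof (rule sum.mono_neutral_right)
    show "\<forall>i\<in>{0..<13} - {1..12}. of_int (chi i) * f i = 0"
    proof
      fix i :: int assume "i \<in> {0..<13} - {1..12}"
      then have "i = 0" by auto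
      then show "of_int (chi i) * f i = 0" by (simp add: chi_def)
    qed
  qed auto
  have H: "hecke F t = (F (t / 169) + U + V) / 169 + 13 * \<rho> * X + 13 ^ 5 * F (169 * t)"
    unfolding hecke_def sum_residues_169 chi0 U_def V_def X_def \<rho>_def by simp
  have U': "(\<Sum>b\<in>set units169. F ((-1 / t + 24 * of_int b) / 169)) = \<sigma> * U"
  proof -
    have "(\<Sum>b\<in>set units169. F ((-1 / t + 24 * of_int b) / 169)) = (\<Sum>b\<in>set units169. \<sigma> * F ((t + 24 * of_int (inv169 b)) / 169))"
      by (rule sum.cong[OF refl 2])
    also have "\<dots> = (\<Sum>b\<in>set units169. \<sigma> * F ((t + 24 * of_int b) / 169))"
      by (rule sum.reindex_bij_betw[OF bij_betw_inv169])
    finally show ?thesis by (simp add: U_def sum_distrib_left)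
  qed
  have V': "(\<Sum>b\<in>{1..12}. F ((-1 / t + 24 * of_int (13 * b)) / 169)) = 2197 * \<rho> * \<sigma> * X"
  proof -
    have "(\<Sum>b\<in>{1..12}. F ((-1 / t + 24 * of_int (13 * b)) / 169)) =
        (\<Sum>b\<in>{1..12}. 2197 * \<rho> * \<sigma> * (of_int (chi (inv13 b)) * F (t + 24 * of_int (inv13 b) / 13)))"
    proof (rule sum.cong[OF refl])
      fix b :: int assume b: "b \<in> {1..12}"
      show "F ((-1 / t + 24 * of_int (13 * b)) / 169) =
        2197 * \<rho> * \<sigma> * (of_int (chi (inv13 b)) * F (t + 24 * of_int (inv13 b) / 13))"
        unfolding 3[OF b] chi_inv13[OF b] by (simp only: mult_ac)
    qed
    also have "\<dots> = (\<Sum>b\<in>{1..12}. 2197 * \<rho> * \<sigma> * (of_int (chi b) * F (t + 24 * of_int b / 13)))"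
      by (rule sum.reindex_bij_betw[OF bij_betw_inv13])
    finally show ?thesis by (simp add: X_def sum_distrib_left)
  qed
  have X': "(\<Sum>b\<in>{1..12}. of_int (chi b) * F (-1 / t + 24 * of_int b / 13)) = \<sigma> / (2197 * \<rho>) * V"
  proof -
    have "(\<Sum>b\<in>{1..12}. of_int (chi b) * F (-1 / t + 24 * of_int b / 13)) =
        (\<Sum>b\<in>{1..12}. \<sigma> / (2197 * \<rho>) * F ((t + 24 * of_int (13 * inv13 b)) / 169))"
    proof (rule sum.cong[OF refl])
      fix b :: int assume b: "b \<in> {1..12}"
      have "\<not> 13 dvd b" using b by (auto dest: zdvd_imp_le)
      then have "of_int (chi b) * of_int (chi b) = (1 :: complex)"
        using chi_square by (simp flip: of_int_mult)
      then show "of_int (chi b) * F (-1 / t + 24 * of_int b / 13) = \<sigma> / (2197 * \<rho>) * F ((t + 24 * of_int (13 * inv13 b)) / 169)"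
        unfolding 4[OF b] by (metis mult.assoc mult_1)
    qed
    also have "\<dots> = (\<Sum>b\<in>{1..12}. \<sigma> / (2197 * \<rho>) * F ((t + 24 * of_int (13 * b)) / 169))"
      by (rule sum.reindex_bij_betw[OF bij_betw_inv13])
    finally show ?thesis by (simp add: V_def sum_distrib_left)
  qed
  have "hecke F (-1 / t) = (F ((-1 / t) / 169) + (\<Sum>b\<in>set units169. F ((-1 / t + 24 * of_int b) / 169)) +
      (\<Sum>b\<in>{1..12}. F ((-1 / t + 24 * of_int (13 * b)) / 169))) / 169 +
      13 * \<rho> * (\<Sum>b\<in>{1..12}. of_int (chi b) * F (-1 / t + 24 * of_int b / 13)) + 13 ^ 5 * F (169 * (-1 / t))"
    unfolding hecke_def sum_residues_169 chi0 \<rho>_def by simp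
  also have "\<dots> = (13 ^ 7 * \<sigma> * F (169 * t) + \<sigma> * U + 2197 * \<rho> * \<sigma> * X) / 169 +
      13 * \<rho> * (\<sigma> / (2197 * \<rho>) * V) + 13 ^ 5 * (\<sigma> / 13 ^ 7 * F (t / 169))"
    unfolding 1 U' V' X' 5 ..
  also have "\<dots> = \<sigma> * hecke F t"
  proof -
    have "13 * \<rho> * (\<sigma> / (2197 * \<rho>) * V) = \<sigma> * V / 169" using rho0 by simp
    moreover have "(13 ^ 7 * \<sigma> * F (169 * t) + \<sigma> * U + 2197 * \<rho> * \<sigma> * X) / 169 =
        13 ^ 5 * \<sigma> * F (169 * t) + \<sigma> * U / 169 + 13 * \<rho> * \<sigma> * X"
      by (simp add: add_divide_distrib)
    ultimately show ?thesis
      unfolding H by (simp add: distrib_left add_divide_distrib)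
  qed
  finally show ?thesis by (simp only: \<sigma>_def)
qed

lemma mform_hecke:
  assumes F: "mform F a"
  shows "mform (hecke F) (hecke_coeff a)"
proof -
  obtain N where N: "\<And>r. r < N \<Longrightarrow> a r = 0" using F by (auto simp: mform_def)
  \<comment> \<open>Only for a bound that is at most 0 does r < 169 M bound all three indices 169 r,
    r and r / 169.\<close>
  define M where "M = min N 0"
  have M: "\<And>r. r < M \<Longrightarrow> a r = 0" "M \<le> 0" using N by (auto simp: M_def)
  have supp: "\<And>r. a r \<noteq> 0 \<Longrightarrow> r mod 24 = 23" using F by (simp add: mform_def)
  \<comment> \<open>169 = 7 * 24 + 1, so the operator preserves the residue 23 modulo 24.\<close>
  have mod24: "(169 * r) mod 24 = r mod 24" for r :: int
    using mod_mult_left_eq[of 169 24 r] by simp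
  show ?thesis
  proof (rule mformI)
    fix r assume r: "r < 169 * M"
    then have "169 * r < M" "r < M" "r div 169 < M" using M(2) by linarith+
    then show "hecke_coeff a r = 0" by (simp add: hecke_coeff_def M)
  next
    fix r assume "hecke_coeff a r \<noteq> 0"
    then have "a (169 * r) \<noteq> 0 \<or> a r \<noteq> 0 \<or> (169 dvd r \<and> a (r div 169) \<noteq> 0)"
      by (auto simp: hecke_coeff_def split: if_splits)
    then show "r mod 24 = 23"
    proof (elim disjE conjE)
      assume "a (169 * r) \<noteq> 0"
      from supp[OF this] show ?thesis unfolding mod24 .
    next
      assume "a r \<noteq> 0"
      from supp[OF this] show ?thesis .
    next
      assume "169 dvd r" "a (r div 169) \<noteq> 0"
      then obtain m where m: "r = 169 * m" "a m \<noteq> 0" by auto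
      from supp[OF m(2)] show ?thesis unfolding m(1) mod24 .
    qed
  qed (use hecke_expansion[OF F] hecke_inversion[OF F] in auto)
qed

section \<open>Divisibility of the coefficients\<close>

lemma mform_unique:
  assumes "mform F a" "mform G b" "\<And>r. r < 0 \<Longrightarrow> a r = b r"
  shows "a = b"
proof
  fix r
  have "a r + (- 1) * b r = 0"
    by (rule mform_vanishes[OF mform_add_scaled[OF assms(1,2)]]) (simp add: assms(3))
  then show "a r = b r" by simp
qed

text \<open>The coefficients of f_j; the choice is unique by \<open>mform_unique\<close>.\<close>

definition principal :: "nat \<Rightarrow> int \<Rightarrow> int" where
  "principal j = (SOME a. (\<exists>F. mform F a) \<and> (\<forall>r<0. a r = (if r = - (169 ^ j) then 1 else 0)))"

lemma principal:
  shows "\<exists>F. mform F (principal j)" and principal_neg: "\<And>r. r < 0 \<Longrightarrow> principal j r = (if r = - (169 ^ j) then 1 else 0)"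
proof -
  \<comment> \<open>This makes -169^j an admissible index -(24 i + 1), at which
    \<open>mform_basis\<close> provides a form.\<close>
  have "(169 ^ j :: int) mod 24 = 1"
    using power_mod[of "169 :: int" 24 j] by simp
  then have i: "24 * int (nat (169 ^ j div 24)) + 1 = 169 ^ j"
    using div_mult_mod_eq[of "169 ^ j :: int" 24] by (simp add: pos_imp_zdiv_nonneg_iff)
  obtain F a where a: "mform F a" "a (- (24 * int (nat (169 ^ j div 24)) + 1)) = 1"
    "\<And>r. r < 0 \<Longrightarrow> r \<noteq> - (24 * int (nat (169 ^ j div 24)) + 1) \<Longrightarrow> a r = 0"
    using mform_basis[of "nat (169 ^ j div 24)"] by metis
  have "\<exists>a. (\<exists>F. mform F a) \<and> (\<forall>r<0. a r = (if r = - (169 ^ j) then 1 else 0))"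
    using a unfolding i by metis
  from someI_ex[OF this]
  show "\<exists>F. mform F (principal j)" "\<And>r. r < 0 \<Longrightarrow> principal j r = (if r = - (169 ^ j) then 1 else 0)"
    unfolding principal_def[symmetric] by blast+
qed

lemma hecke_coeff_principal_neg:
  assumes "r < 0"
  shows "hecke_coeff (principal j) r = (if 169 * r = - (169 ^ j) then 1 else 0) +
     (if r = - (169 ^ j) then 169 * gauss_sign * chi r else 0) + (if r = - (169 ^ Suc j) then 13 ^ 5 else 0)"
proof -
  have "(if 169 dvd r then 13 ^ 5 * principal j (r div 169) else 0) = (if r = - (169 ^ Suc j) then 13 ^ 5 else (0 :: int))"
  proof (cases "169 dvd r")
    case True
    then obtain m where m: "r = 169 * m" by (auto elim: dvdE)
    then show ?thesis using assms by (simp add: principal_neg)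
  next
    case False
    then have "r \<noteq> - (169 ^ Suc j)" by auto
    then show ?thesis using False by simp
  qed
  then show ?thesis using assms by (simp add: hecke_coeff_def principal_neg)
qed

lemma hecke_coeff_principal_0:
  "hecke_coeff (principal 0) = (\<lambda>r. 169 * gauss_sign * chi (- 1) * principal 0 r + 13 ^ 5 * principal 1 r)"
proof -
  obtain F G where F: "mform F (principal 0)" and G: "mform G (principal 1)"
    using principal(1)[of 0] principal(1)[of 1] by blast
  obtain N where N: "\<And>r. r < N \<Longrightarrow> principal 0 r = 0" using F by (auto simp: mform_def)
  let ?c = "169 * gauss_sign * chi (- 1)"
  \<comment> \<open>\<open>mform_add_scaled\<close> leaves its first summand unscaled, so the
    multiple by \<open>?c\<close> is split as 1 + (\<open>?c\<close> - 1).\<close>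
  have *: "mform (\<lambda>t. (F t + of_int (?c - 1) * F t) + of_int (13 ^ 5) * G t)
      (\<lambda>r. (principal 0 r + (?c - 1) * principal 0 r) + 13 ^ 5 * principal 1 r)"
    by (intro mform_add_scaled F G)
  have "hecke_coeff (principal 0) = (\<lambda>r. (principal 0 r + (?c - 1) * principal 0 r) + 13 ^ 5 * principal 1 r)"
  proof (rule mform_unique[OF mform_hecke[OF F] *])
    fix r :: int assume r: "r < 0"
    have "169 * r \<noteq> - 1" by presburger
    then show "hecke_coeff (principal 0) r = (principal 0 r + (?c - 1) * principal 0 r) + 13 ^ 5 * principal 1 r"
      using r by (auto simp: hecke_coeff_principal_neg principal_neg)
  qed
  then show ?thesis by (simp add: algebra_simps)
qed

text \<open>The pole at -169^(j + 1) is divisible by 13, which kills the character term, and by 169,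
  so that a(169 r) now contributes the pole of \<open>principal j\<close>.\<close>

lemma hecke_coeff_principal_Suc:
  "hecke_coeff (principal (Suc j)) = (\<lambda>r. principal j r + 13 ^ 5 * principal (Suc (Suc j)) r)"
proof -
  obtain F G E where F: "mform F (principal (Suc j))" and G: "mform G (principal j)" and E: "mform E (principal (Suc (Suc j)))"
    using principal(1)[of "Suc j"] principal(1)[of j] principal(1)[of "Suc (Suc j)"] by blast
  have *: "mform (\<lambda>t. G t + of_int (13 ^ 5) * E t) (\<lambda>r. principal j r + 13 ^ 5 * principal (Suc (Suc j)) r)"
    by (intro mform_add_scaled G E)
  show ?thesis
  proof (rule mform_unique[OF mform_hecke[OF F] *])
    fix r :: int assume r: "r < 0"
    have "chi (- (169 ^ Suc j)) = 0" by (simp add: chi_def)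
    then show "hecke_coeff (principal (Suc j)) r = principal j r + 13 ^ 5 * principal (Suc (Suc j)) r"
      using r by (auto simp: hecke_coeff_principal_neg principal_neg)
  qed
qed

text \<open>The coefficient of \<open>principal j\<close> at \<open>169 ^ Suc k * m\<close> is read off from the Hecke relations
  at \<open>169 ^ k * m\<close>; the weights $13^5$ and $169$ there make up for every loss in \<open>k - j\<close>.\<close>

lemma principal_dvd: "169 ^ (k - j) dvd principal j (169 ^ k * m)"
proof (induction k arbitrary: j rule: less_induct)
  case (less k)
  show ?case
  proof (cases k)
    case (Suc l)
    let ?r = "169 ^ l * m"
    \<comment> \<open>\<open>i\<close> counts explicit factors 169 and \<open>e\<close> those from
      the induction hypothesis; all truncated subtractions reduce to one additive
      inequality.\<close>
    have le: "169 ^ (Suc l - j) dvd (169 ^ i * x :: int)" if "Suc l \<le> i + e + j" "169 ^ e dvd x" for i e x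
    proof -
      have "(169 ^ (Suc l - j) :: int) dvd 169 ^ i * 169 ^ e"
        unfolding power_add[symmetric] using that(1) by (intro le_imp_power_dvd) simp
      also have "169 ^ i * 169 ^ e dvd 169 ^ i * x" using that(2) by simp
      finally show ?thesis .
    qed
    have five: "(13 ^ 5 * x :: int) = 169 ^ 2 * (13 * x)" for x by simp
    have IH: "169 ^ (l - i) dvd principal i ?r" for i using less.IH[of l i] Suc by simp
    have a: "169 ^ (Suc l - j) dvd 169 * gauss_sign * chi ?r * principal j ?r"
    proof -
      have "169 ^ (Suc l - j) dvd 169 ^ 1 * (gauss_sign * chi ?r * principal j ?r)"
        by (rule le[of _ "l - j"]) (use IH[of j] in auto)
      then show ?thesis by (simp add: mult.assoc)
    qed
    have b: "169 ^ (Suc l - j) dvd (if 169 dvd ?r then 13 ^ 5 * principal j (?r div 169) else 0)"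
    proof (cases l)
      \<comment> \<open>No smaller instance is available here, but the exponent is at most 1 and
        169^2 is explicit.\<close>
      case 0
      then have "169 ^ (Suc l - j) dvd 169 ^ 2 * (13 * principal j (?r div 169))"
        by (intro le[of _ 0]) auto
      then show ?thesis by (cases "169 dvd ?r") (simp_all only: five if_True if_False dvd_0_right)
    next
      case (Suc i)
      then have r: "?r div 169 = 169 ^ i * m" by simp
      have "169 ^ (i - j) dvd principal j (169 ^ i * m)" using less.IH[of i j] \<open>k = Suc l\<close> Suc by simp
      then have "169 ^ (Suc l - j) dvd 169 ^ 2 * (13 * principal j (169 ^ i * m))"
        using Suc by (intro le[of _ "i - j"]) auto
      then show ?thesis
        unfolding r by (cases "169 dvd ?r") (simp_all only: five if_True if_False dvd_0_right)
    qed
    have c: "169 ^ (Suc l - j) dvd hecke_coeff (principal j) ?r"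
    proof (cases j)
      case 0
      have "169 ^ (Suc l - j) dvd 169 ^ 1 * (gauss_sign * chi (- 1) * principal 0 ?r)"
        by (rule le[of _ "l - 0"]) (use IH[of 0] in auto)
      moreover have "169 ^ (Suc l - j) dvd 13 ^ 5 * principal 1 ?r"
        unfolding five by (rule le[of _ "l - 1"]) (use IH[of 1] in auto)
      ultimately show ?thesis unfolding 0 hecke_coeff_principal_0 by (simp add: mult.assoc)
    next
      case (Suc i)
      \<comment> \<open>Passing from (k, j) to (k - 1, j + 1) loses two factors 169, which 13^5
        restores; passing to (k - 1, j - 1) loses none.\<close>
      have "169 ^ (Suc l - j) dvd 13 ^ 5 * principal (Suc (Suc i)) ?r"
        unfolding five by (rule le[of _ "l - Suc (Suc i)"]) (use IH[of "Suc (Suc i)"] Suc in auto)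
      moreover have "169 ^ (Suc l - j) dvd principal i ?r" using IH[of i] Suc by simp
      ultimately show ?thesis unfolding Suc hecke_coeff_principal_Suc by simp
    qed
    have "principal j (169 ^ k * m) = hecke_coeff (principal j) ?r - 169 * gauss_sign * chi ?r * principal j ?r
       - (if 169 dvd ?r then 13 ^ 5 * principal j (?r div 169) else 0)"
      by (simp add: hecke_coeff_def Suc mult.assoc)
    then show ?thesis using a b c Suc by simp
  qed simp
qed

lemma e4_eq_principal: "e4 n = principal 0 (24 * int n - 1)"
proof -
  obtain F where F: "mform F (principal 0)" using principal(1)[of 0] by blast
  \<comment> \<open>At negative indices both have a single 1, at -1.\<close>
  have "principal 0 = base_coeff 0"
  proof (rule mform_unique[OF F mform_base])
    fix r :: int assume "r < 0"
    then show "principal 0 r = base_coeff 0 r"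
      using base_coeff_below[of r 0] base_coeff_leading[of 0] by (cases "r = -1") (auto simp: principal_neg)
  qed
  moreover have "Abs_fps e4 = E4_fps * partition_fps"
  proof -
    have "Abs_fps e4 = Abs_fps e4 * (euler_fps * partition_fps)" by (simp add: euler_times_partition)
    then show ?thesis by (simp add: e4_generating_function flip: mult.assoc)
  qed
  then have "e4 n = fps_nth (E4_fps * partition_fps) n" by (metis fps_nth_Abs_fps)
  moreover have "(24 * int n - 1) mod 24 = 23"
  proof -
    have "24 * int n - 1 = 23 + 24 * (int n - 1)" by simp
    then show ?thesis by (simp only: mod_mult_self2) simp
  qed
  ultimately show ?thesis by (simp add: base_coeff_def)
qed

theorem theorem6p5:
  fixes k n :: nat
  assumes "k \<ge> 1"
  shows "[e4 (13 ^ (2 * k) * n + delta 13 (2 * k)) = 0] (mod 13 ^ (2 * k))"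
proof -
  define d where "d = delta 13 (2 * k)"
  have "prime (13 :: nat)" by simp
  then have "[24 * d = 1] (mod 13 ^ (2 * k))"
    using theI'[OF ex1_delta[of 13 "2 * k"]] assms unfolding d_def delta_def by simp
  then have "[int (24 * d) = int 1] (mod int (13 ^ (2 * k)))" by (simp only: cong_int_iff)
  then have "int (13 ^ (2 * k)) dvd int (24 * d) - int 1" by (simp only: cong_iff_dvd_diff)
  then obtain m where "int (24 * d) - int 1 = int (13 ^ (2 * k)) * m" by (auto elim: dvdE)
  then have m: "24 * int d - 1 = 169 ^ k * m" by (simp add: power_mult)
  \<comment> \<open>The progression consists of those N for which the index 24 N - 1 is divisible by
    169^k.\<close>
  have "24 * int (13 ^ (2 * k) * n + d) - 1 = 169 ^ k * (24 * int n + m)"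
    using m by (simp add: power_mult distrib_left)
  then have "e4 (13 ^ (2 * k) * n + d) = principal 0 (169 ^ k * (24 * int n + m))"
    by (simp add: e4_eq_principal)
  then have "169 ^ k dvd e4 (13 ^ (2 * k) * n + d)"
    using principal_dvd[of k 0 "24 * int n + m"] by simp
  then show ?thesis by (simp add: cong_0_iff power_mult d_def)
qed

end
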